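(* Let $V$ be the Sierpiński gasket in $\mathbb{R}^{N-1}$ ($N\ge 2$) with intrinsic boundary $V_0$ and measure $\mu$. Let $M>0$, let $f:\mathbb{R}\to\mathbb{R}$ and $h:[-M,M]\to\mathbb{R}_+$ be continuous, let $F(\xi)=\int_0^\xi f(x)\,dx$, let $a: V\to\mathbb{R}$, let $(g_m)_{m\in\mathbb{N}}\subset C(V)$, and let $(u_m)_{m\in\mathbb{N}}\subset L^2(V,\mu)$ with $|u_m(y)|\le M$ for a.e. $y\in V$ and every $m$. Assume: (A1) $a\in L^1(V,\mu)$ and $a\le 0$ almost everywhere in $V$; (A2) there exist positive constants $g^1,g^2$ such that $g^1\le g_m(y)\le g^2$ for all $y\in V$ and all $m\in\mathbb{N}$, and positive constants $h^1,h^2$ such that $h^1\le h(v)\le h^2$ for all $v\in[-M,M]$; (A3) there exist $\varepsilon>0$ and constants $\theta_m>2+\varepsilon$ ($m\in\mathbb{N}$) such that $0<\theta_m F(v)\le v f(v)$ for all $v\in\mathbb{R}\setminus\{0\}$ and all $m$; moreover, there is a constant $c>0$ such that $\frac12-\frac1{\theta_m}\ge c$ for all $m$; (A4) there are constants $M_1>0$ and $\beta_m>0$ ($m\in\mathbb{N}$) such that, for all $m$, $$\max_{y\in V,\ |v|\le M_1,\ |u|\le M} |g_m(y)f(v)h(u)| \le \frac{M_1}{2(\beta_m+1)(2N+3)^2}.$$ Let $g_m\to g_0$ in $C(V)$ and $u_m\to u_0$ in $L^2(V,\mu)$. Then the problem $$\begin{cases}\Delta x(y)+a(y)x(y)+g_0(y)f(x(y))h(u_0(y))=0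 & \text{for a.e. } y\in V\setminus V_0,\\ x|_{V_0}=0\end{cases}$$ has a nontrivial (i.e. not identically zero) weak solution $x\in H_0^1(V)$.
   Context: Sierpiński gasket: Let $N\ge2$ and let $p_1,\dots,p_N\in\mathbb{R}^{N-1}$ satisfy $|p_i-p_j|=1$ for $i\ne j$. Put $S_i(x)=\frac12x+\frac12p_i$ on $\mathbb{R}^{N-1}$ and $G(A)=\bigcup_{i=1}^N S_i(A)$ for $A\subset\mathbb{R}^{N-1}$. $V$ is the unique non-empty compact subset of $\mathbb{R}^{N-1}$ with $G(V)=V$. Put $V_0=\{p_1,\dots,p_N\}$ (the intrinsic boundary), $V_m=G(V_{m-1})$ for $m\ge1$; then $V=\overline{\bigcup_{m\ge0}V_m}$. $V$ carries the Euclidean topology, and $\mu$ is the restriction to $V$ of the normalized $\log N/\log 2$-dimensional Hausdorff measure, so $\mu(V)=1$. $C(V)$ is the space of real continuous functions on $V$ with the supremum norm, and $C_0(V)=\{u\in C(V): u|_{V_0}=0\}$. $L^2(V)=L^2(V,\mu)$ with its usual norm. Energy: for $u,v:V\to\mathbb{R}$ let $$\mathcal{W}_m(u,v)=\left(\frac{N+2}{N}\right)^m\sum_{x,y\in V_m,\ |x-y|=2^{-m}}(u(x)-u(y))(v(x)-v(y)),\qquad W_m(u)=\mathcal{W}_m(u,u).$$ The sequence $W_m(u)$ is nondecreasing in $m$; put $W(u)=\lim_m W_m(u)$. $H_0^1(V)=\{u\in C_0(V): W(u)<\infty\}$, which is a real Hilbert space with inner product $\mathcal{W}(u,v)=\lim_m\mathcal{W}_m(u,v)$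 and norm $\|u\|=\sqrt{W(u)}$. Weak solution: $\Delta$ is the weak Laplacian on $V$, determined by $\langle\Delta u|v\rangle=-\mathcal{W}(u,v)$ for $v\in H_0^1(V)$. A weak solution of the problem $\Delta x+a x+g f(x)h(u)=0$ on $V\setminus V_0$, $x|_{V_0}=0$, is a function $x\in H_0^1(V)$ such that for every $v\in H_0^1(V)$ $$\mathcal{W}(x,v)-\int_V a(y)x(y)v(y)\,d\mu-\int_V g(y)f(x(y))h(u(y))v(y)\,d\mu=0.$$ Solutions are understood in this weak sense. *)

theory Defs
  imports "HOL-Analysis.Analysis"
begin

section \<open>Hausdorff measure\<close>

text \<open>
  Used for \<open>s > 0\<close> only, where \<open>0 powr s = 0\<close> and \<open>diameter {} = 0\<close> make empty members of a
  cover cost nothing. Boundedness is required because \<^const>\<open>diameter\<close> has no meaningful value on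
  unbounded sets.
\<close>

definition hausdorff_premeasure :: "real \<Rightarrow> real \<Rightarrow> 'a::metric_space set \<Rightarrow> ennreal" where
  "hausdorff_premeasure s \<delta> A =
     (INF U \<in> {U :: nat \<Rightarrow> 'a set. A \<subseteq> (\<Union>i. U i) \<and> (\<forall>i. bounded (U i) \<and> diameter (U i) \<le> \<delta>)}.
        \<Sum>i. ennreal (diameter (U i) powr s))"

definition hausdorff_outer :: "real \<Rightarrow> 'a::metric_space set \<Rightarrow> ennreal" where
  "hausdorff_outer s A = (SUP \<delta> \<in> {0<..}. hausdorff_premeasure s \<delta> A)"

text \<open>
  The measure lives on all Caratheodory-measurable sets, not only on the Borel sets; hence it is
  complete, and functions defined or controlled only almost everywhere cause no measurability
  problems.
\<close>

definition hausdorff_measure :: "real \<Rightarrow> 'a::metric_space measure" where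
  "hausdorff_measure s =
     measure_of UNIV (lambda_system UNIV UNIV (hausdorff_outer s)) (hausdorff_outer s)"


section \<open>The Sierpinski gasket\<close>

definition gasket_map :: "nat \<Rightarrow> (nat \<Rightarrow> 'a::euclidean_space) \<Rightarrow> 'a set \<Rightarrow> 'a set" where
  "gasket_map N p A = (\<Union>i\<in>{1..N}. (\<lambda>x. (1/2) *\<^sub>R x + (1/2) *\<^sub>R p i) ` A)"

definition gasket :: "nat \<Rightarrow> (nat \<Rightarrow> 'a::euclidean_space) \<Rightarrow> 'a set" where
  "gasket N p = (THE K. K \<noteq> {} \<and> compact K \<and> gasket_map N p K = K)"

definition gasket_boundary :: "nat \<Rightarrow> (nat \<Rightarrow> 'a::euclidean_space) \<Rightarrow> 'a set" where
  "gasket_boundary N p = p ` {1..N}"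

definition gasket_vertices :: "nat \<Rightarrow> (nat \<Rightarrow> 'a::euclidean_space) \<Rightarrow> nat \<Rightarrow> 'a set" where
  "gasket_vertices N p m = (gasket_map N p ^^ m) (gasket_boundary N p)"

definition gasket_measure :: "nat \<Rightarrow> (nat \<Rightarrow> 'a::euclidean_space) \<Rightarrow> 'a measure" where
  "gasket_measure N p =
     (let s = ln (real N) / ln 2; V = gasket N p
      in scale_measure (inverse (emeasure (hausdorff_measure s) V))
           (restrict_space (hausdorff_measure s) V))"


section \<open>Function spaces on the gasket\<close>

text \<open>
  Functions on the gasket are represented by functions on the ambient space; their values outside
  the gasket are irrelevant to everything below. Elements of \<open>L\<^sup>2\<close> are represented by individual
  functions rather than by classes.
\<close>

definition square_integrable :: "'a measure \<Rightarrow> ('a \<Rightarrow> real) \<Rightarrow> bool" where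
  "square_integrable M u \<longleftrightarrow> u \<in> borel_measurable M \<and> integrable M (\<lambda>y. (u y)\<^sup>2)"

definition l2_norm :: "'a measure \<Rightarrow> ('a \<Rightarrow> real) \<Rightarrow> real" where
  "l2_norm M u = sqrt (\<integral>y. (u y)\<^sup>2 \<partial>M)"

text \<open>The sum ranges over ordered pairs, so every edge is counted twice.\<close>

definition energy_approx ::
    "nat \<Rightarrow> (nat \<Rightarrow> 'a::euclidean_space) \<Rightarrow> nat \<Rightarrow> ('a \<Rightarrow> real) \<Rightarrow> ('a \<Rightarrow> real) \<Rightarrow> real" where
  "energy_approx N p m u v =
     ((real N + 2) / real N) ^ m *
     (\<Sum>(x, y) \<in> {(x, y). x \<in> gasket_vertices N p m \<and> y \<in> gasket_vertices N p m \<and>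
                          norm (x - y) = 1 / 2 ^ m}.
        (u x - u y) * (v x - v y))"

text \<open>Extended-real valued, as the nondecreasing sequence may diverge.\<close>

definition energy :: "nat \<Rightarrow> (nat \<Rightarrow> 'a::euclidean_space) \<Rightarrow> ('a \<Rightarrow> real) \<Rightarrow> ereal" where
  "energy N p u = lim (\<lambda>m. ereal (energy_approx N p m u u))"

definition energy_form ::
    "nat \<Rightarrow> (nat \<Rightarrow> 'a::euclidean_space) \<Rightarrow> ('a \<Rightarrow> real) \<Rightarrow> ('a \<Rightarrow> real) \<Rightarrow> real" where
  "energy_form N p u v = lim (\<lambda>m. energy_approx N p m u v)"

definition H01 :: "nat \<Rightarrow> (nat \<Rightarrow> 'a::euclidean_space) \<Rightarrow> ('a \<Rightarrow> real) set" where
  "H01 N p = {u. continuous_on (gasket N p) u \<and> (\<forall>y\<in>gasket_boundary N p. u y = 0) \<and>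
                 energy N p u < \<infinity>}"

definition weak_solution ::
    "nat \<Rightarrow> (nat \<Rightarrow> 'a::euclidean_space) \<Rightarrow> ('a \<Rightarrow> real) \<Rightarrow> ('a \<Rightarrow> real) \<Rightarrow> (real \<Rightarrow> real) \<Rightarrow>
     (real \<Rightarrow> real) \<Rightarrow> ('a \<Rightarrow> real) \<Rightarrow> ('a \<Rightarrow> real) \<Rightarrow> bool" where
  "weak_solution N p a g f h u x \<longleftrightarrow>
     x \<in> H01 N p \<and>
     (\<forall>v\<in>H01 N p.
        energy_form N p x v
        - (\<integral>y. a y * x y * v y \<partial>gasket_measure N p)
        - (\<integral>y. g y * f (x y) * h (u y) * v y \<partial>gasket_measure N p) = 0)"

end

theory Submission
  imports Defs "HOL-Complex_Analysis.Great_Picard" "HOL-Library.Function_Algebras"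
begin

text \<open>
  A weak solution is a critical point of the functional
  \<open>\<Phi> x = \<W>(x, x) / 2 - (\<integral> a x\<^sup>2) / 2 - \<integral> b F(x)\<close> on \<open>H\<^sub>0\<^sup>1\<close>, where \<open>b = g0 * h(u0)\<close>.
  The bounds on \<open>g m\<close> and \<open>u m\<close> pass to the limits \<open>g0\<close> and \<open>u0\<close>, so \<open>b\<close> lies between two
  positive constants almost everywhere. The superquadratic growth of \<open>F\<close> makes \<open>\<Phi>\<close> at least a
  multiple of the squared norm near \<open>0\<close> (\<open>near_zero\<close>) and negative somewhere (\<open>far_away\<close>); it also
  bounds the points of bounded level and small gradient (\<open>AR_bounded\<close>). Functions of bounded energy
  are equicontinuous, hence \<open>H\<^sub>0\<^sup>1\<close> embeds compactly into the continuous functions and the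
  Palais-Smale condition holds (\<open>palais_smale\<close>). The mountain pass theorem then provides a critical
  point other than \<open>0\<close>.

  The mountain pass theorem itself (\<open>mountain_pass\<close>) is proved without a gradient flow and without
  a minimax over paths: one fixed discrete descent step is iterated on all points of the segment from
  \<open>0\<close> to a point where \<open>\<Phi>\<close> is negative, and the connectedness of that segment yields an orbit that
  neither falls into the well at \<open>0\<close> nor reaches negative values.

  The energy needs care. The sum defining \<open>\<W>\<^sub>m\<close> runs over all pairs of vertices at distance
  \<open>1 / 2 ^ m\<close>. If \<open>N \<ge> 3\<close> and \<open>m \<ge> 2\<close>, these are not only the edges of the cells of level \<open>m\<close>: near
  each point where two cells meet there are pairs facing each other across a hole
  (\<open>close_pairs_Suc_subset\<close>). So \<open>\<W>\<^sub>m\<close> differs from the usual graph energy \<open>E m\<close>, which is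
  self-similar and increasing in \<open>m\<close>. The two have proportional limits, though. A
  harmonic function changes across a hole by a multiple of the difference of two corner values, the
  factor depending only on the level (\<open>harmonic_hole_diff\<close>), so on harmonic functions the pairs across
  holes only change the energy by a factor. This extends to functions that are harmonic in all
  cells of some level, and from there by density to all functions of finite energy, because
  \<open>W m u u \<le> 5 * E m u u\<close> uniformly in \<open>m\<close> (\<open>W_le\<close>, \<open>W_tendsto\<close>).

  On the side of the measure, the Hausdorff measure of the gasket is positive and finite, charges
  every nonempty relatively open set, measures Borel sets and is complete; completeness is what makes
  \<open>h(u0)\<close> measurable when \<open>\<bar>u0\<bar> \<le> M\<close> holds only almost everywhere.
\<close>

section \<open>A mountain pass theorem by discrete descent\<close>

lemma nonneg_quadratic_discriminant:
  fixes a b c :: real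
  assumes "\<And>t. 0 \<le> a + 2 * t * b + t\<^sup>2 * c" and "0 \<le> c"
  shows "b\<^sup>2 \<le> a * c"
proof (cases "c = 0")
  case True
  have "b = 0"
  proof (rule ccontr)
    assume "b \<noteq> 0"
    have "0 \<le> a + 2 * (- (a + 1) / (2 * b)) * b + (- (a + 1) / (2 * b))\<^sup>2 * c"
      by (rule assms)
    with True \<open>b \<noteq> 0\<close> show False by (simp add: field_simps)
  qed
  with True show ?thesis by simp
next
  case False
  with assms(2) have "c > 0" by simp
  have "0 \<le> a + 2 * (- b / c) * b + (- b / c)\<^sup>2 * c"
    by (rule assms)
  with \<open>c > 0\<close> show ?thesis
    by (simp add: field_simps power2_eq_square)
qed

text \<open>
  A complete semi-inner product on a subspace. It is a seminorm because functions on the ambient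
  space that agree on the gasket are not identified, and it lives on a carrier set because the
  function space depends on \<open>N\<close> and \<open>p\<close>.
\<close>

locale hilbert_seminorm =
  fixes H :: "'b::real_vector set" and ip :: "'b \<Rightarrow> 'b \<Rightarrow> real"
  assumes subspace_H: "subspace H"
    and ip_add_left: "\<And>x y z. x \<in> H \<Longrightarrow> y \<in> H \<Longrightarrow> z \<in> H \<Longrightarrow> ip (x + y) z = ip x z + ip y z"
    and ip_scale_left: "\<And>c x z. x \<in> H \<Longrightarrow> z \<in> H \<Longrightarrow> ip (c *\<^sub>R x) z = c * ip x z"
    and ip_sym: "\<And>x y. x \<in> H \<Longrightarrow> y \<in> H \<Longrightarrow> ip x y = ip y x"
    and ip_nonneg: "\<And>x. x \<in> H \<Longrightarrow> 0 \<le> ip x x"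
    and complete: "\<And>X. (\<And>n. X n \<in> H) \<Longrightarrow>
      (\<And>e. e > 0 \<Longrightarrow> \<exists>n0. \<forall>m\<ge>n0. \<forall>n\<ge>n0. sqrt (ip (X m - X n) (X m - X n)) < e) \<Longrightarrow>
      \<exists>x\<in>H. (\<lambda>n. sqrt (ip (X n - x) (X n - x))) \<longlonglongrightarrow> 0"
begin

definition nrm :: "'b \<Rightarrow> real" where "nrm x = sqrt (ip x x)"

lemma H_closed [simp, intro]:
  "0 \<in> H" "x \<in> H \<Longrightarrow> y \<in> H \<Longrightarrow> x + y \<in> H" "x \<in> H \<Longrightarrow> y \<in> H \<Longrightarrow> x - y \<in> H"
  "x \<in> H \<Longrightarrow> c *\<^sub>R x \<in> H" "x \<in> H \<Longrightarrow> - x \<in> H"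
  using subspace_H by (auto simp: subspace_0 subspace_add subspace_diff subspace_scale subspace_neg)

lemma ip_add_right: "x \<in> H \<Longrightarrow> y \<in> H \<Longrightarrow> z \<in> H \<Longrightarrow> ip z (x + y) = ip z x + ip z y"
  by (metis H_closed(2) ip_add_left ip_sym)

lemma ip_scale_right: "x \<in> H \<Longrightarrow> z \<in> H \<Longrightarrow> ip z (c *\<^sub>R x) = c * ip z x"
  by (metis H_closed(4) ip_scale_left ip_sym)

lemma ip_minus_left: "x \<in> H \<Longrightarrow> z \<in> H \<Longrightarrow> ip (- x) z = - ip x z"
  using ip_scale_left[of x z "-1"] by simp

lemma ip_minus_right: "x \<in> H \<Longrightarrow> z \<in> H \<Longrightarrow> ip z (- x) = - ip z x"
  using ip_scale_right[of x z "-1"] by simp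

lemma ip_diff_left: "x \<in> H \<Longrightarrow> y \<in> H \<Longrightarrow> z \<in> H \<Longrightarrow> ip (x - y) z = ip x z - ip y z"
  using ip_add_left[of x "-y" z] by (simp add: ip_minus_left)

lemma ip_diff_right: "x \<in> H \<Longrightarrow> y \<in> H \<Longrightarrow> z \<in> H \<Longrightarrow> ip z (x - y) = ip z x - ip z y"
  using ip_add_right[of x "-y" z] by (simp add: ip_minus_right)

lemmas ip_simps = ip_add_left ip_add_right ip_scale_left ip_scale_right ip_diff_left ip_diff_right
  ip_minus_left ip_minus_right

lemma nrm_nonneg [simp]: "x \<in> H \<Longrightarrow> 0 \<le> nrm x"
  by (simp add: nrm_def ip_nonneg)

lemma nrm_sq: "x \<in> H \<Longrightarrow> (nrm x)\<^sup>2 = ip x x"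
  by (simp add: nrm_def ip_nonneg)

lemma Cauchy_Schwarz:
  assumes "x \<in> H" "y \<in> H"
  shows "\<bar>ip x y\<bar> \<le> nrm x * nrm y"
proof -
  have "(ip x y)\<^sup>2 \<le> ip x x * ip y y"
  proof (rule nonneg_quadratic_discriminant)
    fix t :: real
    have "0 \<le> ip (x + t *\<^sub>R y) (x + t *\<^sub>R y)"
      using assms by (intro ip_nonneg) auto
    also have "\<dots> = ip x x + 2 * t * ip x y + t\<^sup>2 * ip y y"
      using assms ip_sym[of x y] by (simp add: ip_simps power2_eq_square algebra_simps)
    finally show "0 \<le> ip x x + 2 * t * ip x y + t\<^sup>2 * ip y y" .
  qed (use assms ip_nonneg in auto)
  also have "\<dots> = (nrm x * nrm y)\<^sup>2"
    using assms by (simp add: power_mult_distrib nrm_sq)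
  finally show ?thesis
    using assms by (metis abs_le_square_iff abs_of_nonneg mult_nonneg_nonneg nrm_nonneg)
qed

lemma nrm_scale: "x \<in> H \<Longrightarrow> nrm (c *\<^sub>R x) = \<bar>c\<bar> * nrm x"
  by (simp add: nrm_def ip_simps real_sqrt_mult flip: mult.assoc)

lemma nrm_zero [simp]: "nrm 0 = 0"
  using nrm_scale[of 0 0] by simp

lemma nrm_minus: "x \<in> H \<Longrightarrow> nrm (- x) = nrm x"
  using nrm_scale[of x "-1"] by simp

lemma nrm_triangle:
  assumes "x \<in> H" "y \<in> H"
  shows "nrm (x + y) \<le> nrm x + nrm y"
proof (rule power2_le_imp_le)
  have "(nrm (x + y))\<^sup>2 = ip x x + 2 * ip x y + ip y y"
    using assms ip_sym[of x y] by (simp add: nrm_sq ip_simps)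
  also have "\<dots> \<le> (nrm x + nrm y)\<^sup>2"
    using Cauchy_Schwarz[OF assms] assms by (simp add: power2_sum nrm_sq)
  finally show "(nrm (x + y))\<^sup>2 \<le> (nrm x + nrm y)\<^sup>2" .
qed (use assms in auto)

lemma nrm_triangle3:
  assumes "x \<in> H" "y \<in> H" "z \<in> H"
  shows "nrm (x + (y + z)) \<le> nrm x + (nrm y + nrm z)"
  using nrm_triangle[of x "y + z"] nrm_triangle[of y z] assms by fastforce

lemma nrm_diff_triangle:
  assumes "x \<in> H" "y \<in> H"
  shows "\<bar>nrm x - nrm y\<bar> \<le> nrm (x - y)"
  using nrm_triangle[of "x - y" y] nrm_triangle[of "y - x" x] nrm_minus[of "x - y"] assms
  by (simp add: abs_le_iff)

lemma nrm_tendsto: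
  assumes "\<And>n. X n \<in> H" "x \<in> H" "(\<lambda>n. nrm (X n - x)) \<longlonglongrightarrow> 0"
  shows "(\<lambda>n. nrm (X n)) \<longlonglongrightarrow> nrm x"
proof -
  have "(\<lambda>n. nrm (X n) - nrm x) \<longlonglongrightarrow> 0"
    by (rule Lim_null_comparison[OF _ assms(3)]) (use nrm_diff_triangle assms in auto)
  then show ?thesis by (simp add: LIM_zero_iff)
qed

lemma ip_tendsto:
  assumes "\<And>n. X n \<in> H" "x \<in> H" "(\<lambda>n. nrm (X n - x)) \<longlonglongrightarrow> 0" "v \<in> H"
  shows "(\<lambda>n. ip (X n) v) \<longlonglongrightarrow> ip x v"
proof -
  have "(\<lambda>n. nrm (X n - x) * nrm v) \<longlonglongrightarrow> 0"
    using tendsto_mult_right[OF assms(3), of "nrm v"] by simp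
  then have "(\<lambda>n. ip (X n) v - ip x v) \<longlonglongrightarrow> 0"
    by (rule Lim_null_comparison[rotated])
      (use Cauchy_Schwarz[of "X _ - x" v] assms in \<open>auto simp: ip_simps\<close>)
  then show ?thesis by (simp add: LIM_zero_iff)
qed

text \<open>
  The functional \<open>v \<mapsto> ip v v - 2 * l v\<close> has a minimiser: by the parallelogram law, every minimising
  sequence is a Cauchy sequence. Along such a sequence, almost minimality in the direction \<open>v\<close> is a
  quadratic inequality whose discriminant bounds \<open>ip (X n) v - l v\<close>.
\<close>

lemma Riesz_representation:
  assumes add: "\<And>v w. v \<in> H \<Longrightarrow> w \<in> H \<Longrightarrow> l (v + w) = l v + l w"
    and scale: "\<And>c v. v \<in> H \<Longrightarrow> l (c *\<^sub>R v) = c * l v"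
    and bound: "\<And>v. v \<in> H \<Longrightarrow> \<bar>l v\<bar> \<le> L * nrm v"
  shows "\<exists>r\<in>H. \<forall>v\<in>H. ip r v = l v"
proof -
  define J where "J v = ip v v - 2 * l v" for v
  define d where "d = Inf (J ` H)"
  have low: "- L\<^sup>2 \<le> J v" if "v \<in> H" for v
  proof -
    have "0 \<le> (nrm v - L)\<^sup>2" by simp
    also have "\<dots> = ip v v - 2 * (L * nrm v) + L\<^sup>2"
      using that by (simp add: power2_diff nrm_sq algebra_simps)
    also have "\<dots> \<le> J v + L\<^sup>2"
      using bound[OF that] by (simp add: J_def abs_le_iff)
    finally show ?thesis by simp
  qed
  have bdd: "bdd_below (J ` H)"
    using low by (intro bdd_belowI[of _ "- L\<^sup>2"]) auto
  have dle: "d \<le> J v" if "v \<in> H" for v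
    unfolding d_def using bdd that by (intro cInf_lower) auto
  have ne: "J ` H \<noteq> {}"
    using H_closed(1) by auto
  have "\<exists>v. v \<in> H \<and> J v < d + 1 / (Suc n)" for n
    using cInf_lessD[OF ne, of "d + 1 / Suc n"] by (auto simp: d_def)
  then obtain X where X: "\<And>n. X n \<in> H" "\<And>n. J (X n) < d + 1 / (Suc n)"
    by metis
  have mid: "ip (x - y) (x - y) \<le> 2 * (J x - d) + 2 * (J y - d)" if "x \<in> H" "y \<in> H" for x y
  proof -
    have "J ((1/2) *\<^sub>R (x + y)) = J x / 2 + J y / 2 - ip (x - y) (x - y) / 4"
      using that ip_sym[of x y]
      by (simp add: J_def ip_simps add scale) (simp add: field_simps)
    with dle[of "(1/2) *\<^sub>R (x + y)"] that show ?thesis by auto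
  qed
  have "\<exists>x\<in>H. (\<lambda>n. sqrt (ip (X n - x) (X n - x))) \<longlonglongrightarrow> 0"
  proof (rule complete)
    fix e :: real assume "e > 0"
    then obtain n0 where n0: "1 / real (Suc n0) < e\<^sup>2 / 4"
      using nat_approx_posE[of "e\<^sup>2/4"] by (auto simp: zero_less_power)
    have "sqrt (ip (X m - X n) (X m - X n)) < e" if "m \<ge> n0" "n \<ge> n0" for m n
    proof -
      have *: "1 / real (Suc k) < e\<^sup>2 / 4" if "k \<ge> n0" for k
        using n0 that by (smt (verit) Suc_le_mono frac_le of_nat_0_less_iff of_nat_mono zero_less_Suc)
      have "ip (X m - X n) (X m - X n) < e\<^sup>2"
        using mid[OF X(1) X(1), of m n] X(2)[of m] X(2)[of n] *[OF that(1)] *[OF that(2)] by argo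
      then show ?thesis
        using \<open>e > 0\<close> by (simp add: real_sqrt_less_iff real_less_lsqrt)
    qed
    then show "\<exists>n0. \<forall>m\<ge>n0. \<forall>n\<ge>n0. sqrt (ip (X m - X n) (X m - X n)) < e" by blast
  qed (rule X)
  then obtain r where r: "r \<in> H" "(\<lambda>n. nrm (X n - r)) \<longlonglongrightarrow> 0"
    by (auto simp: nrm_def)
  have "ip r v = l v" if v: "v \<in> H" for v
  proof -
    have sq: "(ip (X n) v - l v)\<^sup>2 \<le> 1 / Suc n * ip v v" for n
    proof (rule nonneg_quadratic_discriminant)
      fix t :: real
      have "d \<le> J (X n + t *\<^sub>R v)"
        using X v by (intro dle) auto
      also have "\<dots> = J (X n) + 2 * t * (ip (X n) v - l v) + t\<^sup>2 * ip v v"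
        using X v ip_sym[of "X n" v]
        by (simp add: J_def ip_simps add scale power2_eq_square algebra_simps)
      finally show "0 \<le> 1 / Suc n + 2 * t * (ip (X n) v - l v) + t\<^sup>2 * ip v v"
        using X(2)[of n] by simp
    qed (use v ip_nonneg in auto)
    have "(\<lambda>n. 1 / Suc n * ip v v) \<longlonglongrightarrow> 0"
      using tendsto_mult_right[OF LIMSEQ_Suc[OF lim_1_over_n], of "ip v v"] by simp
    then have "(\<lambda>n. (ip (X n) v - l v)\<^sup>2) \<longlonglongrightarrow> 0"
      by (rule Lim_null_comparison[rotated]) (use sq in auto)
    moreover have "(\<lambda>n. (ip (X n) v - l v)\<^sup>2) \<longlonglongrightarrow> (ip r v - l v)\<^sup>2"
      by (intro tendsto_intros ip_tendsto X r v)
    ultimately have "(ip r v - l v)\<^sup>2 = 0"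
      using LIMSEQ_unique by blast
    then show ?thesis by simp
  qed
  with r show ?thesis by blast
qed

lemma tendsto_of_first_order:
  fixes \<Phi> :: "'b \<Rightarrow> real" and g :: "'b \<Rightarrow> 'b"
  assumes g: "\<And>x. x \<in> H \<Longrightarrow> g x \<in> H"
    and first_order: "\<And>R \<epsilon>. \<epsilon> > 0 \<Longrightarrow> \<exists>s>0. \<forall>x\<in>H. \<forall>w\<in>H. nrm x \<le> R \<longrightarrow> nrm w \<le> s \<longrightarrow>
      \<bar>\<Phi> (x + w) - \<Phi> x - ip (g x) w\<bar> \<le> \<epsilon> * nrm w"
    and X: "\<And>n. X n \<in> H" and x: "x \<in> H" and lim: "(\<lambda>n. nrm (X n - x)) \<longlonglongrightarrow> 0"
  shows "(\<lambda>n. \<Phi> (X n)) \<longlonglongrightarrow> \<Phi> x"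
proof -
  obtain s' where s': "s' > 0" "\<And>w. w \<in> H \<Longrightarrow> nrm w \<le> s' \<Longrightarrow>
    \<bar>\<Phi> (x + w) - \<Phi> x - ip (g x) w\<bar> \<le> 1 * nrm w"
    using first_order[of 1 "nrm x"] x by auto
  have "(\<lambda>n. \<Phi> (X n) - \<Phi> x) \<longlonglongrightarrow> 0"
  proof (rule Lim_null_comparison)
    show "(\<lambda>n. (nrm (g x) + 1) * nrm (X n - x)) \<longlonglongrightarrow> 0"
      using tendsto_mult_left[OF lim] by simp
    show "\<forall>\<^sub>F n in sequentially. norm (\<Phi> (X n) - \<Phi> x) \<le> (nrm (g x) + 1) * nrm (X n - x)"
      using order_tendstoD(2)[OF lim s'(1)]
    proof eventually_elim
      case (elim n)
      with s'(2)[of "X n - x"] X x Cauchy_Schwarz[of "g x" "X n - x"] g[OF x]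
      show ?case by (simp add: algebra_simps)
    qed
  qed
  then show ?thesis by (simp add: LIM_zero_iff)
qed

text \<open>
  Let \<open>\<eta>\<close> be a short step against the gradient, switched off where the gradient is small or the
  point is far out. Then \<open>\<eta>\<close> never increases \<open>\<Phi>\<close>, and both the well \<open>N0\<close> around \<open>0\<close> and the set
  where \<open>\<Phi>\<close> is negative are invariant. The parameters \<open>t\<close> for which the orbit of \<open>t e\<close> enters the
  one or the other form two disjoint relatively open subsets of the unit interval, containing \<open>0\<close> and \<open>1\<close>
  respectively. By connectedness some orbit enters neither. If the gradient were larger than
  \<open>\<delta>\<close> all along it, then every step would lower \<open>\<Phi>\<close> by a fixed amount, although \<open>\<Phi>\<close> stays
  nonnegative.
\<close>

lemma mountain_pass_approx:
  fixes \<Phi> :: "'b \<Rightarrow> real" and g :: "'b \<Rightarrow> 'b"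
  assumes g: "\<And>x. x \<in> H \<Longrightarrow> g x \<in> H"
    and first_order: "\<And>R \<epsilon>. \<epsilon> > 0 \<Longrightarrow> \<exists>s>0. \<forall>x\<in>H. \<forall>w\<in>H. nrm x \<le> R \<longrightarrow> nrm w \<le> s \<longrightarrow>
      \<bar>\<Phi> (x + w) - \<Phi> x - ip (g x) w\<bar> \<le> \<epsilon> * nrm w"
    and g_cont: "\<And>X x. (\<And>n. X n \<in> H) \<Longrightarrow> x \<in> H \<Longrightarrow> (\<lambda>n. nrm (X n - x)) \<longlonglongrightarrow> 0 \<Longrightarrow>
      (\<lambda>n. nrm (g (X n) - g x)) \<longlonglongrightarrow> 0"
    and rho: "\<rho> > 0" "c0 > 0" "\<And>x. x \<in> H \<Longrightarrow> nrm x \<le> \<rho> \<Longrightarrow> c0 * (nrm x)\<^sup>2 \<le> \<Phi> x"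
    and \<Phi>0: "\<Phi> 0 = 0" and e: "e \<in> H" "\<Phi> e < 0"
    and AR: "\<And>x. x \<in> H \<Longrightarrow> \<Phi> x \<le> C \<Longrightarrow> nrm (g x) \<le> 1 \<Longrightarrow> nrm x \<le> R0"
    and C: "\<And>t. 0 \<le> t \<Longrightarrow> t \<le> 1 \<Longrightarrow> \<Phi> (t *\<^sub>R e) \<le> C"
    and \<delta>: "\<delta> > 0"
  shows "\<exists>x\<in>H. nrm (g x) \<le> \<delta> \<and> 0 \<le> \<Phi> x \<and> \<Phi> x \<le> C \<and> (\<rho> \<le> nrm x \<or> c0 * \<rho>\<^sup>2 / 4 \<le> \<Phi> x)"
proof (rule ccontr)
  assume neg: "\<not> ?thesis"
  define d where "d = min \<delta> 1 / 2"
  have d: "0 < d" "d \<le> 1/2" "2 * d \<le> \<delta>" using \<delta> by (auto simp: d_def)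
  have "C \<ge> 0" using C[of 0] \<Phi>0 by simp
  \<comment> \<open>Beyond the radius \<open>R0\<close> the gradient exceeds \<open>1\<close>, so a step increases the norm by at most twice
    the decrease of \<open>\<Phi>\<close>; hence \<open>nrm x + 2 * \<Phi> x\<close> will stay below \<open>R1\<close>.\<close>
  define R1 where "R1 = max (nrm e) (R0 + 1) + 2 * C"
  obtain s where s: "s > 0" "\<And>x w. x \<in> H \<Longrightarrow> w \<in> H \<Longrightarrow> nrm x \<le> R1 + 1 \<Longrightarrow> nrm w \<le> s \<Longrightarrow>
      \<bar>\<Phi> (x + w) - \<Phi> x - ip (g x) w\<bar> \<le> d / 2 * nrm w"
    using first_order[of "d / 2" "R1 + 1"] d by auto
  define s1 where "s1 = min s (min 1 (\<rho> / 2))"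
  have s1: "s1 > 0" "s1 \<le> s" "s1 \<le> 1" "s1 \<le> \<rho> / 2"
    using s rho by (auto simp: s1_def)
  \<comment> \<open>The division by \<open>(1 + nrm (g x))\<^sup>2\<close> keeps the step length \<open>\<alpha> x * nrm (g x)\<close> below \<open>s1\<close>; the other
    factors switch the step off continuously.\<close>
  define \<alpha> where "\<alpha> x = s1 * min 1 (max 0 (R1 + 1 - nrm x)) * (max 0 (nrm (g x) - d) / (1 + nrm (g x))\<^sup>2)" for x
  define \<eta> where "\<eta> x = x - \<alpha> x *\<^sub>R g x" for x
  have gn: "0 \<le> nrm (g x)" if "x \<in> H" for x using g[OF that] by simp
  have \<alpha>0: "0 \<le> \<alpha> x" if "x \<in> H" for x
    using s1 gn[OF that] by (auto simp: \<alpha>_def)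
  have len: "\<alpha> x * nrm (g x) \<le> s1" if "x \<in> H" for x
  proof -
    let ?n = "nrm (g x)"
    have "max 0 (?n - d) * ?n \<le> (1 + ?n)\<^sup>2"
    proof -
      have "max 0 (?n - d) * ?n \<le> ?n * ?n"
        using gn[OF that] d by (intro mult_right_mono) auto
      then show ?thesis
        using gn[OF that] by (simp add: power2_eq_square algebra_simps)
    qed
    then have "max 0 (?n - d) / (1 + ?n)\<^sup>2 * ?n \<le> 1"
      using gn[OF that] by (simp add: divide_le_eq)
    moreover have "0 \<le> max 0 (?n - d) / (1 + ?n)\<^sup>2 * ?n"
      using gn[OF that] by auto
    moreover have "0 \<le> min 1 (max 0 (R1 + 1 - nrm x))" "min 1 (max 0 (R1 + 1 - nrm x)) \<le> 1" by auto
    ultimately have "min 1 (max 0 (R1 + 1 - nrm x)) * (max 0 (?n - d) / (1 + ?n)\<^sup>2 * ?n) \<le> 1"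
      by (metis mult_le_one)
    from mult_left_mono[OF this, of s1] s1 show ?thesis
      by (simp add: \<alpha>_def mult.assoc)
  qed
  have \<eta>H: "\<eta> x \<in> H" if "x \<in> H" for x
    using that g by (auto simp: \<eta>_def)
  have step: "nrm (\<eta> x) \<le> nrm x + \<alpha> x * nrm (g x)" if "x \<in> H" for x
    using nrm_triangle[of x "- (\<alpha> x *\<^sub>R g x)"] that g[OF that] \<alpha>0[OF that]
    by (simp add: \<eta>_def nrm_minus nrm_scale)
  have desc: "\<Phi> (\<eta> x) \<le> \<Phi> x - \<alpha> x * nrm (g x) * (nrm (g x) - d / 2)" if x: "x \<in> H" for x
  proof (cases "nrm x \<le> R1 + 1")
    case True
    let ?w = "- (\<alpha> x *\<^sub>R g x)"
    have w: "?w \<in> H" "nrm ?w = \<alpha> x * nrm (g x)"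
      using g[OF x] \<alpha>0[OF x] by (auto simp: nrm_minus nrm_scale)
    have "\<bar>\<Phi> (x + ?w) - \<Phi> x - ip (g x) ?w\<bar> \<le> d / 2 * nrm ?w"
      by (rule s(2)) (use x w True len[OF x] s1 in auto)
    then have "\<Phi> (\<eta> x) \<le> \<Phi> x + ip (g x) ?w + d / 2 * nrm ?w"
      unfolding \<eta>_def using abs_le_D1 by fastforce
    moreover have "ip (g x) ?w = - \<alpha> x * (nrm (g x))\<^sup>2"
      using g[OF x] by (simp add: ip_minus_right ip_scale_right nrm_sq)
    ultimately show ?thesis
      unfolding w by (simp add: algebra_simps power2_eq_square)
  next
    case False
    then have "\<alpha> x = 0" by (simp add: \<alpha>_def)
    then show ?thesis by (simp add: \<eta>_def)
  qed
  have mono: "\<Phi> (\<eta> x) \<le> \<Phi> x" if x: "x \<in> H" for x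
  proof (cases "nrm (g x) \<ge> d")
    case True
    then have "0 \<le> \<alpha> x * nrm (g x) * (nrm (g x) - d / 2)"
      using d by (intro mult_nonneg_nonneg \<alpha>0 gn x) auto
    with desc[OF x] show ?thesis by simp
  next
    case False
    then have "\<alpha> x = 0" by (simp add: \<alpha>_def)
    then show ?thesis by (simp add: \<eta>_def)
  qed
  have \<eta>_cont: "(\<lambda>n. nrm (\<eta> (X n) - \<eta> x)) \<longlonglongrightarrow> 0"
    if X: "\<And>n. X n \<in> H" and x: "x \<in> H" and lim: "(\<lambda>n. nrm (X n - x)) \<longlonglongrightarrow> 0" for X x
  proof -
    have gX: "(\<lambda>n. nrm (g (X n) - g x)) \<longlonglongrightarrow> 0"
      by (rule g_cont[OF X x lim])
    have ngX: "(\<lambda>n. nrm (g (X n))) \<longlonglongrightarrow> nrm (g x)"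
      by (rule nrm_tendsto[OF _ _ gX]) (use g X x in auto)
    have \<alpha>X: "(\<lambda>n. \<alpha> (X n)) \<longlonglongrightarrow> \<alpha> x"
      unfolding \<alpha>_def using gn[OF x]
      by (intro tendsto_intros ngX nrm_tendsto X x lim) auto
    have "(\<lambda>n. nrm (X n - x) + (\<bar>\<alpha> (X n)\<bar> * nrm (g (X n) - g x) + \<bar>\<alpha> (X n) - \<alpha> x\<bar> * nrm (g x)))
        \<longlonglongrightarrow> 0 + (\<bar>\<alpha> x\<bar> * 0 + \<bar>\<alpha> x - \<alpha> x\<bar> * nrm (g x))"
      by (intro tendsto_intros lim gX \<alpha>X)
    then have lim2: "(\<lambda>n. nrm (X n - x) + (\<bar>\<alpha> (X n)\<bar> * nrm (g (X n) - g x) + \<bar>\<alpha> (X n) - \<alpha> x\<bar> * nrm (g x)))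
        \<longlonglongrightarrow> 0" by simp
    show ?thesis
    proof (rule Lim_null_comparison[OF _ lim2], intro always_eventually allI)
      fix n
      let ?A = "X n - x" and ?B = "- (\<alpha> (X n) *\<^sub>R (g (X n) - g x))" and ?C = "- ((\<alpha> (X n) - \<alpha> x) *\<^sub>R g x)"
      have H: "?A \<in> H" "?B \<in> H" "?C \<in> H" using X x g by auto
      have "\<eta> (X n) - \<eta> x = ?A + (?B + ?C)"
        by (simp add: \<eta>_def algebra_simps)
      also have "nrm \<dots> \<le> nrm ?A + (nrm ?B + nrm ?C)"
        by (rule nrm_triangle3[OF H])
      also have "nrm ?B = \<bar>\<alpha> (X n)\<bar> * nrm (g (X n) - g x)"
        using X x g by (subst nrm_minus) (auto simp: nrm_scale)
      also have "nrm ?C = \<bar>\<alpha> (X n) - \<alpha> x\<bar> * nrm (g x)"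
        using X x g by (subst nrm_minus) (auto simp: nrm_scale)
      finally show "norm (nrm (\<eta> (X n) - \<eta> x)) \<le> nrm (X n - x) + (\<bar>\<alpha> (X n)\<bar> * nrm (g (X n) - g x) + \<bar>\<alpha> (X n) - \<alpha> x\<bar> * nrm (g x))"
        using nrm_nonneg[of "\<eta> (X n) - \<eta> x"] \<eta>H X x by simp
    qed
  qed
  have \<Phi>_cont: "(\<lambda>n. \<Phi> (X n)) \<longlonglongrightarrow> \<Phi> x"
    if X: "\<And>n. X n \<in> H" and x: "x \<in> H" and lim: "(\<lambda>n. nrm (X n - x)) \<longlonglongrightarrow> 0" for X x
    by (rule tendsto_of_first_order[OF g first_order]) (use that in auto)
  define traj where "traj n t = (\<eta> ^^ n) (t *\<^sub>R e)" for n and t :: real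
  have traj_simps: "traj 0 t = t *\<^sub>R e" "traj (Suc n) t = \<eta> (traj n t)" for n t
    by (auto simp: traj_def)
  have trajH: "traj n t \<in> H" for n t
    by (induction n) (use e \<eta>H in \<open>auto simp: traj_simps\<close>)
  have traj_cont: "(\<lambda>k. nrm (traj n (T k) - traj n t)) \<longlonglongrightarrow> 0" if "T \<longlonglongrightarrow> t" for n T t
  proof (induction n)
    case 0
    have "(\<lambda>k. \<bar>T k - t\<bar> * nrm e) \<longlonglongrightarrow> \<bar>t - t\<bar> * nrm e"
      by (intro tendsto_intros that)
    then show ?case
      using e by (simp add: traj_simps nrm_scale flip: scaleR_left_diff_distrib)
  next
    case (Suc n)
    then show ?case unfolding traj_simps by (intro \<eta>_cont trajH)
  qed
  define N0 where "N0 = {x \<in> H. nrm x < \<rho> \<and> \<Phi> x < c0 * \<rho>\<^sup>2 / 4}"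
  define B where "B = {t \<in> {0..1}. \<exists>n. traj n t \<in> N0}"
  define D where "D = {t \<in> {0..1}. \<exists>n. \<Phi> (traj n t) < 0}"
  have N0inv: "\<eta> x \<in> N0" if "x \<in> N0" for x
  proof -
    have x: "x \<in> H" "nrm x < \<rho>" "\<Phi> x < c0 * \<rho>\<^sup>2 / 4" using that by (auto simp: N0_def)
    have "c0 * (nrm x)\<^sup>2 < c0 * (\<rho> / 2)\<^sup>2"
      using rho(3)[of x] x by (simp add: power_divide)
    then have "(nrm x)\<^sup>2 < (\<rho> / 2)\<^sup>2"
      using rho(2) by (simp only: mult_less_cancel_left_pos)
    then have "nrm x < \<rho> / 2"
      by (rule power_less_imp_less_base) (use rho in auto)
    then show ?thesis
      using step[OF x(1)] len[OF x(1)] s1 mono[OF x(1)] x \<eta>H by (auto simp: N0_def)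
  qed
  have N0later: "traj (n + k) t \<in> N0" if "traj n t \<in> N0" for n k t
    using that by (induction k) (auto simp: traj_simps N0inv)
  have Dlater: "\<Phi> (traj (n + k) t) < 0" if "\<Phi> (traj n t) < 0" for n k t
    using that by (induction k) (use mono[OF trajH] in \<open>auto simp: traj_simps intro: le_less_trans\<close>)
  have N0pos: "0 \<le> \<Phi> x" if "x \<in> N0" for x
    using that rho(3)[of x] rho(2) by (auto simp: N0_def intro: order_trans[rotated])
  have BD: "B \<inter> D = {}"
  proof -
    have False if "traj n t \<in> N0" "\<Phi> (traj m t) < 0" for n m t
      using N0later[OF that(1), of m] Dlater[OF that(2), of n] N0pos by (force simp: add.commute)
    then show ?thesis by (auto simp: B_def D_def)
  qed
  have clB: "closed ({0..1} - B)"
    unfolding closed_sequential_limits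
  proof (intro allI impI, elim conjE)
    fix T t assume T: "\<forall>k. T k \<in> {0..1} - B" "T \<longlonglongrightarrow> t"
    have "t \<in> {0..1}"
      using T closed_sequentially[of "{0..1}" T t] by auto
    moreover have "t \<notin> B"
    proof
      assume "t \<in> B"
      then obtain n where n: "traj n t \<in> N0" by (auto simp: B_def)
      have lim: "(\<lambda>k. nrm (traj n (T k))) \<longlonglongrightarrow> nrm (traj n t)" "(\<lambda>k. \<Phi> (traj n (T k))) \<longlonglongrightarrow> \<Phi> (traj n t)"
        by (auto intro!: nrm_tendsto \<Phi>_cont trajH traj_cont T)
      have "\<forall>\<^sub>F k in sequentially. nrm (traj n (T k)) < \<rho> \<and> \<Phi> (traj n (T k)) < c0 * \<rho>\<^sup>2 / 4"
        using n by (intro eventually_conj order_tendstoD(2)[OF lim(1)] order_tendstoD(2)[OF lim(2)])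
          (auto simp: N0_def)
      then obtain k where "traj n (T k) \<in> N0"
        using trajH by (auto simp: N0_def eventually_sequentially)
      with T show False by (auto simp: B_def)
    qed
    ultimately show "t \<in> {0..1} - B" by blast
  qed
  have clD: "closed ({0..1} - D)"
    unfolding closed_sequential_limits
  proof (intro allI impI, elim conjE)
    fix T t assume T: "\<forall>k. T k \<in> {0..1} - D" "T \<longlonglongrightarrow> t"
    have "t \<in> {0..1}"
      using T closed_sequentially[of "{0..1}" T t] by auto
    moreover have "t \<notin> D"
    proof
      assume "t \<in> D"
      then obtain n where n: "\<Phi> (traj n t) < 0" by (auto simp: D_def)
      have lim: "(\<lambda>k. \<Phi> (traj n (T k))) \<longlonglongrightarrow> \<Phi> (traj n t)"
        by (auto intro!: \<Phi>_cont trajH traj_cont T)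
      have "\<forall>\<^sub>F k in sequentially. \<Phi> (traj n (T k)) < 0"
        using n by (intro order_tendstoD(2)[OF lim])
      then obtain k where "\<Phi> (traj n (T k)) < 0"
        by (auto simp: eventually_sequentially)
      with T show False by (auto simp: D_def)
    qed
    ultimately show "t \<in> {0..1} - D" by blast
  qed
  have "1 \<in> D" using e by (auto simp: D_def traj_simps intro!: exI[of _ 0])
  have "0 \<in> B" using rho by (auto simp: B_def N0_def traj_simps \<Phi>0 intro!: exI[of _ 0])
  have "\<exists>t\<in>{0..1}. t \<notin> B \<and> t \<notin> D"
  proof (rule ccontr)
    assume "\<not> ?thesis"
    then have cover: "{0..1} \<subseteq> B \<union> D" by blast
    have "0 \<notin> D" "1 \<notin> B" using BD \<open>1 \<in> D\<close> \<open>0 \<in> B\<close> by blast+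
    then have "0 \<in> {0..1} - D" "1 \<in> {0..1} - B" by auto
    then have "({0..1} - B) \<inter> {0..1} \<noteq> {}" "({0..1} - D) \<inter> {0..1} \<noteq> {}" by blast+
    moreover have "({0..1} - B) \<inter> ({0..1} - D) \<inter> {0..1} = {}" using cover by blast
    moreover have "{0..1} \<subseteq> ({0..1} - B) \<union> ({0..1} - D)" using BD by blast
    ultimately show False
      using connected_Icc[of "0::real" 1] clB clD unfolding connected_closed by blast
  qed
  then obtain t where t: "0 \<le> t" "t \<le> 1" "t \<notin> B" "t \<notin> D" by auto
  have nN0: "traj n t \<notin> N0" and pos: "0 \<le> \<Phi> (traj n t)" for n
    using t by (auto simp: B_def D_def not_less)
  have leC: "\<Phi> (traj n t) \<le> C" for n
    by (induction n) (use C t mono[OF trajH] in \<open>auto simp: traj_simps intro: order_trans\<close>)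
  have big: "2 * d < nrm (g (traj n t))" for n
  proof -
    have "\<not> nrm (g (traj n t)) \<le> \<delta>"
      using neg nN0[of n] pos[of n] leC[of n] trajH[of n t] by (auto simp: N0_def not_less)
    with d show ?thesis by simp
  qed
  have inv: "nrm (traj n t) + 2 * \<Phi> (traj n t) \<le> R1" for n
  proof (induction n)
    case 0
    have "t * nrm e \<le> nrm e" using t e by (simp add: mult_left_le_one_le)
    then show ?case using t e leC[of 0] by (simp add: traj_simps nrm_scale R1_def)
  next
    case (Suc n)
    let ?x = "traj n t"
    have x: "?x \<in> H" by (rule trajH)
    show ?case
    proof (cases "nrm (g ?x) \<le> 1")
      case True
      then have "nrm ?x \<le> R0" using AR leC x by blast
      then have "nrm (\<eta> ?x) \<le> R0 + 1" using step[OF x] len[OF x] s1 by simp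
      then show ?thesis using leC[of "Suc n"] by (simp add: traj_simps R1_def)
    next
      case False
      have "\<alpha> ?x * nrm (g ?x) * (1/2) \<le> \<alpha> ?x * nrm (g ?x) * (nrm (g ?x) - d / 2)"
        using False d by (intro mult_left_mono mult_nonneg_nonneg \<alpha>0 gn x) auto
      then show ?thesis using desc[OF x] step[OF x] Suc.IH by (simp add: traj_simps)
    qed
  qed
  define \<kappa> where "\<kappa> = s1 * (d / 2) * (2 * d / (1 + 2 * d))\<^sup>2"
  have "\<kappa> > 0" using s1 d by (simp add: \<kappa>_def)
  have dec: "\<Phi> (traj (Suc n) t) \<le> \<Phi> (traj n t) - \<kappa>" for n
  proof -
    let ?x = "traj n t"
    let ?n = "nrm (g ?x)"
    have x: "?x \<in> H" by (rule trajH)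
    have n: "2 * d < ?n" by (rule big)
    have "nrm ?x \<le> R1" using inv[of n] pos[of n] by simp
    then have \<alpha>: "\<alpha> ?x = s1 * ((?n - d) / (1 + ?n)\<^sup>2)"
      using n d by (simp add: \<alpha>_def)
    have "2 * d / (1 + 2 * d) \<le> ?n / (1 + ?n)"
      using n d by (simp add: field_simps)
    then have q: "(2 * d / (1 + 2 * d))\<^sup>2 \<le> (?n / (1 + ?n))\<^sup>2"
      using d by (intro power_mono) auto
    have "\<kappa> \<le> s1 * ((?n - d) * (?n - d / 2) / ?n * (?n / (1 + ?n))\<^sup>2)"
      unfolding \<kappa>_def mult.assoc
    proof (intro mult_left_mono mult_mono q)
      have "d * ?n / 2 \<le> (?n / 2) * (?n / 2)"
        using n d by (simp add: mult_right_mono)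
      also have "\<dots> \<le> (?n - d) * (?n - d / 2)"
        using n d by (intro mult_mono) auto
      finally show "d / 2 \<le> (?n - d) * (?n - d / 2) / ?n"
        using n d by (simp add: field_simps)
    qed (use n d s1 in auto)
    also have "\<dots> = \<alpha> ?x * ?n * (?n - d / 2)"
    proof -
      have "A / ?n * (?n / q)\<^sup>2 = A * ?n / q\<^sup>2" for A q :: real
        using n d by (simp add: power2_eq_square)
      then show ?thesis unfolding \<alpha> by simp
    qed
    finally show ?thesis using desc[OF x] by (simp add: traj_simps)
  qed
  have "\<Phi> (traj n t) \<le> C - real n * \<kappa>" for n
  proof (induction n)
    case (Suc n)
    with dec[of n] show ?case by (simp add: algebra_simps)
  qed (use leC[of 0] in simp)
  moreover obtain n where "C < real n * \<kappa>"
    using \<open>\<kappa> > 0\<close> reals_Archimedean3 by blast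
  ultimately show False using pos[of n] by (smt (verit))
qed

text \<open>
  The Palais-Smale condition turns the approximate critical points into a critical point; the
  alternative between large norm and positive level keeps it away from \<open>0\<close>.
\<close>

theorem mountain_pass:
  fixes \<Phi> :: "'b \<Rightarrow> real" and g :: "'b \<Rightarrow> 'b"
  assumes g: "\<And>x. x \<in> H \<Longrightarrow> g x \<in> H"
    and first_order: "\<And>R \<epsilon>. \<epsilon> > 0 \<Longrightarrow> \<exists>s>0. \<forall>x\<in>H. \<forall>w\<in>H. nrm x \<le> R \<longrightarrow> nrm w \<le> s \<longrightarrow>
      \<bar>\<Phi> (x + w) - \<Phi> x - ip (g x) w\<bar> \<le> \<epsilon> * nrm w"
    and g_cont: "\<And>X x. (\<And>n. X n \<in> H) \<Longrightarrow> x \<in> H \<Longrightarrow> (\<lambda>n. nrm (X n - x)) \<longlonglongrightarrow> 0 \<Longrightarrow>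
      (\<lambda>n. nrm (g (X n) - g x)) \<longlonglongrightarrow> 0"
    and rho: "\<rho> > 0" "c0 > 0" "\<And>x. x \<in> H \<Longrightarrow> nrm x \<le> \<rho> \<Longrightarrow> c0 * (nrm x)\<^sup>2 \<le> \<Phi> x"
    and \<Phi>0: "\<Phi> 0 = 0" and e: "e \<in> H" "\<Phi> e < 0"
    and AR: "\<And>C. \<exists>R0. \<forall>x\<in>H. \<Phi> x \<le> C \<longrightarrow> nrm (g x) \<le> 1 \<longrightarrow> nrm x \<le> R0"
    and PS: "\<And>X R. (\<And>n. X n \<in> H) \<Longrightarrow> (\<And>n. nrm (X n) \<le> R) \<Longrightarrow> (\<lambda>n. nrm (g (X n))) \<longlonglongrightarrow> 0 \<Longrightarrow>
      \<exists>x\<in>H. \<exists>r. strict_mono r \<and> (\<lambda>n. nrm (X (r n) - x)) \<longlonglongrightarrow> 0"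
  shows "\<exists>x\<in>H. nrm (g x) = 0 \<and> nrm x \<noteq> 0"
proof -
  have \<Phi>_cont: "(\<lambda>n. \<Phi> (X n)) \<longlonglongrightarrow> \<Phi> x"
    if X: "\<And>n. X n \<in> H" and x: "x \<in> H" and lim: "(\<lambda>n. nrm (X n - x)) \<longlonglongrightarrow> 0" for X x
    by (rule tendsto_of_first_order[OF g first_order]) (use that in auto)
  have "\<exists>C. \<forall>t\<in>{0..1}. \<Phi> (t *\<^sub>R e) \<le> C"
  proof -
    have "continuous_on {0..1} (\<lambda>t. \<Phi> (t *\<^sub>R e))"
      unfolding continuous_on_sequentially comp_def
    proof (intro allI ballI impI, elim conjE)
      fix T t assume T: "T \<longlonglongrightarrow> (t::real)"
      have "(\<lambda>k. \<bar>T k - t\<bar> * nrm e) \<longlonglongrightarrow> \<bar>t - t\<bar> * nrm e"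
        by (intro tendsto_intros T)
      then show "(\<lambda>k. \<Phi> (T k *\<^sub>R e)) \<longlonglongrightarrow> \<Phi> (t *\<^sub>R e)"
        using e by (intro \<Phi>_cont) (auto simp: nrm_scale simp flip: scaleR_left_diff_distrib)
    qed
    from compact_continuous_image[OF this] have "bounded ((\<lambda>t. \<Phi> (t *\<^sub>R e)) ` {0..1})"
      by (simp add: compact_imp_bounded)
    then show ?thesis by (auto simp: bounded_iff abs_le_iff)
  qed
  then obtain C where "\<forall>t\<in>{0..1}. \<Phi> (t *\<^sub>R e) \<le> C" ..
  then have C: "\<And>t. 0 \<le> t \<Longrightarrow> t \<le> 1 \<Longrightarrow> \<Phi> (t *\<^sub>R e) \<le> C" by auto
  from AR obtain R0 where R0: "\<And>x. x \<in> H \<Longrightarrow> \<Phi> x \<le> C \<Longrightarrow> nrm (g x) \<le> 1 \<Longrightarrow> nrm x \<le> R0" by blast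
  have "\<exists>x\<in>H. nrm (g x) \<le> 1 / Suc n \<and> 0 \<le> \<Phi> x \<and> \<Phi> x \<le> C \<and> (\<rho> \<le> nrm x \<or> c0 * \<rho>\<^sup>2 / 4 \<le> \<Phi> x)" for n
    by (rule mountain_pass_approx[OF g first_order g_cont rho \<Phi>0 e R0 C]) auto
  then obtain X where X: "\<And>n. X n \<in> H" "\<And>n. nrm (g (X n)) \<le> 1 / Suc n" "\<And>n. \<Phi> (X n) \<le> C"
      "\<And>n. \<rho> \<le> nrm (X n) \<or> c0 * \<rho>\<^sup>2 / 4 \<le> \<Phi> (X n)" by metis
  have g0: "(\<lambda>n. nrm (g (X n))) \<longlonglongrightarrow> 0"
    by (rule Lim_null_comparison[OF _ LIMSEQ_Suc[OF lim_1_over_n]]) (use X g in auto)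
  have "nrm (X n) \<le> R0" for n
  proof (rule R0)
    have "1 / real (Suc n) \<le> 1" by simp
    with X(2)[of n] show "nrm (g (X n)) \<le> 1" by linarith
  qed (use X in auto)
  from PS[OF X(1) this g0] obtain x r where x: "x \<in> H" and r: "strict_mono r"
      and lim: "(\<lambda>n. nrm (X (r n) - x)) \<longlonglongrightarrow> 0" by auto
  have "(\<lambda>n. nrm (g (X (r n)))) \<longlonglongrightarrow> nrm (g x)"
    by (rule nrm_tendsto[OF _ _ g_cont]) (use X x lim g in auto)
  moreover have "(\<lambda>n. nrm (g (X (r n)))) \<longlonglongrightarrow> 0"
    using LIMSEQ_subseq_LIMSEQ[OF g0 r] by (simp add: comp_def)
  ultimately have "nrm (g x) = 0"
    using LIMSEQ_unique by blast
  moreover have "nrm x \<noteq> 0"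
  proof
    assume "nrm x = 0"
    have "(\<lambda>n. nrm (X (r n))) \<longlonglongrightarrow> nrm x"
      by (rule nrm_tendsto) (use X x lim in auto)
    with \<open>nrm x = 0\<close> have l1: "(\<lambda>n. nrm (X (r n))) \<longlonglongrightarrow> 0" by simp
    have l2: "(\<lambda>n. \<Phi> (X (r n))) \<longlonglongrightarrow> 0"
      using \<Phi>_cont[of "\<lambda>n. X (r n)" 0] X l1 by (simp add: \<Phi>0)
    have "\<forall>\<^sub>F n in sequentially. nrm (X (r n)) < \<rho> \<and> \<Phi> (X (r n)) < c0 * \<rho>\<^sup>2 / 4"
      using rho by (intro eventually_conj order_tendstoD(2)[OF l1] order_tendstoD(2)[OF l2]) auto
    then obtain n where "nrm (X (r n)) < \<rho>" "\<Phi> (X (r n)) < c0 * \<rho>\<^sup>2 / 4"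
      by (auto simp: eventually_sequentially)
    with X(4)[of "r n"] show False by auto
  qed
  ultimately show ?thesis using x by blast
qed

end

section \<open>Hausdorff measures\<close>

definition fine_cover :: "real \<Rightarrow> 'a::metric_space set \<Rightarrow> (nat \<Rightarrow> 'a set) \<Rightarrow> bool" where
  "fine_cover \<delta> A U \<longleftrightarrow> A \<subseteq> (\<Union>i. U i) \<and> (\<forall>i. bounded (U i) \<and> diameter (U i) \<le> \<delta>)"

definition cover_size :: "real \<Rightarrow> (nat \<Rightarrow> 'a::metric_space set) \<Rightarrow> ennreal" where
  "cover_size s U = (\<Sum>i. ennreal (diameter (U i) powr s))"

lemma premeasure_eq: "hausdorff_premeasure s \<delta> A = (INF U\<in>{U. fine_cover \<delta> A U}. cover_size s U)"
  by (simp add: hausdorff_premeasure_def fine_cover_def cover_size_def)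

lemma premeasure_le: "fine_cover \<delta> A U \<Longrightarrow> hausdorff_premeasure s \<delta> A \<le> cover_size s U"
  unfolding premeasure_eq by (rule INF_lower) simp

lemma premeasure_geI: "(\<And>U. fine_cover \<delta> A U \<Longrightarrow> b \<le> cover_size s U) \<Longrightarrow> b \<le> hausdorff_premeasure s \<delta> A"
  unfolding premeasure_eq by (rule INF_greatest) simp

lemma premeasure_le_outer: "0 < \<delta> \<Longrightarrow> hausdorff_premeasure s \<delta> A \<le> hausdorff_outer s A"
  unfolding hausdorff_outer_def by (rule SUP_upper) simp

lemma outer_leI: "(\<And>\<delta>. 0 < \<delta> \<Longrightarrow> hausdorff_premeasure s \<delta> A \<le> b) \<Longrightarrow> hausdorff_outer s A \<le> b"
  unfolding hausdorff_outer_def by (rule SUP_least) simp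

lemma premeasure_mono: "A \<subseteq> B \<Longrightarrow> hausdorff_premeasure s \<delta> A \<le> hausdorff_premeasure s \<delta> B"
  by (rule premeasure_geI, rule premeasure_le) (auto simp: fine_cover_def)

lemma premeasure_antimono: "\<delta> \<le> \<delta>' \<Longrightarrow> hausdorff_premeasure s \<delta>' A \<le> hausdorff_premeasure s \<delta> A"
  by (rule premeasure_geI, rule premeasure_le) (auto simp: fine_cover_def intro: order_trans)

lemma premeasure_empty: "0 \<le> \<delta> \<Longrightarrow> hausdorff_premeasure s \<delta> {} = 0"
  using premeasure_le[of \<delta> "{}" "\<lambda>_. {}" s] by (simp add: fine_cover_def cover_size_def)

lemma outer_empty: "hausdorff_outer s {} = 0"
  using outer_leI[of s "{}" 0] by (simp add: premeasure_empty)

lemma outer_mono: "A \<subseteq> B \<Longrightarrow> hausdorff_outer s A \<le> hausdorff_outer s B"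
  by (rule outer_leI) (meson order_trans premeasure_mono premeasure_le_outer)

text \<open>
  Covers of the sets \<open>A n\<close> that are optimal up to \<open>e / 2 ^ (n + 1)\<close> are enumerated together.
\<close>

lemma premeasure_subadditive:
  "hausdorff_premeasure s \<delta> (\<Union>n. A n) \<le> (\<Sum>n. hausdorff_premeasure s \<delta> (A n))"
proof (rule ennreal_le_epsilon)
  fix e :: real assume fin: "(\<Sum>n. hausdorff_premeasure s \<delta> (A n)) < top" and "0 < e"
  have "\<exists>U. fine_cover \<delta> (A n) U \<and> cover_size s U < hausdorff_premeasure s \<delta> (A n) + ennreal (e * (1 / 2) ^ Suc n)" for n
  proof -
    have "hausdorff_premeasure s \<delta> (A n) \<noteq> top"
      using fin by (metis ennreal_suminf_lessD less_irrefl top.not_eq_extremum)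
    moreover have "0 < ennreal (e * (1 / 2) ^ Suc n)" using \<open>0 < e\<close> by (subst ennreal_less_zero_iff) simp
    ultimately have "hausdorff_premeasure s \<delta> (A n) < hausdorff_premeasure s \<delta> (A n) + ennreal (e * (1 / 2) ^ Suc n)"
      using ennreal_add_left_cancel_less[of "hausdorff_premeasure s \<delta> (A n)" 0] by simp
    then show ?thesis
      unfolding premeasure_eq[of s \<delta> "A n"] INF_less_iff by auto
  qed
  then obtain U where U: "\<And>n. fine_cover \<delta> (A n) (U n)"
    "\<And>n. cover_size s (U n) < hausdorff_premeasure s \<delta> (A n) + ennreal (e * (1 / 2) ^ Suc n)" by metis
  define T where "T = (\<lambda>i. case prod_decode i of (m, n) \<Rightarrow> U m n)"
  have "fine_cover \<delta> (\<Union>n. A n) T"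
    unfolding fine_cover_def
  proof (intro conjI allI subsetI)
    fix x assume "x \<in> (\<Union>n. A n)"
    then obtain n m where "x \<in> U n m" using U(1) unfolding fine_cover_def by blast
    then have "x \<in> T (prod_encode (n, m))" by (simp add: T_def)
    then show "x \<in> (\<Union>i. T i)" by blast
  qed (use U(1) in \<open>auto simp: fine_cover_def T_def split: prod.splits\<close>)
  then have "hausdorff_premeasure s \<delta> (\<Union>n. A n) \<le> cover_size s T" by (rule premeasure_le)
  also have "cover_size s T = (\<Sum>m. cover_size s (U m))"
  proof -
    have "(\<Sum>i. (\<lambda>(m, n). ennreal (diameter (U m n) powr s)) (prod_decode i)) = (\<Sum>m. cover_size s (U m))"
      by (rule suminf_ennreal_2dimen) (simp add: cover_size_def)
    moreover have "(\<lambda>(m, n). ennreal (diameter (U m n) powr s)) (prod_decode i) = ennreal (diameter (T i) powr s)" for i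
      by (simp add: T_def split: prod.splits)
    ultimately show ?thesis by (simp add: cover_size_def)
  qed
  also have "\<dots> \<le> (\<Sum>n. hausdorff_premeasure s \<delta> (A n) + ennreal (e * (1 / 2) ^ Suc n))"
    by (intro suminf_le less_imp_le[OF U(2)]) auto
  also have "\<dots> = (\<Sum>n. hausdorff_premeasure s \<delta> (A n)) + (\<Sum>n. ennreal (e * (1 / 2) ^ Suc n))"
    by (intro suminf_add[symmetric]) auto
  also have "(\<Sum>n. ennreal (e * (1 / 2) ^ Suc n)) = ennreal e"
    unfolding suminf_ennreal_eq[OF _ sums_mult[OF power_half_series]] using \<open>0 < e\<close>
    by (subst suminf_ennreal_eq[OF _ sums_mult[OF power_half_series]]) auto
  finally show "hausdorff_premeasure s \<delta> (\<Union>n. A n) \<le> (\<Sum>n. hausdorff_premeasure s \<delta> (A n)) + ennreal e" .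
qed

lemma outer_subadditive: "hausdorff_outer s (\<Union>n. A n) \<le> (\<Sum>n. hausdorff_outer s (A n))"
proof (rule outer_leI)
  fix \<delta> :: real assume "0 < \<delta>"
  then have "(\<Sum>n. hausdorff_premeasure s \<delta> (A n)) \<le> (\<Sum>n. hausdorff_outer s (A n))"
    by (intro suminf_le premeasure_le_outer) auto
  then show "hausdorff_premeasure s \<delta> (\<Union>n. A n) \<le> (\<Sum>n. hausdorff_outer s (A n))"
    using premeasure_subadditive order_trans by blast
qed

lemma outer_measure_space: "outer_measure_space UNIV (hausdorff_outer s)"
  unfolding outer_measure_space_def positive_def increasing_def countably_subadditive_def
  by (auto simp: outer_empty outer_mono outer_subadditive)

lemma premeasure_finite_subadditive:
  fixes A :: "nat \<Rightarrow> 'a::metric_space set"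
  assumes "0 \<le> \<delta>"
  shows "hausdorff_premeasure s \<delta> (\<Union>n<k. A n) \<le> (\<Sum>n<k. hausdorff_premeasure s \<delta> (A n))"
proof -
  have "(\<Sum>n. hausdorff_premeasure s \<delta> (if n < k then A n else {})) = (\<Sum>n<k. hausdorff_premeasure s \<delta> (A n))"
    by (subst suminf_finite[of "{..<k}"]) (auto simp: premeasure_empty[OF assms])
  moreover have "(\<Union>n. if n < k then A n else {}) = (\<Union>n<k. A n)"
    by (auto split: if_splits)
  ultimately show ?thesis
    using premeasure_subadditive[of s \<delta> "\<lambda>n. if n < k then A n else {}"] by simp
qed

lemma outer_Un: "hausdorff_outer s (A \<union> B) \<le> hausdorff_outer s A + hausdorff_outer s B"
proof -
  have "(\<Union>n::nat. if n = 0 then A else if n = 1 then B else {}) = A \<union> B"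
    by (auto split: if_splits intro: exI[of _ 0] exI[of _ 1])
  moreover have "(\<Sum>n::nat. hausdorff_outer s (if n = 0 then A else if n = 1 then B else {})) = hausdorff_outer s A + hausdorff_outer s B"
    by (subst suminf_finite[of "{0, 1}"]) (auto simp: outer_empty)
  ultimately show ?thesis
    using outer_subadditive[of s "\<lambda>n. if n = 0 then A else if n = 1 then B else {}"] by simp
qed

text \<open>
  A set of diameter less than \<open>d\<close> meets at most one of \<open>A\<close> and \<open>B\<close>, so a fine cover of the union
  splits into a cover of \<open>A\<close> and one of \<open>B\<close>.
\<close>

lemma outer_separated:
  assumes "0 < d" and sep: "\<And>x y. x \<in> A \<Longrightarrow> y \<in> B \<Longrightarrow> d \<le> dist x y"
  shows "hausdorff_outer s A + hausdorff_outer s B \<le> hausdorff_outer s (A \<union> B)"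
proof -
  have small: "hausdorff_premeasure s \<delta> A + hausdorff_premeasure s \<delta> B \<le> hausdorff_premeasure s \<delta> (A \<union> B)"
    if \<delta>: "0 < \<delta>" "\<delta> < d" for \<delta>
  proof (rule premeasure_geI)
    fix U assume U: "fine_cover \<delta> (A \<union> B) U"
    define UA where "UA i = (if U i \<inter> A = {} then {} else U i)" for i
    define UB where "UB i = (if U i \<inter> B = {} then {} else U i)" for i
    have "fine_cover \<delta> A UA" "fine_cover \<delta> B UB"
      using U \<delta> unfolding fine_cover_def UA_def UB_def by (auto, blast+)
    then have "hausdorff_premeasure s \<delta> A + hausdorff_premeasure s \<delta> B \<le> cover_size s UA + cover_size s UB"
      by (intro add_mono premeasure_le)
    also have "\<dots> = (\<Sum>i. ennreal (diameter (UA i) powr s) + ennreal (diameter (UB i) powr s))"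
      unfolding cover_size_def by (intro suminf_add) auto
    also have "\<dots> \<le> cover_size s U"
      unfolding cover_size_def
    proof (intro suminf_le)
      fix i
      have "U i \<inter> A = {} \<or> U i \<inter> B = {}"
      proof (rule ccontr)
        assume "\<not> ?thesis"
        then obtain x y where xy: "x \<in> U i" "x \<in> A" "y \<in> U i" "y \<in> B" by blast
        have "dist x y \<le> diameter (U i)"
          using U xy by (intro diameter_bounded_bound) (auto simp: fine_cover_def)
        also have "\<dots> \<le> \<delta>" using U by (simp add: fine_cover_def)
        finally show False using sep[OF xy(2,4)] \<delta> by simp
      qed
      then show "ennreal (diameter (UA i) powr s) + ennreal (diameter (UB i) powr s) \<le> ennreal (diameter (U i) powr s)"
        by (auto simp: UA_def UB_def)
    qed auto
    finally show "hausdorff_premeasure s \<delta> A + hausdorff_premeasure s \<delta> B \<le> cover_size s U" .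
  qed
  have *: "hausdorff_premeasure s \<delta>1 A + hausdorff_premeasure s \<delta>2 B \<le> hausdorff_outer s (A \<union> B)"
    if "0 < \<delta>1" "0 < \<delta>2" for \<delta>1 \<delta>2
  proof -
    define \<delta> where "\<delta> = min (d / 2) (min \<delta>1 \<delta>2)"
    have \<delta>: "0 < \<delta>" "\<delta> < d" "\<delta> \<le> \<delta>1" "\<delta> \<le> \<delta>2" using that \<open>0 < d\<close> by (auto simp: \<delta>_def)
    have "hausdorff_premeasure s \<delta>1 A + hausdorff_premeasure s \<delta>2 B \<le> hausdorff_premeasure s \<delta> A + hausdorff_premeasure s \<delta> B"
      by (intro add_mono premeasure_antimono \<delta>)
    also have "\<dots> \<le> hausdorff_premeasure s \<delta> (A \<union> B)" by (rule small[OF \<delta>(1,2)])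
    also have "\<dots> \<le> hausdorff_outer s (A \<union> B)" by (rule premeasure_le_outer[OF \<delta>(1)])
    finally show ?thesis .
  qed
  have half: "hausdorff_outer s A + hausdorff_premeasure s \<delta>2 B \<le> hausdorff_outer s (A \<union> B)" if "0 < \<delta>2" for \<delta>2
    unfolding hausdorff_outer_def[of s A]
    by (subst ennreal_SUP_add_left[symmetric]) (use * that in \<open>auto intro!: SUP_least\<close>)
  show ?thesis
    unfolding hausdorff_outer_def[of s B]
    by (subst ennreal_SUP_add_right) (use half in \<open>auto intro!: SUP_least\<close>)
qed

text \<open>
  Caratheodory's criterion. The points of \<open>X\<close> at distance at least \<open>1 / (n + 1)\<close> from \<open>C\<close> are separated
  from \<open>C\<close>; the other points of \<open>X - C\<close> lie in the shells \<open>R k\<close> with \<open>k \<ge> n\<close>. Shells whose indices have the same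
  parity are separated from each other, so the outer measures of all shells add up to at most twice
  that of \<open>X\<close>, and the tails of this series tend to \<open>0\<close>.
\<close>

lemma closed_in_lambda_system:
  fixes C :: "'a::metric_space set"
  assumes C: "closed C"
  shows "C \<in> lambda_system UNIV UNIV (hausdorff_outer s)"
proof -
  let ?f = "hausdorff_outer s :: 'a set \<Rightarrow> ennreal"
  have "?f (C \<inter> X) + ?f ((UNIV - C) \<inter> X) = ?f X" for X
  proof (rule antisym)
    show "?f X \<le> ?f (C \<inter> X) + ?f ((UNIV - C) \<inter> X)"
      using outer_Un[of s "C \<inter> X" "(UNIV - C) \<inter> X"] by (simp add: Int_Diff Int_Un_distrib2[symmetric])
  next
    show "?f (C \<inter> X) + ?f ((UNIV - C) \<inter> X) \<le> ?f X"
    proof (cases "C = {} \<or> ?f X = top")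
      case True
      then show ?thesis by (auto simp: outer_empty)
    next
      case False
      then have "C \<noteq> {}" and fin: "?f X < top" by (auto simp: less_top)
      define r where "r n = 1 / (real n + 1)" for n
      have r: "0 < r n" "r (Suc n) < r n" for n by (auto simp: r_def field_simps)
      have r_anti: "r m \<le> r n" if "n \<le> m" for m n using that by (auto simp: r_def field_simps)
      have r_diff: "r (Suc n) - r (Suc (Suc n)) \<le> r n - r (Suc n)" for n
      proof -
        have d: "r n - r (Suc n) = 1 / ((real n + 1) * (real n + 2))" for n
          by (simp add: r_def field_simps)
        show ?thesis unfolding d by (intro divide_left_mono mult_mono) auto
      qed
      define A where "A n = {x \<in> X. r n \<le> infdist x C}" for n
      define R where "R n = {x \<in> X. r (Suc n) \<le> infdist x C \<and> infdist x C < r n}" for n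
      have close: "infdist x C \<le> dist x y + infdist y C" for x y
        using infdist_triangle[of x C y] by simp
      have A: "?f (C \<inter> X) + ?f (A n) \<le> ?f X" for n
      proof -
        have "?f (C \<inter> X) + ?f (A n) \<le> ?f (C \<inter> X \<union> A n)"
        proof (rule outer_separated[OF r(1)])
          fix x y assume "x \<in> C \<inter> X" "y \<in> A n"
          then show "r n \<le> dist x y" using close[of y x] by (simp add: A_def dist_commute)
        qed
        also have "\<dots> \<le> ?f X" by (rule outer_mono) (auto simp: A_def)
        finally show ?thesis .
      qed
      have part: "(\<Sum>k<n. ?f (R (2 * k + j))) \<le> ?f (\<Union>k<n. R (2 * k + j))" for n j
      proof (induction n)
        case (Suc n)
        have "(\<Sum>k<Suc n. ?f (R (2 * k + j))) \<le> ?f (\<Union>k<n. R (2 * k + j)) + ?f (R (2 * n + j))"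
          using Suc by (simp add: add_right_mono)
        also have "\<dots> \<le> ?f ((\<Union>k<n. R (2 * k + j)) \<union> R (2 * n + j))"
        proof (rule outer_separated)
          show "0 < r (2 * n + j) - r (Suc (2 * n + j))" using r by simp
          fix x y assume "x \<in> (\<Union>k<n. R (2 * k + j))" "y \<in> R (2 * n + j)"
          then obtain k where k: "k < n" "r (Suc (2 * k + j)) \<le> infdist x C" and y: "infdist y C < r (2 * n + j)"
            by (auto simp: R_def)
          have "r (2 * n + j - 1) \<le> r (Suc (2 * k + j))" using k by (intro r_anti) simp
          moreover have "r (2 * n + j) - r (Suc (2 * n + j)) \<le> r (2 * n + j - 1) - r (2 * n + j)"
            using k r_diff[of "2 * n + j - 1"] by simp
          ultimately show "r (2 * n + j) - r (Suc (2 * n + j)) \<le> dist x y"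
            using close[of x y] k y by linarith
        qed
        also have "(\<Union>k<n. R (2 * k + j)) \<union> R (2 * n + j) = (\<Union>k<Suc n. R (2 * k + j))"
          by (auto simp: less_Suc_eq)
        finally show ?case .
      qed (simp add: outer_empty)
      have "(\<Sum>k<n. ?f (R k)) \<le> 2 * ?f X" for n
      proof -
        have "(\<Sum>k<n. ?f (R k)) \<le> (\<Sum>k<2 * n. ?f (R k))"
          by (rule sum_mono2) auto
        also have "\<dots> = (\<Sum>k<n. ?f (R (2 * k + 0))) + (\<Sum>k<n. ?f (R (2 * k + 1)))"
          by (induction n) (simp_all add: ac_simps)
        also have "\<dots> \<le> ?f X + ?f X"
          by (intro add_mono order_trans[OF part] outer_mono) (auto simp: R_def)
        finally show ?thesis by (simp add: mult_2)
      qed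
      then have "(\<Sum>k. ?f (R k)) \<le> 2 * ?f X"
        by (intro suminf_le_const) auto
      also have "2 * ?f X < top" using fin by (simp add: ennreal_mult_less_top)
      finally have fsum: "(\<Sum>k. ?f (R k)) < top" .
      have fk: "?f (R k) < top" for k
        using ennreal_suminf_lessD[OF fsum] .
      \<comment> \<open>Real values, so that the tail estimate for convergent series applies.\<close>
      define q where "q k = enn2real (?f (R k))" for k
      have q: "?f (R k) = ennreal (q k)" "0 \<le> q k" for k using fk[of k] by (auto simp: q_def)
      have "summable q"
        using fsum q by (intro summable_suminf_not_top) auto
      have tail: "?f ((UNIV - C) \<inter> X) \<le> ?f (A n) + ennreal (\<Sum>k. q (k + n))" for n
      proof -
        have "(UNIV - C) \<inter> X \<subseteq> A n \<union> (\<Union>k. R (k + n))"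
        proof
          fix x assume "x \<in> (UNIV - C) \<inter> X"
          then have x: "x \<notin> C" "x \<in> X" by auto
          then have "0 < infdist x C"
            using in_closed_iff_infdist_zero[OF C \<open>C \<noteq> {}\<close>] infdist_nonneg[of x C] by (metis less_le)
          show "x \<in> A n \<union> (\<Union>k. R (k + n))"
          proof (cases "r n \<le> infdist x C")
            case True
            then show ?thesis using x by (simp add: A_def)
          next
            case False
            obtain m where m: "r m < infdist x C"
              using \<open>0 < infdist x C\<close> reals_Archimedean[of "infdist x C"] by (auto simp: r_def inverse_eq_divide add.commute)
            define l where "l = (LEAST l. r l \<le> infdist x C)"
            have l: "r l \<le> infdist x C" unfolding l_def by (rule LeastI[of _ m]) (use m in simp)
            have "n < l" using l False r_anti[of l n] by (metis not_le order_trans)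
            then obtain k where k: "l = Suc (k + n)" by (metis add.commute less_iff_Suc_add)
            have "\<not> r (k + n) \<le> infdist x C" using not_less_Least[of "k + n" "\<lambda>l. r l \<le> infdist x C"] k by (simp add: l_def)
            then have "x \<in> R (k + n)" using l k x by (simp add: R_def)
            then show ?thesis by blast
          qed
        qed
        then have "?f ((UNIV - C) \<inter> X) \<le> ?f (A n \<union> (\<Union>k. R (k + n)))" by (rule outer_mono)
        also have "\<dots> \<le> ?f (A n) + (\<Sum>k. ?f (R (k + n)))"
          by (intro order_trans[OF outer_Un] add_left_mono outer_subadditive)
        also have "(\<Sum>k. ?f (R (k + n))) = ennreal (\<Sum>k. q (k + n))"
          unfolding q using \<open>summable q\<close> q(2) by (intro suminf_ennreal2) (auto simp: summable_iff_shift)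
        finally show ?thesis .
      qed
      show ?thesis
      proof (rule ennreal_le_epsilon)
        fix e :: real assume "0 < e"
        obtain n where n: "norm (\<Sum>k. q (k + n)) < e"
          using suminf_exist_split[OF \<open>0 < e\<close> \<open>summable q\<close>] by blast
        have "?f (C \<inter> X) + ?f ((UNIV - C) \<inter> X) \<le> ?f (C \<inter> X) + (?f (A n) + ennreal (\<Sum>k. q (k + n)))"
          by (intro add_left_mono tail)
        also have "\<dots> \<le> ?f X + ennreal e"
          unfolding add.assoc[symmetric] using n by (intro add_mono A ennreal_leI) auto
        finally show "?f (C \<inter> X) + ?f ((UNIV - C) \<inter> X) \<le> ?f X + ennreal e" .
      qed
    qed
  qed
  then show ?thesis by (simp add: lambda_system_def)
qed

lemma measure_space_hausdorff: "measure_space UNIV (lambda_system UNIV UNIV (hausdorff_outer s)) (hausdorff_outer s)"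
  using sigma_algebra.caratheodory_lemma[OF _ outer_measure_space, of UNIV s]
    sigma_algebra_Pow[of UNIV] by (simp add: Pow_UNIV)

lemma space_hausdorff [simp]: "space (hausdorff_measure s) = UNIV"
  unfolding hausdorff_measure_def by (rule space_measure_of) simp

lemma sets_hausdorff: "sets (hausdorff_measure s) = lambda_system UNIV UNIV (hausdorff_outer s)"
  unfolding hausdorff_measure_def
  by (rule sigma_algebra.sets_measure_of_eq[OF measure_space_hausdorff[unfolded measure_space_def, THEN conjunct1]])

lemma emeasure_hausdorff:
  assumes "A \<in> sets (hausdorff_measure s)"
  shows "emeasure (hausdorff_measure s) A = hausdorff_outer s A"
proof -
  note ms = measure_space_hausdorff[unfolded measure_space_def]
  show ?thesis
    unfolding hausdorff_measure_def
    by (rule emeasure_measure_of_sigma[OF ms[THEN conjunct1] ms[THEN conjunct2, THEN conjunct1] ms[THEN conjunct2, THEN conjunct2]])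
      (use assms in \<open>simp add: sets_hausdorff\<close>)
qed

lemma borel_subset_hausdorff: "sets borel \<subseteq> sets (hausdorff_measure s :: 'a::metric_space measure)"
proof -
  have "sets (borel :: 'a measure) = sigma_sets UNIV (Collect closed)"
    unfolding borel_eq_closed by simp
  also have "\<dots> \<subseteq> sets (hausdorff_measure s)"
    using sets.sigma_sets_subset[of "Collect closed" "hausdorff_measure s"] closed_in_lambda_system
    by (auto simp: sets_hausdorff)
  finally show ?thesis .
qed

text \<open>
  This makes the Hausdorff measure complete.
\<close>

lemma null_in_hausdorff:
  assumes "hausdorff_outer s A = 0" shows "A \<in> sets (hausdorff_measure s)"
proof -
  have "hausdorff_outer s (A \<inter> X) + hausdorff_outer s ((UNIV - A) \<inter> X) = hausdorff_outer s X" for X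
  proof (rule antisym)
    have "hausdorff_outer s (A \<inter> X) = 0"
      using outer_mono[of "A \<inter> X" A s] assms by simp
    then show "hausdorff_outer s (A \<inter> X) + hausdorff_outer s ((UNIV - A) \<inter> X) \<le> hausdorff_outer s X"
      by (simp add: outer_mono)
    show "hausdorff_outer s X \<le> hausdorff_outer s (A \<inter> X) + hausdorff_outer s ((UNIV - A) \<inter> X)"
      using outer_Un[of s "A \<inter> X" "(UNIV - A) \<inter> X"] by (simp add: Int_Un_distrib2[symmetric])
  qed
  then show ?thesis by (simp add: sets_hausdorff lambda_system_def)
qed

lemma premeasure_similarity:
  fixes T :: "'a::real_normed_vector \<Rightarrow> 'b::real_normed_vector"
  assumes T: "\<And>x y. dist (T x) (T y) = c * dist x y" and "0 < c" and "0 \<le> s"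
  shows "hausdorff_premeasure s (c * \<delta>) (T ` A) \<le> ennreal (c powr s) * hausdorff_premeasure s \<delta> A"
proof -
  have le: "hausdorff_premeasure s (c * \<delta>) (T ` A) \<le> ennreal (c powr s) * cover_size s U" if U: "fine_cover \<delta> A U" for U
  proof -
    have bd: "bounded (T ` U i)" for i
    proof -
      have "bounded (U i)" using U by (simp add: fine_cover_def)
      then obtain x e where "\<forall>y\<in>U i. dist x y \<le> e" unfolding bounded_def by blast
      then have "\<forall>y\<in>T ` U i. dist (T x) y \<le> c * e" using \<open>0 < c\<close> by (auto simp: T)
      then show ?thesis unfolding bounded_def by blast
    qed
    have di: "diameter (T ` U i) \<le> c * diameter (U i)" for i
    proof (rule diameter_le)
      show "T ` U i \<noteq> {} \<or> 0 \<le> c * diameter (U i)"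
        using \<open>0 < c\<close> U diameter_ge_0 by (auto simp: fine_cover_def)
      fix x y assume "x \<in> T ` U i" "y \<in> T ` U i"
      then show "norm (x - y) \<le> c * diameter (U i)"
        unfolding dist_norm[symmetric] using \<open>0 < c\<close> U by (auto simp: T fine_cover_def intro!: mult_left_mono diameter_bounded_bound)
    qed
    have "fine_cover (c * \<delta>) (T ` A) (\<lambda>i. T ` U i)"
      unfolding fine_cover_def
    proof (intro conjI allI bd)
      show "T ` A \<subseteq> (\<Union>i. T ` U i)" using U unfolding fine_cover_def by blast
      fix i
      have "c * diameter (U i) \<le> c * \<delta>" using U \<open>0 < c\<close> by (auto simp: fine_cover_def)
      with di show "diameter (T ` U i) \<le> c * \<delta>" using order_trans by blast
    qed
    then have "hausdorff_premeasure s (c * \<delta>) (T ` A) \<le> cover_size s (\<lambda>i. T ` U i)" by (rule premeasure_le)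
    also have "\<dots> \<le> (\<Sum>i. ennreal (c powr s) * ennreal (diameter (U i) powr s))"
      unfolding cover_size_def
    proof (intro suminf_le)
      fix i
      have "0 \<le> diameter (T ` U i)" "0 \<le> diameter (U i)"
        using U bd diameter_ge_0 by (auto simp: fine_cover_def)
      moreover from this have "diameter (T ` U i) powr s \<le> (c * diameter (U i)) powr s"
        using di \<open>0 \<le> s\<close> by (intro powr_mono2) auto
      ultimately show "ennreal (diameter (T ` U i) powr s) \<le> ennreal (c powr s) * ennreal (diameter (U i) powr s)"
        using \<open>0 < c\<close> by (simp add: powr_mult flip: ennreal_mult')
    qed auto
    also have "\<dots> = ennreal (c powr s) * cover_size s U"
      by (simp add: cover_size_def)
    finally show ?thesis .
  qed
  define k where "k = ennreal (c powr s)"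
  have k: "k \<noteq> 0" "k \<noteq> top" using \<open>0 < c\<close> by (auto simp: k_def)
  have "hausdorff_premeasure s (c * \<delta>) (T ` A) / k \<le> hausdorff_premeasure s \<delta> A"
  proof (rule premeasure_geI)
    fix U assume "fine_cover \<delta> A U"
    from le[OF this] have "hausdorff_premeasure s (c * \<delta>) (T ` A) / k \<le> (k * cover_size s U) / k"
      unfolding k_def by (rule divide_right_mono_ennreal)
    also have "(k * cover_size s U) / k = cover_size s U"
      using k by (simp add: mult.commute[of k] mult_divide_eq_ennreal)
    finally show "hausdorff_premeasure s (c * \<delta>) (T ` A) / k \<le> cover_size s U" .
  qed
  from mult_left_mono[OF this, of k] have "k * (hausdorff_premeasure s (c * \<delta>) (T ` A) / k) \<le> k * hausdorff_premeasure s \<delta> A"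
    by simp
  moreover have "k * (hausdorff_premeasure s (c * \<delta>) (T ` A) / k) = hausdorff_premeasure s (c * \<delta>) (T ` A)"
    using k by (simp add: ennreal_times_divide mult.commute[of k] mult_divide_eq_ennreal)
  ultimately show ?thesis unfolding k_def by simp
qed

lemma outer_similarity:
  fixes T :: "'a::real_normed_vector \<Rightarrow> 'b::real_normed_vector"
  assumes T: "\<And>x y. dist (T x) (T y) = c * dist x y" and "0 < c" and "0 \<le> s"
  shows "hausdorff_outer s (T ` A) \<le> ennreal (c powr s) * hausdorff_outer s A"
proof (rule outer_leI)
  fix \<delta> :: real assume "0 < \<delta>"
  have "hausdorff_premeasure s (c * (\<delta> / c)) (T ` A) \<le> ennreal (c powr s) * hausdorff_premeasure s (\<delta> / c) A"
    by (rule premeasure_similarity[OF assms])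
  also have "\<dots> \<le> ennreal (c powr s) * hausdorff_outer s A"
    using \<open>0 < \<delta>\<close> \<open>0 < c\<close> by (intro mult_left_mono premeasure_le_outer) auto
  finally show "hausdorff_premeasure s \<delta> (T ` A) \<le> ennreal (c powr s) * hausdorff_outer s A"
    using \<open>0 < c\<close> by simp
qed

section \<open>Geometry of the gasket\<close>

text \<open>
  The maps and the gasket are studied in barycentric coordinates. These are explicit affine
  functions on any Euclidean space that contains the simplex.
\<close>

locale regular_simplex =
  fixes N :: nat and p :: "nat \<Rightarrow> 'a::euclidean_space"
  assumes N2: "2 \<le> N"
    and dist_p: "\<And>i j. i \<in> {1..N} \<Longrightarrow> j \<in> {1..N} \<Longrightarrow> i \<noteq> j \<Longrightarrow> norm (p i - p j) = 1"
begin

definition I :: "nat set" where "I = {1..N}"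

lemma I_simps [simp]: "finite I" "card I = N" "I \<noteq> {}"
  using N2 by (auto simp: I_def)

lemma norm_p_diff: "i \<in> I \<Longrightarrow> j \<in> I \<Longrightarrow> i \<noteq> j \<Longrightarrow> norm (p i - p j) = 1"
  using dist_p by (simp add: I_def)

abbreviation "V \<equiv> gasket N p"
abbreviation "Vs \<equiv> gasket_vertices N p"

definition S :: "nat \<Rightarrow> 'a \<Rightarrow> 'a" where "S i x = (1/2) *\<^sub>R x + (1/2) *\<^sub>R p i"

definition centroid :: 'a where "centroid = (1 / real N) *\<^sub>R (\<Sum>i\<in>I. p i)"

text \<open>
  The vectors \<open>p i - centroid\<close> have the Gram matrix \<open>(\<delta>\<^sub>i\<^sub>j - 1 / N) / 2\<close>, so this affine function
  is \<open>1\<close> at \<open>p i\<close> and \<open>0\<close> at the other corners: it is the \<open>i\<close>-th barycentric coordinate.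
\<close>

definition bary :: "nat \<Rightarrow> 'a \<Rightarrow> real" where
  "bary i x = 1 / real N + 2 * ((p i - centroid) \<bullet> (x - centroid))"

lemma N_pos: "0 < real N" "1 \<in> I" "2 \<in> I"
  using N2 by (auto simp: I_def)

lemma sum_centred: "(\<Sum>i\<in>I. p i - centroid) = 0"
  using N_pos by (simp add: sum_subtractf centroid_def sum_constant_scaleR)

lemma inner_p:
  assumes i: "i \<in> I" and j: "j \<in> I"
  shows "(p i - centroid) \<bullet> (p j - centroid) = ((if i = j then 1 else 0) - 1 / real N) / 2"
proof -
  define q where "q i = p i - centroid" for i
  have sq0: "(\<Sum>i\<in>I. q i) = 0" using sum_centred by (simp add: q_def)
  have d: "(norm (q i - q j))\<^sup>2 = (if i = j then 0 else 1)" if "i \<in> I" "j \<in> I" for i j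
    using norm_p_diff[OF that] by (simp add: q_def)
  define T where "T = (\<Sum>j\<in>I. q j \<bullet> q j)"
  have e: "(\<Sum>j\<in>I. (norm (q i - q j))\<^sup>2) = real N * (q i \<bullet> q i) + T" for i
  proof -
    have "(\<Sum>j\<in>I. (norm (q i - q j))\<^sup>2) = (\<Sum>j\<in>I. q i \<bullet> q i - 2 * (q i \<bullet> q j) + q j \<bullet> q j)"
      by (intro sum.cong) (auto simp: power2_norm_eq_inner inner_simps inner_commute)
    also have "\<dots> = real N * (q i \<bullet> q i) - 2 * (q i \<bullet> (\<Sum>j\<in>I. q j)) + T"
      by (simp add: sum.distrib sum_subtractf inner_sum_right sum_distrib_left T_def)
    finally show ?thesis by (simp add: sq0)
  qed
  have e2: "real N * (q i \<bullet> q i) + T = real N - 1" if i: "i \<in> I" for i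
  proof -
    have "(\<Sum>j\<in>I. (norm (q i - q j))\<^sup>2) = (\<Sum>j\<in>I. if i = j then 0 else 1)"
      using d i by (intro sum.cong) auto
    also have "\<dots> = (\<Sum>j\<in>I. 1) - (\<Sum>j\<in>I. if i = j then 1 else 0)"
      unfolding sum_subtractf[symmetric] by (intro sum.cong) auto
    also have "\<dots> = real N - 1" using i by simp
    finally show ?thesis using e[of i] by simp
  qed
  have "(\<Sum>i\<in>I. real N * (q i \<bullet> q i) + T) = real N * (real N - 1)"
    using e2 by simp
  then have "real N * T + real N * T = real N * (real N - 1)"
    by (simp add: sum.distrib T_def sum_distrib_left)
  then have "real N * (2 * T) = real N * (real N - 1)" by simp
  then have T: "T = (real N - 1) / 2"
    using N_pos(1) by (simp only: mult_cancel_left) auto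
  have self: "q i \<bullet> q i = (real N - 1) / (2 * real N)" if "i \<in> I" for i
    using e2[OF that] N_pos by (simp add: T field_simps)
  have "q i \<bullet> q j = (q i \<bullet> q i + q j \<bullet> q j - (norm (q i - q j))\<^sup>2) / 2"
    by (simp add: power2_norm_eq_inner inner_simps inner_commute)
  also have "\<dots> = ((if i = j then 1 else 0) - 1 / real N) / 2"
    using N_pos self[OF i] self[OF j] d[OF i j] by (auto simp: field_simps)
  finally show ?thesis by (simp add: q_def)
qed

lemma bary_p: "i \<in> I \<Longrightarrow> j \<in> I \<Longrightarrow> bary i (p j) = (if i = j then 1 else 0)"
  using N_pos by (simp add: bary_def inner_p field_simps)

lemma bary_sum: "(\<Sum>i\<in>I. bary i x) = 1"
proof -
  have "(\<Sum>i\<in>I. bary i x) = (\<Sum>i\<in>I. 1 / real N) + 2 * ((\<Sum>i\<in>I. p i - centroid) \<bullet> (x - centroid))"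
    by (simp only: bary_def sum.distrib inner_sum_left sum_distrib_left)
  then show ?thesis using N_pos by (simp add: sum_centred)
qed

lemma bary_diff: "bary i x - bary i y = 2 * ((p i - centroid) \<bullet> (x - y))"
  by (simp add: bary_def inner_simps)

lemma bary_S: "i \<in> I \<Longrightarrow> j \<in> I \<Longrightarrow> bary i (S j x) = (bary i x + (if i = j then 1 else 0)) / 2"
proof -
  assume i: "i \<in> I" and j: "j \<in> I"
  have "bary i (S j x) = (bary i x + bary i (p j)) / 2"
    by (simp add: bary_def S_def inner_simps field_simps)
  with i j show ?thesis by (simp add: bary_p)
qed

lemma bary_lipschitz:
  assumes "i \<in> I" shows "\<bar>bary i x - bary i y\<bar> \<le> 2 * norm (x - y)"
proof -
  have "(1 - w) / 2 \<le> 1" if "0 \<le> w" for w :: real using that by simp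
  from this[of "1 / real N"] have "(1 - 1 / real N) / 2 \<le> 1" by simp
  moreover have "(norm (p i - centroid))\<^sup>2 = (1 - 1 / real N) / 2"
    using inner_p[OF assms assms] by (simp add: power2_norm_eq_inner)
  ultimately have "(norm (p i - centroid))\<^sup>2 \<le> 1\<^sup>2"
    by (simp only: power_one)
  then have "norm (p i - centroid) \<le> 1"
    using power2_le_imp_le zero_le_one by blast
  then have "\<bar>(p i - centroid) \<bullet> (x - y)\<bar> \<le> 1 * norm (x - y)"
    using Cauchy_Schwarz_ineq2[of "p i - centroid" "x - y"] mult_right_mono[of "norm (p i - centroid)" 1 "norm (x - y)"]
    by simp
  then show ?thesis by (simp add: bary_diff)
qed

lemma continuous_bary: "continuous_on A (bary i)"
  unfolding bary_def by (intro continuous_intros)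

text \<open>
  The points that are recovered from their barycentric coordinates. This set is closed, contains the
  corners and is invariant under the maps \<open>S i\<close>, hence it contains the gasket.
\<close>

definition affine_hull_p :: "'a set" where
  "affine_hull_p = {x. x = (\<Sum>i\<in>I. bary i x *\<^sub>R p i)}"

text \<open>
  This identity turns the condition \<open>norm (x - y) = 1 / 2 ^ m\<close> into one on integers.
\<close>

lemma norm_bary:
  assumes "x \<in> affine_hull_p" "y \<in> affine_hull_p"
  shows "(norm (x - y))\<^sup>2 = (\<Sum>i\<in>I. (bary i x - bary i y)\<^sup>2) / 2"
proof -
  have x: "x = (\<Sum>i\<in>I. bary i x *\<^sub>R p i)" and y: "y = (\<Sum>i\<in>I. bary i y *\<^sub>R p i)"
    using assms unfolding affine_hull_p_def by blast+
  define d where "d i = bary i x - bary i y" for i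
  have "x - y = (\<Sum>i\<in>I. d i *\<^sub>R p i)"
    by (subst x, subst y) (simp add: d_def sum_subtractf scaleR_left_diff_distrib)
  also have "\<dots> = (\<Sum>i\<in>I. d i *\<^sub>R (p i - centroid)) + (\<Sum>i\<in>I. d i) *\<^sub>R centroid"
    by (simp add: scaleR_right_diff_distrib sum_subtractf scaleR_left.sum)
  also have "(\<Sum>i\<in>I. d i) = 0"
    by (simp add: d_def sum_subtractf bary_sum)
  finally have eq: "x - y = (\<Sum>i\<in>I. d i *\<^sub>R (p i - centroid))" by simp
  have "(norm (x - y))\<^sup>2 = (\<Sum>i\<in>I. d i *\<^sub>R (p i - centroid)) \<bullet> (x - y)"
    unfolding power2_norm_eq_inner by (subst eq) simp
  also have "\<dots> = (\<Sum>i\<in>I. d i * (d i / 2))"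
    by (simp add: inner_sum_left d_def bary_diff)
  also have "\<dots> = (\<Sum>i\<in>I. (bary i x - bary i y)\<^sup>2) / 2"
    by (simp add: d_def power2_eq_square sum_divide_distrib)
  finally show ?thesis .
qed

lemma bary_eqI:
  assumes "x \<in> affine_hull_p" "y \<in> affine_hull_p" "\<And>i. i \<in> I \<Longrightarrow> bary i x = bary i y"
  shows "x = y"
  using norm_bary[OF assms(1,2)] assms(3) by simp

lemma p_in_affine_hull: "j \<in> I \<Longrightarrow> p j \<in> affine_hull_p"
proof -
  assume j: "j \<in> I"
  have "(\<Sum>i\<in>I. bary i (p j) *\<^sub>R p i) = (\<Sum>i\<in>I. if i = j then p i else 0)"
    using j by (intro sum.cong) (auto simp: bary_p)
  also have "\<dots> = p j" using j by simp
  finally show ?thesis by (simp add: affine_hull_p_def)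
qed

lemma S_in_affine_hull: "x \<in> affine_hull_p \<Longrightarrow> j \<in> I \<Longrightarrow> S j x \<in> affine_hull_p"
proof -
  assume x: "x \<in> affine_hull_p" and j: "j \<in> I"
  have x': "x = (\<Sum>i\<in>I. bary i x *\<^sub>R p i)" using x by (simp add: affine_hull_p_def)
  have "(\<Sum>i\<in>I. bary i (S j x) *\<^sub>R p i) = (\<Sum>i\<in>I. (1/2) *\<^sub>R (bary i x *\<^sub>R p i) + (if i = j then (1/2) *\<^sub>R p i else 0))"
    using j by (intro sum.cong) (auto simp: bary_S scaleR_left_distrib add_divide_distrib)
  also have "\<dots> = (1/2) *\<^sub>R (\<Sum>i\<in>I. bary i x *\<^sub>R p i) + (1/2) *\<^sub>R p j"
    using j by (simp add: sum.distrib scaleR_sum_right)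
  also have "\<dots> = S j x" using x' by (simp add: S_def)
  finally show ?thesis by (simp add: affine_hull_p_def)
qed

lemma closed_affine_hull: "closed affine_hull_p"
  unfolding affine_hull_p_def by (intro closed_Collect_eq continuous_intros continuous_bary)

lemma gasket_map_S: "gasket_map N p A = (\<Union>i\<in>I. S i ` A)"
  by (simp add: gasket_map_def S_def I_def)

lemma S_diff: "S i x - S i y = (1/2) *\<^sub>R (x - y)"
  by (simp add: S_def algebra_simps)

lemma norm_S_diff: "norm (S i x - S i y) = norm (x - y) / 2"
  by (simp add: S_diff)

lemma S_eq_iff [simp]: "S i x = S i y \<longleftrightarrow> x = y"
  by (simp add: S_def)

lemma S_p: "S i (p i) = p i"
  by (simp add: S_def flip: scaleR_left_distrib)

lemma S_p_sym: "S i (p j) = S j (p i)"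
  by (simp add: S_def add.commute)

lemma continuous_S [continuous_intros]: "continuous_on A (S i)"
  unfolding S_def by (intro continuous_intros)

lemma Vs_0: "Vs 0 = p ` I"
  by (simp add: gasket_vertices_def gasket_boundary_def I_def)

lemma Vs_Suc: "Vs (Suc m) = (\<Union>i\<in>I. S i ` Vs m)"
  by (simp add: gasket_vertices_def gasket_map_S)

lemma boundary_eq: "gasket_boundary N p = p ` I"
  by (simp add: gasket_boundary_def I_def)

lemma finite_Vs: "finite (Vs m)"
  by (induction m) (auto simp: Vs_0 Vs_Suc)

lemma Vs_mono_Suc: "Vs m \<subseteq> Vs (Suc m)"
proof (induction m)
  case 0
  show ?case
  proof
    fix x assume "x \<in> Vs 0"
    then obtain i where i: "i \<in> I" "x = p i" by (auto simp: Vs_0)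
    then have "x = S i (p i)" by (simp add: S_p)
    with i show "x \<in> Vs (Suc 0)" unfolding Vs_Suc Vs_0 by blast
  qed
next
  case (Suc m)
  then show ?case by (subst (2) Vs_Suc, subst Vs_Suc) blast
qed

lemma p_in_Vs: "i \<in> I \<Longrightarrow> p i \<in> Vs m"
  by (induction m) (use Vs_mono_Suc in \<open>auto simp: Vs_0\<close>)

definition "Vstar = (\<Union>m. Vs m)"

lemma gasket_map_Vstar: "gasket_map N p Vstar = Vstar"
proof -
  have "gasket_map N p Vstar = (\<Union>m. Vs (Suc m))"
    by (auto simp: gasket_map_S Vstar_def Vs_Suc)
  also have "\<dots> = Vstar"
    using Vs_mono_Suc by (auto simp: Vstar_def)
  finally show ?thesis .
qed

lemma closure_S: "closure (S i ` A) = S i ` closure A"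
proof -
  have "S i ` A = (+) ((1/2) *\<^sub>R p i) ` ((*\<^sub>R) (1/2) ` A)" for A
    by (auto simp: S_def image_image add.commute)
  then show ?thesis
    by (simp add: closure_translation closure_scaleR)
qed

lemma closure_finite_UN: "finite J \<Longrightarrow> closure (\<Union>i\<in>J. A i) = (\<Union>i\<in>J. closure (A i))"
  by (induction J rule: finite_induct) auto

lemma gasket_map_closure: "gasket_map N p (closure A) = closure (gasket_map N p A)"
  by (simp add: gasket_map_S closure_finite_UN closure_S)

lemma bounded_Vstar: "bounded Vstar"
proof -
  define R where "R = Max (norm ` p ` I)"
  have R: "norm (p i) \<le> R" if "i \<in> I" for i
    unfolding R_def using that by (intro Max_ge) auto
  have "norm x \<le> R" if "x \<in> Vs m" for x m
    using that
  proof (induction m arbitrary: x)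
    case 0 then show ?case using R by (auto simp: Vs_0)
  next
    case (Suc m)
    then obtain i y where i: "i \<in> I" "y \<in> Vs m" "x = S i y" by (auto simp: Vs_Suc)
    have "norm x \<le> norm y / 2 + norm (p i) / 2"
      unfolding i S_def using norm_triangle_ineq[of "(1/2) *\<^sub>R y" "(1/2) *\<^sub>R p i"] by simp
    with Suc.IH[OF i(2)] R[OF i(1)] show ?case by simp
  qed
  then show ?thesis by (auto simp: bounded_iff Vstar_def)
qed

text \<open>
  A point of \<open>K\<close> with the greatest distance from \<open>L\<close> is the image under some \<open>S i\<close> of another point of
  \<open>K\<close>, and \<open>S i\<close> halves distances and maps \<open>L\<close> into itself. So that distance is \<open>0\<close>.
\<close>

lemma attractor_subset:
  assumes K: "K \<noteq> {}" "compact K" "gasket_map N p K = K"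
    and L: "L \<noteq> {}" "compact L" "gasket_map N p L = L"
  shows "K \<subseteq> L"
proof -
  have "continuous_on K (\<lambda>x. infdist x L)"
    by (intro continuous_intros)
  from continuous_attains_sup[OF K(2,1) this]
  obtain x where x: "x \<in> K" "\<And>y. y \<in> K \<Longrightarrow> infdist y L \<le> infdist x L" by auto
  have "\<exists>i\<in>I. \<exists>x'\<in>K. x = S i x'"
  proof -
    have "x \<in> gasket_map N p K" using x(1) K(3) by simp
    then show ?thesis by (auto simp: gasket_map_S)
  qed
  then obtain i x' where i: "i \<in> I" "x' \<in> K" "x = S i x'" by blast
  obtain z where z: "z \<in> L" "infdist x' L = dist x' z"
    using infdist_attains_inf[of L x'] L by (auto simp: compact_imp_closed)
  have "S i z \<in> gasket_map N p L"
    using z i by (auto simp: gasket_map_S)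
  then have "S i z \<in> L" using L(3) by simp
  then have "infdist x L \<le> dist (S i x') (S i z)"
    unfolding i(3) by (rule infdist_le)
  also have "\<dots> = infdist x' L / 2"
    by (simp add: dist_norm norm_S_diff z)
  also have "\<dots> \<le> infdist x L / 2"
    using x(2)[OF i(2)] by simp
  finally have "infdist x L \<le> 0" by simp
  then have "infdist y L = 0" if "y \<in> K" for y
    using x(2)[OF that] infdist_nonneg[of y L] by simp
  then show ?thesis
    using L in_closed_iff_infdist_zero[of L] by (auto simp: compact_imp_closed)
qed

lemma gasket_eq_closure: "V = closure Vstar"
proof -
  have ne: "Vstar \<noteq> {}"
    using p_in_Vs[of 1 0] N_pos by (auto simp: Vstar_def)
  have A: "closure Vstar \<noteq> {}" "compact (closure Vstar)" "gasket_map N p (closure Vstar) = closure Vstar"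
    using ne bounded_Vstar by (auto simp: compact_closure gasket_map_closure gasket_map_Vstar)
  show ?thesis
    unfolding gasket_def
  proof (rule the_equality)
    fix K assume "K \<noteq> {} \<and> compact K \<and> gasket_map N p K = K"
    then show "K = closure Vstar"
      using A attractor_subset[of K "closure Vstar"] attractor_subset[of "closure Vstar" K] by blast
  qed (use A in blast)
qed

lemma compact_V: "compact V" and closed_V: "closed V" and V_ne: "V \<noteq> {}" and gasket_map_V: "gasket_map N p V = V"
proof -
  show "compact V" unfolding gasket_eq_closure using bounded_Vstar by simp
  then show "closed V" by (rule compact_imp_closed)
  show "V \<noteq> {}" unfolding gasket_eq_closure using p_in_Vs[of 1 0] N_pos by (auto simp: Vstar_def)
  show "gasket_map N p V = V" unfolding gasket_eq_closure by (simp add: gasket_map_closure gasket_map_Vstar)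
qed

lemma V_eq: "V = (\<Union>i\<in>I. S i ` V)"
  using gasket_map_V by (simp add: gasket_map_S)

lemma S_in_V: "x \<in> V \<Longrightarrow> i \<in> I \<Longrightarrow> S i x \<in> V"
  using V_eq by blast

lemma V_cases:
  assumes "x \<in> V" obtains i y where "i \<in> I" "y \<in> V" "x = S i y"
  using assms V_eq by blast

lemma Vs_subset: "Vs m \<subseteq> V"
  unfolding gasket_eq_closure by (auto simp: Vstar_def intro!: closure_subset[THEN subsetD])

lemma p_in_V: "i \<in> I \<Longrightarrow> p i \<in> V"
  using p_in_Vs Vs_subset by blast

lemma V_induct:
  assumes "closed {x. P x}" "\<And>i. i \<in> I \<Longrightarrow> P (p i)" "\<And>x i. P x \<Longrightarrow> i \<in> I \<Longrightarrow> P (S i x)" "x \<in> V"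
  shows "P x"
proof -
  have "P x" if "x \<in> Vs m" for x m
    using that by (induction m arbitrary: x) (use assms in \<open>auto simp: Vs_0 Vs_Suc\<close>)
  then have "closure Vstar \<subseteq> {x. P x}"
    using assms(1) by (intro closure_minimal) (auto simp: Vstar_def)
  with assms(4) show ?thesis by (auto simp: gasket_eq_closure)
qed

lemma V_affine: "x \<in> V \<Longrightarrow> x \<in> affine_hull_p"
  by (rule V_induct) (use closed_affine_hull p_in_affine_hull S_in_affine_hull in auto)

lemma bary_nonneg: "x \<in> V \<Longrightarrow> i \<in> I \<Longrightarrow> 0 \<le> bary i x"
  by (rule V_induct[of "\<lambda>x. 0 \<le> bary i x"])
    (auto simp: bary_p bary_S intro!: closed_Collect_le continuous_intros continuous_bary)

lemma bary_le_1: "x \<in> V \<Longrightarrow> i \<in> I \<Longrightarrow> bary i x \<le> 1"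
  using bary_sum[of x] member_le_sum[of i I "\<lambda>i. bary i x"] bary_nonneg by auto

lemma bary_add_le_1:
  assumes "x \<in> V" "i \<in> I" "j \<in> I" "i \<noteq> j"
  shows "bary i x + bary j x \<le> 1"
proof -
  have "(\<Sum>l\<in>{i,j}. bary l x) \<le> (\<Sum>l\<in>I. bary l x)"
    using assms bary_nonneg by (intro sum_mono2) auto
  with assms show ?thesis by (simp add: bary_sum)
qed

lemma bary_S_ge: "x \<in> V \<Longrightarrow> i \<in> I \<Longrightarrow> 1 / 2 \<le> bary i (S i x)"
  using bary_nonneg[of x i] by (simp add: bary_S)

lemma V_eqI: "x \<in> V \<Longrightarrow> y \<in> V \<Longrightarrow> (\<And>i. i \<in> I \<Longrightarrow> bary i x = bary i y) \<Longrightarrow> x = y"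
  by (rule bary_eqI) (auto intro: V_affine)

lemma bary_eq_1_imp:
  assumes "x \<in> V" "i \<in> I" "1 \<le> bary i x" shows "x = p i"
proof (rule V_eqI)
  fix l assume l: "l \<in> I"
  show "bary l x = bary l (p i)"
    using bary_add_le_1[of x i l] bary_le_1[of x i] bary_nonneg[of x l] l assms by (auto simp: bary_p)
qed (use assms p_in_V in auto)

text \<open>
  A point of two cells has two barycentric coordinates that are at least \<open>1 / 2\<close>; it is the midpoint of
  two corners.
\<close>

lemma S_overlap:
  assumes "x \<in> V" "y \<in> V" "i \<in> I" "j \<in> I" "i \<noteq> j" "S i x = S j y"
  shows "x = p j" "y = p i"
proof -
  have "1/2 \<le> bary j (S i x)" using bary_S_ge[of y j] assms by simp
  then have "1 \<le> bary j x" using bary_S[of j i x] assms(3-5) by simp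
  moreover have "1/2 \<le> bary i (S j y)" using bary_S_ge[of x i] assms by simp
  then have "1 \<le> bary i y" using bary_S[of i j y] assms(3-5) by simp
  ultimately show "x = p j" "y = p i" using bary_eq_1_imp assms by auto
qed

lemma V_near_corner:
  assumes "x \<in> V" "j \<in> I" "1 / 2 < bary j x"
  obtains y where "y \<in> V" "x = S j y"
proof -
  obtain i y where i: "i \<in> I" "y \<in> V" "x = S i y" using V_cases assms by blast
  have "i = j"
    using bary_add_le_1[of x i j] bary_S_ge[of y i] assms i by fastforce
  with i that show thesis by blast
qed

lemma S_iter: "(S j ^^ m) x = p j + (1 / 2 ^ m) *\<^sub>R (x - p j)"
proof (induction m)
  case (Suc m)
  have "(S j ^^ Suc m) x = S j (p j + (1 / 2 ^ m) *\<^sub>R (x - p j))"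
    using Suc by simp
  also have "\<dots> = (1/2) *\<^sub>R (p j + (1 / 2 ^ m) *\<^sub>R (x - p j)) + (1/2) *\<^sub>R p j"
    by (simp only: S_def)
  also have "\<dots> = (1/2 + 1/2) *\<^sub>R p j + (1 / 2 ^ Suc m) *\<^sub>R (x - p j)"
    by (simp only: scaleR_add_right scaleR_scaleR scaleR_add_left) simp
  finally show ?case by simp
qed simp

lemma S_iter_in_Vs: "x \<in> Vs 0 \<Longrightarrow> j \<in> I \<Longrightarrow> (S j ^^ m) x \<in> Vs m"
  by (induction m) (auto simp: Vs_Suc)

lemma bary_S_iter:
  assumes "l \<in> I" "j \<in> I"
  shows "bary l ((S j ^^ m) x) = (1 - 1 / 2 ^ m) * (if l = j then 1 else 0) + bary l x / 2 ^ m"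
  by (induction m) (use assms in \<open>auto simp: bary_S field_simps\<close>)

section \<open>Pairs of vertices at distance \<open>1 / 2 ^ m\<close>\<close>

definition close_pairs :: "nat \<Rightarrow> ('a \<times> 'a) set" where
  "close_pairs m = {(x, y). x \<in> Vs m \<and> y \<in> Vs m \<and> norm (x - y) = 1 / 2 ^ m}"

definition triples :: "(nat \<times> nat \<times> nat) set" where
  "triples = {(i, j, k). i \<in> I \<and> j \<in> I \<and> k \<in> I \<and> i \<noteq> j \<and> k \<noteq> i \<and> k \<noteq> j}"

text \<open>
  Both points are neighbours of \<open>S i (p j)\<close>, where the cells \<open>i\<close> and \<open>j\<close> meet, in the direction of \<open>p k\<close>. For
  \<open>m > 0\<close> no cell of level \<open>1\<close> contains both: they face each other across the hole between the
  cells.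
\<close>

definition hole_pair :: "nat \<Rightarrow> nat \<times> nat \<times> nat \<Rightarrow> 'a \<times> 'a" where
  "hole_pair m = (\<lambda>(i, j, k). (S i ((S j ^^ m) (p k)), S j ((S i ^^ m) (p k))))"

lemma finite_close_pairs: "finite (close_pairs m)"
  by (rule finite_subset[of _ "Vs m \<times> Vs m"]) (auto simp: close_pairs_def finite_Vs)

lemma finite_triples: "finite triples"
  by (rule finite_subset[of _ "I \<times> I \<times> I"]) (auto simp: triples_def)

lemma close_pairs_0: "close_pairs 0 = {(x, y). \<exists>i\<in>I. \<exists>j\<in>I. i \<noteq> j \<and> x = p i \<and> y = p j}"
  unfolding close_pairs_def Vs_0 using norm_p_diff by (auto, metis norm_zero diff_self zero_neq_one)

lemma p_inj: "i \<in> I \<Longrightarrow> j \<in> I \<Longrightarrow> p i = p j \<longleftrightarrow> i = j"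
  using norm_p_diff[of i j] by (cases "i = j") auto

lemma bary_Vs_int:
  assumes "x \<in> Vs m" "l \<in> I" shows "2 ^ m * bary l x \<in> \<int>"
  using assms(1)
proof (induction m arbitrary: x)
  case 0
  then show ?case using assms by (auto simp: Vs_0 bary_p)
next
  case (Suc m)
  then obtain i y where i: "i \<in> I" "y \<in> Vs m" "x = S i y" by (auto simp: Vs_Suc)
  have "2 ^ Suc m * bary l x = 2 ^ m * bary l y + 2 ^ m * (if l = i then 1 else 0)"
    using i assms by (simp add: bary_S algebra_simps)
  also have "\<dots> \<in> \<int>"
  proof (rule Ints_add[OF Suc.IH[OF i(2)]])
    show "(2::real) ^ m * (if l = i then 1 else 0) \<in> \<int>" by auto
  qed
  finally show ?case .
qed

text \<open>
  On \<open>Vs m\<close> the numbers \<open>2 ^ m * bary l x\<close> are integers. For a close pair, the differences of these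
  integers have sum \<open>0\<close> and sum of squares \<open>2\<close>, so one is \<open>1\<close>, one is \<open>-1\<close> and the others vanish.
\<close>

lemma close_pairs_lattice_step:
  assumes xy: "(x, y) \<in> close_pairs m"
  obtains a b where "a \<in> I" "b \<in> I" "a \<noteq> b" "bary a x = bary a y + 1 / 2 ^ m" "bary b y = bary b x + 1 / 2 ^ m"
    "\<And>l. l \<in> I \<Longrightarrow> l \<noteq> a \<Longrightarrow> l \<noteq> b \<Longrightarrow> bary l x = bary l y"
proof -
  have x: "x \<in> Vs m" and y: "y \<in> Vs m" and n: "norm (x - y) = 1 / 2 ^ m"
    using xy by (auto simp: close_pairs_def)
  have "\<exists>z::int. real_of_int z = 2 ^ m * (bary l x - bary l y)" if "l \<in> I" for l
  proof -
    have "2 ^ m * (bary l x - bary l y) \<in> \<int>"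
      unfolding right_diff_distrib using that x y by (intro Ints_diff bary_Vs_int)
    then show ?thesis by (auto elim!: Ints_cases)
  qed
  then obtain d :: "nat \<Rightarrow> int" where d: "\<And>l. l \<in> I \<Longrightarrow> real_of_int (d l) = 2 ^ m * (bary l x - bary l y)"
    by metis
  have "real_of_int (\<Sum>l\<in>I. d l) = 2 ^ m * ((\<Sum>l\<in>I. bary l x) - (\<Sum>l\<in>I. bary l y))"
    by (simp add: d sum_distrib_left sum_subtractf right_diff_distrib)
  then have "real_of_int (\<Sum>l\<in>I. d l) = 0" unfolding bary_sum by simp
  then have sum0: "(\<Sum>l\<in>I. d l) = 0" by (simp only: of_int_eq_0_iff)
  have "real_of_int (\<Sum>l\<in>I. (d l)\<^sup>2) = (2 ^ m)\<^sup>2 * (\<Sum>l\<in>I. (bary l x - bary l y)\<^sup>2)"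
    by (simp add: d sum_distrib_left power_mult_distrib)
  also have "(\<Sum>l\<in>I. (bary l x - bary l y)\<^sup>2) = 2 * (1 / 2 ^ m)\<^sup>2"
    using norm_bary[of x y] x y Vs_subset V_affine n by (auto simp: subset_iff)
  finally have "real_of_int (\<Sum>l\<in>I. (d l)\<^sup>2) = 2"
    by (simp add: power_divide)
  then have sum2: "(\<Sum>l\<in>I. (d l)\<^sup>2) = 2" by (metis of_int_eq_iff of_int_numeral)
  have "\<exists>a\<in>I. d a > 0"
  proof (rule ccontr)
    assume "\<not> ?thesis"
    then have "\<forall>l\<in>I. - d l \<ge> 0" by auto
    moreover have "(\<Sum>l\<in>I. - d l) = 0" using sum0 by (simp add: sum_negf)
    ultimately have "\<forall>l\<in>I. - d l = 0"
      by (subst (asm) sum_nonneg_eq_0_iff) auto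
    then show False using sum2 by simp
  qed
  moreover have "\<exists>b\<in>I. d b < 0"
  proof (rule ccontr)
    assume "\<not> ?thesis"
    then have "\<forall>l\<in>I. d l \<ge> 0" by auto
    then have "\<forall>l\<in>I. d l = 0"
      using sum0 by (subst (asm) sum_nonneg_eq_0_iff) auto
    then show False using sum2 by simp
  qed
  ultimately obtain a b where ab: "a \<in> I" "b \<in> I" "d a > 0" "d b < 0" by blast
  then have "a \<noteq> b" by auto
  have split: "(\<Sum>l\<in>I. (d l)\<^sup>2) = (d a)\<^sup>2 + ((d b)\<^sup>2 + (\<Sum>l\<in>I - {a} - {b}. (d l)\<^sup>2))"
    using ab \<open>a \<noteq> b\<close> by (subst sum.remove[of I a], simp, simp, subst sum.remove[of "I - {a}" b]) auto
  have nn: "0 \<le> (\<Sum>l\<in>I - {a} - {b}. (d l)\<^sup>2)" by (intro sum_nonneg) auto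
  have sq1: "1 \<le> (d a)\<^sup>2" "1 \<le> (d b)\<^sup>2"
    using ab by (auto simp: power2_eq_square int_one_le_iff_zero_less zero_less_mult_iff)
  have sqs: "(d a)\<^sup>2 = 1" "(d b)\<^sup>2 = 1" "(\<Sum>l\<in>I - {a} - {b}. (d l)\<^sup>2) = 0"
    using split sum2 nn sq1 by linarith+
  have "d a = 1" "d b = -1" using sqs ab by (auto simp: power2_eq_1_iff)
  moreover have "d l = 0" if "l \<in> I" "l \<noteq> a" "l \<noteq> b" for l
    using sqs(3) that by (subst (asm) sum_nonneg_eq_0_iff) auto
  then have "bary l x = bary l y" if "l \<in> I" "l \<noteq> a" "l \<noteq> b" for l
    using d[of l] that by simp
  ultimately show thesis
    using that[OF ab(1,2) \<open>a \<noteq> b\<close>] d[OF ab(1)] d[OF ab(2)] by (auto simp: field_simps)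
qed

lemma hole_pair_bary:
  assumes "(i, j, k) \<in> triples" "l \<in> I"
  shows "bary l (fst (hole_pair m (i, j, k))) =
      (if l = i then 1 / 2 else if l = j then 1 / 2 - 1 / 2 ^ Suc m else if l = k then 1 / 2 ^ Suc m else 0)"
    "bary l (snd (hole_pair m (i, j, k))) =
      (if l = j then 1 / 2 else if l = i then 1 / 2 - 1 / 2 ^ Suc m else if l = k then 1 / 2 ^ Suc m else 0)"
  using assms by (auto simp: hole_pair_def triples_def bary_S bary_S_iter bary_p field_simps)

lemma hole_pair_close:
  assumes "(i, j, k) \<in> triples" shows "hole_pair m (i, j, k) \<in> close_pairs (Suc m)"
proof -
  have *: "S i ((S j ^^ m) z) - S j ((S i ^^ m) z) = (1 / 2 ^ Suc m) *\<^sub>R (p i - p j)" for z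
    by (simp add: S_iter S_def algebra_simps)
  show ?thesis
    using assms S_iter_in_Vs[of "p k"] norm_p_diff[of i j]
    by (auto simp: hole_pair_def close_pairs_def * triples_def Vs_Suc Vs_0)
qed

text \<open>
  Let \<open>x\<close> and \<open>y\<close> lie in cells \<open>i \<noteq> j\<close> of level \<open>1\<close>. If one of them is the common point of these cells, a
  single cell contains both. Otherwise the lattice step forces the coordinates of \<open>x\<close> to be \<open>1 / 2\<close> at
  \<open>i\<close>, \<open>1 / 2 - U\<close> at \<open>j\<close> and \<open>U\<close> at a third index \<open>k\<close>, and those of \<open>y\<close> are the same with \<open>i\<close> and \<open>j\<close>
  exchanged.
\<close>

lemma close_pairs_Suc_subset:
  assumes xy: "(x, y) \<in> close_pairs (Suc m)"
  shows "(\<exists>i\<in>I. \<exists>(x', y')\<in>close_pairs m. x = S i x' \<and> y = S i y') \<or>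
     (0 < m \<and> (\<exists>t\<in>triples. (x, y) = hole_pair m t))"
proof -
  define U where "U = (1::real) / 2 ^ Suc m"
  have x: "x \<in> Vs (Suc m)" and y: "y \<in> Vs (Suc m)" and n: "norm (x - y) = U"
    using xy by (auto simp: close_pairs_def U_def)
  have xV: "x \<in> V" and yV: "y \<in> V" using x y Vs_subset by blast+
  have same: ?thesis if "l \<in> I" "x = S l x'" "x' \<in> Vs m" "y = S l y'" "y' \<in> Vs m" for l x' y'
  proof -
    have "norm (x' - y') = 1 / 2 ^ m"
      using n norm_S_diff[of l x' y'] that by (simp add: U_def)
    with that show ?thesis by (auto simp: close_pairs_def)
  qed
  obtain i x' where i: "i \<in> I" "x' \<in> Vs m" "x = S i x'" using x by (auto simp: Vs_Suc)
  obtain j y' where j: "j \<in> I" "y' \<in> Vs m" "y = S j y'" using y by (auto simp: Vs_Suc)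
  have x'V: "x' \<in> V" and y'V: "y' \<in> V" using i j Vs_subset by blast+
  show ?thesis
  proof (cases "i = j")
    case True
    then show ?thesis using same i j by blast
  next
    case ij: False
    show ?thesis
    proof (cases "1/2 \<le> bary i y")
      case True
      then have "1 \<le> bary i y'" using bary_S[of i j y'] i j ij by simp
      then have "y' = p i" using bary_eq_1_imp y'V i by blast
      then have "y = S i (p j)" using j S_p_sym by metis
      then show ?thesis using same[OF i(1,3,2), of "p j"] p_in_Vs j by blast
    next
      case iy: False
      show ?thesis
      proof (cases "1/2 \<le> bary j x")
        case True
        then have "1 \<le> bary j x'" using bary_S[of j i x'] i j ij by simp
        then have "x' = p j" using bary_eq_1_imp x'V j by blast
        then have "x = S j (p i)" using i S_p_sym by metis
        then show ?thesis using same[OF j(1) _ _ j(3,2), of "p i"] p_in_Vs i by blast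
      next
        case jx: False
        have xi: "1/2 \<le> bary i x" and yj: "1/2 \<le> bary j y"
          using bary_S_ge x'V y'V i j by auto
        obtain a b where ab: "a \<in> I" "b \<in> I" "a \<noteq> b" "bary a x = bary a y + U" "bary b y = bary b x + U"
          "\<And>l. l \<in> I \<Longrightarrow> l \<noteq> a \<Longrightarrow> l \<noteq> b \<Longrightarrow> bary l x = bary l y"
          using close_pairs_lattice_step[OF xy] by (auto simp: U_def)
        have "U > 0" by (simp add: U_def)
        have "i = a"
          using ab(5) ab(6)[OF i(1)] xi iy \<open>U > 0\<close> by fastforce
        moreover have "j = b"
          using ab(4) ab(6)[OF j(1)] yj jx \<open>U > 0\<close> by fastforce
        ultimately have e: "bary i x = bary i y + U" "bary j y = bary j x + U"
          "\<And>l. l \<in> I \<Longrightarrow> l \<noteq> i \<Longrightarrow> l \<noteq> j \<Longrightarrow> bary l x = bary l y" using ab by auto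
        have half: "r \<le> 1 / 2 - U" if "r < 1 / 2" "r / U \<in> \<int>" for r
        proof -
          from that(2) obtain z where z: "r / U = real_of_int z" by (rule Ints_cases)
          then have r: "r = real_of_int z * U" using \<open>U > 0\<close> by (simp add: field_simps)
          have "real_of_int z < 2 ^ m" using that(1) unfolding r by (simp add: U_def field_simps)
          then have "z < 2 ^ m" by simp
          then have "z + 1 \<le> 2 ^ m" by simp
          then have "real_of_int (z + 1) \<le> 2 ^ m" by (simp only: of_int_le_numeral_power_cancel_iff)
          then have "real_of_int z + 1 \<le> 2 ^ m" by simp
          then have "(real_of_int z + 1) * U \<le> 2 ^ m * U"
            using \<open>U > 0\<close> by (intro mult_right_mono) auto
          also have "2 ^ m * U = 1 / 2" by (simp add: U_def)
          finally show ?thesis unfolding r by (simp add: algebra_simps)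
        qed
        have int: "bary l z / U \<in> \<int>" if "z \<in> Vs (Suc m)" "l \<in> I" for l z
          using bary_Vs_int[OF that] by (simp add: U_def mult.commute)
        have "bary i y \<le> 1/2 - U" "bary j x \<le> 1/2 - U"
          using half[OF _ int] iy jx x y i j by auto
        with e xi yj have v: "bary i x = 1/2" "bary i y = 1/2 - U" "bary j y = 1/2" "bary j x = 1/2 - U" by auto
        define J where "J = I - {i} - {j}"
        have J: "finite J" "J \<subseteq> I" "\<And>l. l \<in> J \<Longrightarrow> l \<noteq> i \<and> l \<noteq> j" by (auto simp: J_def)
        have "(\<Sum>l\<in>I. bary l x) = bary i x + (bary j x + (\<Sum>l\<in>J. bary l x))"
          unfolding J_def using i j ij
          by (subst sum.remove[of I i], simp, simp, subst sum.remove[of "I - {i}" j]) auto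
        then have sJ: "(\<Sum>l\<in>J. bary l x) = U"
          using v by (simp add: bary_sum)
        have "\<exists>k\<in>J. bary k x \<noteq> 0"
        proof (rule ccontr)
          assume "\<not> ?thesis"
          then have "(\<Sum>l\<in>J. bary l x) = 0" by (intro sum.neutral) auto
          with sJ \<open>U > 0\<close> show False by simp
        qed
        then obtain k where k: "k \<in> J" "bary k x \<noteq> 0" by blast
        then have kI: "k \<in> I" "k \<noteq> i" "k \<noteq> j" using J by auto
        have nn: "0 \<le> bary l x" if "l \<in> I" for l using bary_nonneg xV that .
        have kU: "U \<le> bary k x"
        proof -
          from int[OF x kI(1)] obtain z where z: "bary k x / U = real_of_int z" by (rule Ints_cases)
          then have r: "bary k x = real_of_int z * U" using \<open>U > 0\<close> by (simp add: field_simps)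
          have "z > 0" using r k(2) nn[OF kI(1)] \<open>U > 0\<close> by (auto simp: zero_le_mult_iff)
          then have "1 \<le> real_of_int z" by simp
          then have "1 * U \<le> real_of_int z * U"
            using \<open>U > 0\<close> by (intro mult_right_mono) auto
          then show ?thesis using r by simp
        qed
        have "(\<Sum>l\<in>J. bary l x) = bary k x + (\<Sum>l\<in>J - {k}. bary l x)"
          using J k by (subst sum.remove[of J k]) auto
        moreover have nn': "0 \<le> (\<Sum>l\<in>J - {k}. bary l x)"
          using nn J by (intro sum_nonneg) auto
        ultimately have kx: "bary k x = U" and "(\<Sum>l\<in>J - {k}. bary l x) = 0"
          using sJ kU by auto
        then have zero: "bary l x = 0" if "l \<in> I" "l \<noteq> i" "l \<noteq> j" "l \<noteq> k" for l
          using that nn J(1,2) by (subst (asm) sum_nonneg_eq_0_iff) (auto simp: J_def)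
        have t: "(i, j, k) \<in> triples" using i j ij kI by (simp add: triples_def)
        have hp: "fst (hole_pair m (i, j, k)) \<in> V" "snd (hole_pair m (i, j, k)) \<in> V"
          using hole_pair_close[OF t, of m] Vs_subset by (auto simp: close_pairs_def split: prod.splits)
        have "x = fst (hole_pair m (i, j, k))"
          by (rule V_eqI[OF xV hp(1)]) (use hole_pair_bary[OF t] v kx zero in \<open>auto simp: U_def\<close>)
        moreover have "y = snd (hole_pair m (i, j, k))"
        proof (rule V_eqI[OF yV hp(2)])
          fix l assume l: "l \<in> I"
          have "bary l y = (if l = j then 1/2 else if l = i then 1/2 - U else if l = k then U else 0)"
            using v kx zero[OF l] e(3)[OF l] by auto
          then show "bary l y = bary l (snd (hole_pair m (i, j, k)))"
            unfolding hole_pair_bary(2)[OF t l] U_def .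
        qed
        ultimately have hole: "(x, y) = hole_pair m (i, j, k)" by simp
        show ?thesis
        proof (cases "m = 0")
          case False
          then show ?thesis using hole t by blast
        next
          case True
          then have "x = S k (p i)" "y = S k (p j)"
            using hole by (auto simp: hole_pair_def S_p_sym)
          then show ?thesis using same kI p_in_Vs i j by blast
        qed
      qed
    qed
  qed
qed

text \<open>
  For \<open>m = 0\<close> the hole pair of \<open>(i, j, k)\<close> consists of two corners of the cell \<open>k\<close> and is counted there;
  hence the case distinction.
\<close>

lemma sum_close_pairs_Suc:
  "(\<Sum>z\<in>close_pairs (Suc m). \<phi> z) =
     (\<Sum>i\<in>I. \<Sum>z\<in>close_pairs m. \<phi> (map_prod (S i) (S i) z)) +
     (if m = 0 then 0 else \<Sum>t\<in>triples. \<phi> (hole_pair m t))" for \<phi> :: "'a \<times> 'a \<Rightarrow> real"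
proof -
  define A where "A i = map_prod (S i) (S i) ` close_pairs m" for i
  define B where "B = (if m = 0 then {} else hole_pair m ` triples)"
  have "A i \<subseteq> close_pairs (Suc m)" if "i \<in> I" for i
    using that by (auto simp: A_def close_pairs_def Vs_Suc norm_S_diff)
  moreover have "B \<subseteq> close_pairs (Suc m)"
    using hole_pair_close by (auto simp: B_def)
  moreover have "close_pairs (Suc m) \<subseteq> (\<Union>i\<in>I. A i) \<union> B"
  proof
    fix z assume "z \<in> close_pairs (Suc m)"
    then show "z \<in> (\<Union>i\<in>I. A i) \<union> B"
      using close_pairs_Suc_subset[of "fst z" "snd z" m]
      by (cases z) (auto simp: A_def B_def image_iff, force+)
  qed
  ultimately have eq: "close_pairs (Suc m) = (\<Union>i\<in>I. A i) \<union> B" by blast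
  have finA: "finite (A i)" for i by (simp add: A_def finite_close_pairs)
  have finB: "finite B" by (simp add: B_def finite_triples)
  have AV: "\<exists>x y. x \<in> V \<and> y \<in> V \<and> x \<noteq> y \<and> z = (S i x, S i y)" if "z \<in> A i" for z i
    using that Vs_subset by (force simp: A_def close_pairs_def)
  have disjA: "A i \<inter> A j = {}" if "i \<in> I" "j \<in> I" "i \<noteq> j" for i j
  proof (rule ccontr)
    assume "A i \<inter> A j \<noteq> {}"
    then obtain z where "z \<in> A i" "z \<in> A j" by blast
    then obtain x y x' y' where "x \<in> V" "y \<in> V" "x' \<in> V" "y' \<in> V" "x \<noteq> y" "S i x = S j x'" "S i y = S j y'"
      using AV[of z i] AV[of z j] by auto
    then show False using S_overlap(1) that by metis
  qed
  have disjB: "A i \<inter> B = {}" if l: "i \<in> I" for i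
  proof (rule ccontr)
    assume "A i \<inter> B \<noteq> {}"
    then obtain z where z: "z \<in> A i" "z \<in> B" by blast
    then obtain a b k where t: "(a, b, k) \<in> triples" "z = hole_pair m (a, b, k)" "m > 0"
      by (auto simp: B_def split: if_splits)
    obtain x y where xy: "x \<in> V" "y \<in> V" "z = (S i x, S i y)" using AV z by blast
    have "1/2 \<le> bary i (fst z)" "1/2 \<le> bary i (snd z)" using xy bary_S_ge l by auto
    moreover have "(1::real) / 2 ^ Suc m \<le> 1 / 2 ^ Suc 1"
      using \<open>m > 0\<close> by (intro divide_left_mono power_increasing) auto
    then have "(1::real) / 2 ^ Suc m \<le> 1 / 4" by simp
    moreover have "(0::real) < 1 / 2 ^ Suc m" by simp
    ultimately show False
      using hole_pair_bary[OF t(1) l, of m] t by (auto simp: triples_def split: if_splits)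
  qed
  have inj: "inj_on (hole_pair m) triples" if "m > 0"
  proof (rule inj_onI)
    fix t t' assume tt: "t \<in> triples" "t' \<in> triples" "hole_pair m t = hole_pair m t'"
    obtain i j k where t: "t = (i, j, k)" by (cases t) auto
    obtain i' j' k' where t': "t' = (i', j', k')" by (cases t') auto
    have I: "i \<in> I" "j \<in> I" "k \<in> I" using tt t by (auto simp: triples_def)
    have ne: "i \<noteq> j" "k \<noteq> i" "k \<noteq> j" using tt t by (auto simp: triples_def)
    have "(1::real) / 2 ^ Suc m \<le> 1 / 2 ^ Suc 1"
      using that by (intro divide_left_mono power_increasing) auto
    then have u: "(1::real) / 2 ^ Suc m \<le> 1 / 4" "(0::real) < 1 / 2 ^ Suc m" by simp_all
    note h = hole_pair_bary[OF tt(1)[unfolded t], of _ m] hole_pair_bary[OF tt(2)[unfolded t'], of _ m]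
    have E: "hole_pair m (i, j, k) = hole_pair m (i', j', k')" using tt t t' by simp
    have "i = i'"
      using h(1)[OF I(1)] h(3)[OF I(1)] E u by (auto split: if_splits)
    moreover have "j = j'"
      using h(2)[OF I(2)] h(4)[OF I(2)] E u by (auto split: if_splits)
    moreover have "k = k'"
      using h(1)[OF I(3)] h(3)[OF I(3)] E u ne calculation by (auto split: if_splits)
    ultimately show "t = t'" using t t' by simp
  qed
  have "(\<Sum>z\<in>close_pairs (Suc m). \<phi> z) = (\<Sum>z\<in>(\<Union>i\<in>I. A i). \<phi> z) + (\<Sum>z\<in>B. \<phi> z)"
    unfolding eq using finA finB disjB by (intro sum.union_disjoint) auto
  also have "(\<Sum>z\<in>(\<Union>i\<in>I. A i). \<phi> z) = (\<Sum>i\<in>I. \<Sum>z\<in>A i. \<phi> z)"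
    using finA disjA by (intro sum.UNION_disjoint) auto
  also have "\<dots> = (\<Sum>i\<in>I. \<Sum>z\<in>close_pairs m. \<phi> (map_prod (S i) (S i) z))"
  proof (rule sum.cong[OF refl])
    fix i
    have "inj_on (map_prod (S i) (S i)) (close_pairs m)" by (auto simp: inj_on_def)
    then show "(\<Sum>z\<in>A i. \<phi> z) = (\<Sum>z\<in>close_pairs m. \<phi> (map_prod (S i) (S i) z))"
      by (simp add: A_def sum.reindex)
  qed
  also have "(\<Sum>z\<in>B. \<phi> z) = (if m = 0 then 0 else \<Sum>t\<in>triples. \<phi> (hole_pair m t))"
    using inj by (auto simp: B_def sum.reindex)
  finally show ?thesis .
qed

section \<open>The Hausdorff measure of the gasket\<close>

definition hdim :: real where "hdim = ln (real N) / ln 2"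

lemma hdim_pos: "0 < hdim" using N2 by (simp add: hdim_def)

lemma two_powr_hdim: "2 powr hdim = real N"
  using N2 by (simp add: hdim_def powr_def)

lemma half_powr_hdim: "(1 / 2) powr hdim = 1 / real N"
  by (simp add: powr_divide two_powr_hdim)

lemma dist_S: "dist (S i x) (S i y) = 1 / 2 * dist x y"
  by (simp add: dist_norm norm_S_diff)

text \<open>
  The gasket consists of \<open>N\<close> copies of itself scaled by \<open>1 / 2\<close>, and the exponent is chosen such that
  \<open>N * (1 / 2) powr hdim = 1\<close>.
\<close>

lemma premeasure_V_halve:
  assumes "0 < \<delta>" shows "hausdorff_premeasure hdim (\<delta> / 2) V \<le> hausdorff_premeasure hdim \<delta> V"
proof -
  have "V = (\<Union>n<N. S (Suc n) ` V)"
  proof -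
    have "I = Suc ` {..<N}" by (auto simp: I_def image_iff) (metis Suc_le_D Suc_le_lessD lessThan_iff)
    then show ?thesis using V_eq by (metis (no_types, lifting) SUP_cong image_image)
  qed
  then have "hausdorff_premeasure hdim (\<delta> / 2) V \<le> (\<Sum>n<N. hausdorff_premeasure hdim (\<delta> / 2) (S (Suc n) ` V))"
    using premeasure_finite_subadditive[of "\<delta> / 2" hdim "\<lambda>n. S (Suc n) ` V" N] assms by simp
  also have "\<dots> \<le> (\<Sum>n<N. ennreal (1 / real N) * hausdorff_premeasure hdim \<delta> V)"
    using premeasure_similarity[OF dist_S _ less_imp_le[OF hdim_pos], where \<delta> = \<delta> and A = V]
    by (intro sum_mono) (simp add: half_powr_hdim)
  also have "\<dots> = ennreal (real N * (1 / real N)) * hausdorff_premeasure hdim \<delta> V"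
    by (simp only: sum_constant card_lessThan ennreal_mult' of_nat_0_le_iff ennreal_of_nat_eq_real_of_nat mult.assoc)
  also have "\<dots> = hausdorff_premeasure hdim \<delta> V" using N_pos by simp
  finally show ?thesis .
qed

lemma outer_V_finite: "hausdorff_outer hdim V < top"
proof -
  define d where "d = diameter V + 1"
  have bV: "bounded V" using compact_V by (rule compact_imp_bounded)
  have d: "0 < d" using diameter_ge_0[OF bV] by (simp add: d_def)
  define b where "b = ennreal (diameter V powr hdim)"
  have "fine_cover d V (\<lambda>i. if i = 0 then V else {})"
    using bV d by (auto simp: fine_cover_def d_def)
  then have "hausdorff_premeasure hdim d V \<le> cover_size hdim (\<lambda>i::nat. if i = 0 then V else {})"
    by (rule premeasure_le)
  also have "\<dots> = b"
    unfolding cover_size_def by (subst suminf_finite[of "{0}"]) (auto simp: b_def)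
  finally have base: "hausdorff_premeasure hdim d V \<le> b" .
  have iter: "hausdorff_premeasure hdim (d / 2 ^ m) V \<le> b" for m
  proof (induction m)
    case (Suc m)
    have "hausdorff_premeasure hdim (d / 2 ^ m / 2) V \<le> hausdorff_premeasure hdim (d / 2 ^ m) V"
      using d by (intro premeasure_V_halve) simp
    with Suc show ?case by (simp add: field_simps)
  qed (use base in simp)
  have "hausdorff_outer hdim V \<le> b"
  proof (rule outer_leI)
    fix \<delta> :: real assume "0 < \<delta>"
    obtain m where "(1 / 2) ^ m < \<delta> / d"
      using real_arch_pow_inv[of "\<delta> / d" "1 / 2"] \<open>0 < \<delta>\<close> d by auto
    then have "d / 2 ^ m \<le> \<delta>" using d by (simp add: field_simps)
    then show "hausdorff_premeasure hdim \<delta> V \<le> b"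
      using iter[of m] premeasure_antimono order_trans by blast
  qed
  then show ?thesis by (simp add: b_def le_less_trans)
qed

text \<open>
  The images of \<open>p 1\<close> under all compositions of \<open>m\<close> of the maps: one point for each cell of level
  \<open>m\<close>.
\<close>

primrec corner_points :: "nat \<Rightarrow> 'a set" where
  "corner_points 0 = {p 1}"
| "corner_points (Suc m) = (\<Union>i\<in>I. S i ` corner_points m)"

lemma corner_points_subset: "corner_points m \<subseteq> Vs m"
  by (induction m) (use N_pos in \<open>auto simp: Vs_0 Vs_Suc\<close>)

lemma finite_corner_points: "finite (corner_points m)"
  using corner_points_subset finite_Vs finite_subset by blast

lemma corner_points_p: "j \<in> I \<Longrightarrow> p j \<in> corner_points m \<Longrightarrow> j = 1"
proof (induction m)
  case 0
  then show ?case using p_inj[of j 1] N_pos by auto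
next
  case (Suc m)
  then obtain i y where i: "i \<in> I" "y \<in> corner_points m" "p j = S i y" by auto
  have yV: "y \<in> V" using i corner_points_subset Vs_subset by blast
  have "1 = bary j (S i y)" using i Suc.prems by (simp flip: i(3) add: bary_p)
  then have "i = j \<and> 1 \<le> bary j y"
    using bary_le_1[OF yV Suc.prems(1)] i Suc.prems by (auto simp: bary_S split: if_splits)
  then have "y = p j" using bary_eq_1_imp yV Suc.prems by blast
  then show ?case using Suc i by simp
qed

text \<open>
  Two cells of level \<open>1\<close> share only the point \<open>S i (p j)\<close>, and that cannot be a common image of
  corner points, since \<open>p 1\<close> is the only corner of the simplex among these.
\<close>

lemma card_corner_points: "card (corner_points m) = N ^ m"
proof (induction m)
  case (Suc m)
  have "card (corner_points (Suc m)) = (\<Sum>i\<in>I. card (S i ` corner_points m))"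
    unfolding corner_points.simps
  proof (rule card_UN_disjoint)
    show "\<forall>i\<in>I. \<forall>j\<in>I. i \<noteq> j \<longrightarrow> S i ` corner_points m \<inter> S j ` corner_points m = {}"
    proof (intro ballI impI, rule ccontr)
      fix i j assume ij: "i \<in> I" "j \<in> I" "i \<noteq> j" and "S i ` corner_points m \<inter> S j ` corner_points m \<noteq> {}"
      then obtain x y where xy: "x \<in> corner_points m" "y \<in> corner_points m" "S i x = S j y" by blast
      have "x \<in> V" "y \<in> V" using xy corner_points_subset Vs_subset by blast+
      then have "x = p j" "y = p i" using S_overlap ij xy(3) by blast+
      then have "j = 1" "i = 1" using corner_points_p xy ij by blast+
      then show False using ij by simp
    qed
  qed (auto simp: finite_corner_points)
  also have "\<dots> = (\<Sum>i\<in>I. N ^ m)"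
    by (intro sum.cong refl) (simp add: card_image inj_on_def Suc)
  finally show ?case by simp
qed simp

lemma corner_points_split:
  assumes "x \<in> corner_points (k + l)"
  shows "\<exists>b\<in>corner_points k. \<exists>y\<in>corner_points l. x = b + (1 / 2 ^ k) *\<^sub>R (y - p 1)"
  using assms
proof (induction k arbitrary: x)
  case (Suc k)
  then obtain i x' where i: "i \<in> I" "x' \<in> corner_points (k + l)" "x = S i x'" by auto
  obtain b y where b: "b \<in> corner_points k" "y \<in> corner_points l" "x' = b + (1 / 2 ^ k) *\<^sub>R (y - p 1)"
    using Suc.IH[OF i(2)] by blast
  have "x = S i b + (1 / 2 ^ Suc k) *\<^sub>R (y - p 1)"
    unfolding i(3) b(3) by (simp add: S_def scaleR_add_right add_ac)
  then show ?case using b i by (intro bexI[of _ "S i b"] bexI[of _ y]) auto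
qed auto

text \<open>
  After scaling by \<open>2 ^ k\<close>, the barycentric coordinates of the vertices of level \<open>k\<close> in such a ball,
  relative to one of them, are integers in an interval that does not depend on \<open>k\<close>.
\<close>

lemma lattice_packing:
  "\<exists>K. \<forall>k u. card (Vs k \<inter> cball u (\<rho> / 2 ^ k)) \<le> K"
proof -
  define M where "M = \<lceil>4 * \<rho>\<rceil>"
  define K where "K = card (PiE I (\<lambda>_. {-M..M}))"
  have "card (Vs k \<inter> cball u (\<rho> / 2 ^ k)) \<le> K" for k u
  proof (cases "Vs k \<inter> cball u (\<rho> / 2 ^ k) = {}")
    case False
    then obtain x0 where x0: "x0 \<in> Vs k" "dist u x0 \<le> \<rho> / 2 ^ k" by auto
    define c where "c x = (\<lambda>i\<in>I. \<lfloor>2 ^ k * (bary i x - bary i x0)\<rfloor>)" for x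
    have int: "real_of_int (c x i) = 2 ^ k * (bary i x - bary i x0)" if "x \<in> Vs k" "i \<in> I" for x i
    proof -
      have "2 ^ k * (bary i x - bary i x0) \<in> \<int>"
        unfolding right_diff_distrib using that x0 by (intro Ints_diff bary_Vs_int)
      then show ?thesis using that by (simp add: c_def)
    qed
    have "inj_on c (Vs k)"
    proof (rule inj_onI)
      fix x y assume xy: "x \<in> Vs k" "y \<in> Vs k" "c x = c y"
      show "x = y"
      proof (rule V_eqI)
        fix i assume i: "i \<in> I"
        have "2 ^ k * (bary i x - bary i x0) = 2 ^ k * (bary i y - bary i x0)"
          using int[OF xy(1) i] int[OF xy(2) i] xy(3) by simp
        then show "bary i x = bary i y" by simp
      qed (use xy Vs_subset in blast)+
    qed
    then have inj: "inj_on c (Vs k \<inter> cball u (\<rho> / 2 ^ k))" by (rule inj_on_subset) simp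
    have "c ` (Vs k \<inter> cball u (\<rho> / 2 ^ k)) \<subseteq> PiE I (\<lambda>_. {-M..M})"
    proof (rule image_subsetI, rule PiE_I)
      fix x i assume x: "x \<in> Vs k \<inter> cball u (\<rho> / 2 ^ k)" and i: "i \<in> I"
      have "dist x x0 \<le> dist u x + dist u x0" by (metis dist_commute dist_triangle)
      then have "norm (x - x0) \<le> 2 * (\<rho> / 2 ^ k)" using x x0 by (simp add: dist_norm)
      then have "\<bar>bary i x - bary i x0\<bar> \<le> 4 * (\<rho> / 2 ^ k)" using bary_lipschitz[OF i, of x x0] by linarith
      then have "2 ^ k * \<bar>bary i x - bary i x0\<bar> \<le> 2 ^ k * (4 * (\<rho> / 2 ^ k))" by (intro mult_left_mono) auto
      then have "\<bar>real_of_int (c x i)\<bar> \<le> 4 * \<rho>" using int[of x i] x i by (simp add: abs_mult)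
      also have "\<dots> \<le> real_of_int M" by (simp add: M_def)
      finally show "c x i \<in> {-M..M}" by (simp add: abs_le_iff)
    qed (simp add: c_def)
    then have "card (c ` (Vs k \<inter> cball u (\<rho> / 2 ^ k))) \<le> K"
      unfolding K_def by (intro card_mono finite_PiE) auto
    then show ?thesis using card_image[OF inj] by simp
  qed simp
  then show ?thesis by blast
qed

text \<open>
  A corner point of level \<open>k + l\<close> near \<open>u\<close> lies in a cell of level \<open>k\<close> whose corner point is near \<open>u\<close>.
  There are boundedly many such cells, and each has \<open>N ^ l\<close> corner points of level \<open>k + l\<close>.
\<close>

lemma corner_count:
  "\<exists>K>0. \<forall>k l u G. G \<subseteq> cball u (2 / 2 ^ k) \<longrightarrow> card (corner_points (k + l) \<inter> G) \<le> K * N ^ l"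
proof -
  define R where "R = diameter V"
  have R: "norm (x - y) \<le> R" if "x \<in> V" "y \<in> V" for x y
    unfolding R_def dist_norm[symmetric] using that compact_imp_bounded[OF compact_V] by (intro diameter_bounded_bound)
  obtain K where K: "\<And>k u. card (Vs k \<inter> cball u ((2 + R) / 2 ^ k)) \<le> K"
    using lattice_packing by blast
  have "card (corner_points (k + l) \<inter> G) \<le> Suc K * N ^ l" if G: "G \<subseteq> cball u (2 / 2 ^ k)" for k l u G
  proof -
    define B where "B = corner_points k \<inter> cball u ((2 + R) / 2 ^ k)"
    have finB: "finite B" by (simp add: B_def finite_corner_points)
    have "corner_points (k + l) \<inter> G \<subseteq> (\<lambda>(b, y). b + (1 / 2 ^ k) *\<^sub>R (y - p 1)) ` (B \<times> corner_points l)"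
    proof
      fix x assume x: "x \<in> corner_points (k + l) \<inter> G"
      then obtain b y where b: "b \<in> corner_points k" "y \<in> corner_points l" "x = b + (1 / 2 ^ k) *\<^sub>R (y - p 1)"
        using corner_points_split by blast
      have "y \<in> V" "p 1 \<in> V" using b corner_points_subset Vs_subset p_in_V N_pos by blast+
      then have "dist x b \<le> R / 2 ^ k"
        using R[of y "p 1"] by (simp add: b(3) dist_norm divide_right_mono)
      moreover have "dist u x \<le> 2 / 2 ^ k" using x G by auto
      ultimately have "dist u b \<le> (2 + R) / 2 ^ k"
        using dist_triangle[of u b x] by (simp add: add_divide_distrib)
      then have "b \<in> B" using b by (simp add: B_def)
      then show "x \<in> (\<lambda>(b, y). b + (1 / 2 ^ k) *\<^sub>R (y - p 1)) ` (B \<times> corner_points l)"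
        using b by auto
    qed
    then have "card (corner_points (k + l) \<inter> G) \<le> card (B \<times> corner_points l)"
      by (rule surj_card_le[rotated]) (simp add: finB finite_corner_points)
    also have "\<dots> = card B * N ^ l" by (simp add: card_cartesian_product card_corner_points)
    also have "card B \<le> K"
    proof -
      have "card B \<le> card (Vs k \<inter> cball u ((2 + R) / 2 ^ k))"
        unfolding B_def using corner_points_subset finite_Vs by (intro card_mono) auto
      with K show ?thesis using order_trans by blast
    qed
    then have "card B * N ^ l \<le> Suc K * N ^ l" by (intro mult_right_mono) auto
    finally show ?thesis .
  qed
  then show ?thesis by blast
qed

text \<open>
  A dyadic scale comparable to the diameter \<open>d\<close>; the error \<open>e\<close> takes care of \<open>d = 0\<close>.
\<close>

lemma scale_exists:
  assumes "0 \<le> d" "d \<le> 1 / 2" "0 < e"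
  shows "\<exists>m. d < 1 / 2 ^ m \<and> 1 / real N ^ m \<le> real N * d powr hdim + e"
proof (cases "d = 0")
  case True
  have "1 / real N < 1" using N2 by simp
  then obtain m where "(1 / real N) ^ m < e"
    using real_arch_pow_inv[OF \<open>0 < e\<close>] by blast
  then show ?thesis using True by (intro exI[of _ m]) (simp add: power_divide)
next
  case False
  then have "0 < d" using assms by simp
  obtain n where "(1 / 2) ^ n < d"
    using real_arch_pow_inv[OF \<open>0 < d\<close>, of "1 / 2"] by auto
  then have ex: "(1 / 2) ^ n \<le> d" by simp
  define l where "l = (LEAST n. (1 / 2) ^ n \<le> d)"
  have l: "(1 / 2) ^ l \<le> d" unfolding l_def by (rule LeastI[of _ n]) (rule ex)
  have "l \<noteq> 0" using l assms by (cases l) auto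
  then obtain m where m: "l = Suc m" using not0_implies_Suc by blast
  have "\<not> (1 / 2) ^ m \<le> d" using not_less_Least[of m "\<lambda>n. (1 / 2) ^ n \<le> d"] m by (simp add: l_def)
  then have 1: "d < 1 / 2 ^ m" by (simp add: power_divide)
  have "1 / 2 ^ m \<le> 2 * d" using l m by (simp add: power_divide field_simps)
  then have "(1 / 2 ^ m) powr hdim \<le> (2 * d) powr hdim"
    using hdim_pos by (intro powr_mono2) auto
  moreover have "(1 / 2 ^ m) powr hdim = 1 / real N ^ m"
  proof -
    have "(2 ^ m) powr hdim = (2 powr hdim) powr real m"
      by (simp add: powr_powr mult.commute flip: powr_realpow)
    also have "\<dots> = real N ^ m" using N_pos by (simp add: two_powr_hdim powr_realpow)
    finally show ?thesis by (simp add: powr_divide)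
  qed
  moreover have "(2 * d) powr hdim = real N * d powr hdim"
    using \<open>0 < d\<close> by (simp add: powr_mult two_powr_hdim)
  ultimately have "1 / real N ^ m \<le> real N * d powr hdim + e" using \<open>0 < e\<close> by simp
  with 1 show ?thesis by blast
qed

text \<open>
  The mass distribution principle, with the counting of corner points of a high level in the place of
  a mass. The sets of a cover are enlarged to open sets on their own dyadic scales, finitely many of
  these cover the compact set \<open>V\<close>, and by \<open>corner_count\<close> each catches at most a share \<open>K / N ^ m i\<close> of
  all \<open>N ^ n\<close> points.
\<close>

lemma outer_V_pos: "0 < hausdorff_outer hdim V"
proof -
  obtain K where K: "K > 0" "\<And>k l u G. G \<subseteq> cball u (2 / 2 ^ k) \<Longrightarrow> card (corner_points (k + l) \<inter> G) \<le> K * N ^ l"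
    using corner_count by metis
  define c where "c = 1 / (2 * real K * real N)"
  have c: "c > 0" using K N_pos by (simp add: c_def)
  have "ennreal c \<le> hausdorff_premeasure hdim (1 / 2) V"
  proof (rule premeasure_geI)
    fix U assume U: "fine_cover (1 / 2) V U"
    define d where "d i = diameter (U i)" for i
    have d: "0 \<le> d i" "d i \<le> 1 / 2" for i
      using U diameter_ge_0 by (auto simp: fine_cover_def d_def)
    define e where "e = 1 / (2 * real K)"
    have e: "e > 0" using K by (simp add: e_def)
    have "\<exists>m. d i < 1 / 2 ^ m \<and> 1 / real N ^ m \<le> real N * d i powr hdim + e * (1 / 2) ^ Suc i" for i
      using e by (intro scale_exists d) simp
    then obtain m where m: "\<And>i. d i < 1 / 2 ^ m i"
      "\<And>i. 1 / real N ^ m i \<le> real N * d i powr hdim + e * (1 / 2) ^ Suc i" by metis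
    define G where "G i = (\<Union>x\<in>U i. ball x (1 / 2 ^ m i))" for i
    have "open (G i)" for i by (auto simp: G_def)
    moreover have "V \<subseteq> (\<Union>i\<in>UNIV. G i)"
    proof
      fix x assume "x \<in> V"
      then obtain i where "x \<in> U i" using U by (auto simp: fine_cover_def)
      then have "x \<in> G i" unfolding G_def by (intro UN_I[of x]) auto
      then show "x \<in> (\<Union>i\<in>UNIV. G i)" by blast
    qed
    ultimately obtain F where F: "finite F" "V \<subseteq> (\<Union>i\<in>F. G i)"
      using compactE_image[OF compact_V, of UNIV G] by metis
    define n where "n = Max (insert 0 (m ` F))"
    have mn: "m i \<le> n" if "i \<in> F" for i using F that by (auto simp: n_def)
    have cnt: "card (corner_points n \<inter> G i) \<le> K * N ^ (n - m i)" if "i \<in> F" for i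
    proof (cases "U i = {}")
      case True
      then show ?thesis by (simp add: G_def)
    next
      case False
      then obtain u where u: "u \<in> U i" by blast
      have "G i \<subseteq> cball u (2 / 2 ^ m i)"
      proof
        fix x assume "x \<in> G i"
        then obtain y where y: "y \<in> U i" "dist y x < 1 / 2 ^ m i" by (auto simp: G_def)
        have "dist u y \<le> d i"
          unfolding d_def using U u y by (intro diameter_bounded_bound) (auto simp: fine_cover_def)
        then show "x \<in> cball u (2 / 2 ^ m i)"
          using dist_triangle[of u x y] y(2) m(1)[of i] by simp
      qed
      from K(2)[OF this, of "n - m i"] show ?thesis using mn[OF that] by simp
    qed
    have "corner_points n = (\<Union>i\<in>F. corner_points n \<inter> G i)"
      using F(2) corner_points_subset Vs_subset by blast
    then have "card (corner_points n) = card (\<Union>i\<in>F. corner_points n \<inter> G i)"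
      by (rule arg_cong)
    then have "N ^ n = card (\<Union>i\<in>F. corner_points n \<inter> G i)"
      unfolding card_corner_points .
    also have "\<dots> \<le> (\<Sum>i\<in>F. card (corner_points n \<inter> G i))" using F(1) by (rule card_UN_le)
    also have "\<dots> \<le> (\<Sum>i\<in>F. K * N ^ (n - m i))" by (intro sum_mono cnt)
    finally have "real (N ^ n) \<le> real (\<Sum>i\<in>F. K * N ^ (n - m i))" by (rule of_nat_mono)
    also have "\<dots> = real N ^ n * (real K * (\<Sum>i\<in>F. 1 / real N ^ m i))"
    proof -
      have "real N ^ (n - m i) = real N ^ n * (1 / real N ^ m i)" if "i \<in> F" for i
        using mn[OF that] N_pos by (simp add: power_diff)
      then show ?thesis by (simp add: sum_distrib_left mult_ac)
    qed
    finally have "1 \<le> real K * (\<Sum>i\<in>F. 1 / real N ^ m i)" using N_pos by simp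
    also have "\<dots> \<le> real K * (\<Sum>i\<in>F. real N * d i powr hdim + e * (1 / 2) ^ Suc i)"
      by (intro mult_left_mono sum_mono m) simp
    also have "\<dots> = real K * (real N * (\<Sum>i\<in>F. d i powr hdim)) + real K * e * (\<Sum>i\<in>F. (1 / 2) ^ Suc i)"
      by (simp add: sum.distrib sum_distrib_left distrib_left mult_ac)
    finally have sum_ge: "1 \<le> real K * (real N * (\<Sum>i\<in>F. d i powr hdim)) + real K * e * (\<Sum>i\<in>F. (1 / 2) ^ Suc i)" .
    have "(\<Sum>i\<in>F. (1 / 2 :: real) ^ Suc i) \<le> 1"
    proof -
      have "(\<Sum>i\<in>F. (1 / 2 :: real) ^ Suc i) \<le> (\<Sum>i. (1 / 2) ^ Suc i)"
        using F(1) power_half_series by (intro sum_le_suminf) (auto simp: sums_iff)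
      then show ?thesis using power_half_series by (simp add: sums_iff)
    qed
    then have "real K * e * (\<Sum>i\<in>F. (1 / 2) ^ Suc i) \<le> real K * e * 1"
      using e by (intro mult_left_mono) auto
    also have "real K * e * 1 = 1 / 2" using K by (simp add: e_def)
    finally have "1 / 2 \<le> real K * (real N * (\<Sum>i\<in>F. d i powr hdim))" using sum_ge by linarith
    then have "c \<le> (\<Sum>i\<in>F. d i powr hdim)"
      using K N_pos by (simp add: c_def field_simps)
    then have "ennreal c \<le> (\<Sum>i\<in>F. ennreal (d i powr hdim))"
      by (simp add: sum_ennreal ennreal_leI)
    also have "\<dots> \<le> cover_size hdim U"
      unfolding cover_size_def d_def using F(1) by (intro sum_le_suminf) auto
    finally show "ennreal c \<le> cover_size hdim U" .
  qed
  also have "\<dots> \<le> hausdorff_outer hdim V" by (rule premeasure_le_outer) simp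
  finally show ?thesis using c by (metis ennreal_less_zero_iff less_le_trans)
qed

lemma outer_S_ge: "hausdorff_outer hdim A \<le> ennreal (real N) * hausdorff_outer hdim (S i ` A)"
proof -
  have "A = (\<lambda>x. 2 *\<^sub>R x - p i) ` S i ` A"
    by (simp add: image_image S_def scaleR_add_right)
  then show ?thesis
    using outer_similarity[of "\<lambda>x. 2 *\<^sub>R x - p i" 2 hdim "S i ` A"] hdim_pos
    by (simp add: two_powr_hdim dist_norm flip: scaleR_diff_right)
qed

text \<open>
  Every ball around a point of the gasket contains a scaled copy of the gasket. Thus the measure
  charges every nonempty relatively open set.
\<close>

lemma small_piece:
  assumes "q \<in> V"
  shows "\<exists>A\<subseteq>V. compact A \<and> A \<subseteq> cball q (diameter V / 2 ^ m) \<and> 0 < hausdorff_outer hdim A"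
  using assms
proof (induction m arbitrary: q)
  case 0
  show ?case
  proof (intro exI[of _ V] conjI subset_refl compact_V outer_V_pos)
    show "V \<subseteq> cball q (diameter V / 2 ^ 0)"
      using 0 compact_imp_bounded[OF compact_V] by (auto intro: diameter_bounded_bound)
  qed
next
  case (Suc m)
  obtain i q' where i: "i \<in> I" "q' \<in> V" "q = S i q'" using V_cases Suc.prems by blast
  obtain A where A: "A \<subseteq> V" "compact A" "A \<subseteq> cball q' (diameter V / 2 ^ m)" "0 < hausdorff_outer hdim A"
    using Suc.IH[OF i(2)] by blast
  have "S i ` A \<subseteq> V" using A(1) i S_in_V by blast
  moreover have "compact (S i ` A)" using A(2) continuous_S by (intro compact_continuous_image)
  moreover have "S i ` A \<subseteq> cball q (diameter V / 2 ^ Suc m)"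
  proof
    fix x assume "x \<in> S i ` A"
    then obtain a where a: "a \<in> A" "x = S i a" by blast
    then have "dist q' a \<le> diameter V / 2 ^ m" using A(3) by auto
    then show "x \<in> cball q (diameter V / 2 ^ Suc m)" unfolding a(2) i(3) mem_cball dist_S by simp
  qed
  moreover have "0 < hausdorff_outer hdim (S i ` A)"
  proof (rule ccontr)
    assume "\<not> ?thesis"
    then have "hausdorff_outer hdim (S i ` A) = 0" by simp
    then have "hausdorff_outer hdim A = 0" using outer_S_ge[of A i] by simp
    with A(4) show False by simp
  qed
  ultimately show ?case by blast
qed

abbreviation "\<mu> \<equiv> gasket_measure N p"

lemma gasket_measure_eq:
  "\<mu> = scale_measure (inverse (hausdorff_outer hdim V)) (restrict_space (hausdorff_measure hdim) V)"
  using closed_in_lambda_system[OF closed_V, of hdim]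
  by (simp add: gasket_measure_def Let_def flip: hdim_def) (simp add: emeasure_hausdorff sets_hausdorff)

lemma V_in_sets: "V \<in> sets (hausdorff_measure hdim)"
  using closed_in_lambda_system[OF closed_V, of hdim] by (simp add: sets_hausdorff)

lemma space_\<mu> [simp]: "space \<mu> = V"
  unfolding gasket_measure_eq space_scale_measure by (simp add: space_restrict_space)

lemma sets_\<mu>: "A \<in> sets \<mu> \<longleftrightarrow> A \<subseteq> V \<and> A \<in> sets (hausdorff_measure hdim)"
  using V_in_sets by (simp add: gasket_measure_eq sets_restrict_space_iff)

lemma emeasure_\<mu>: "A \<in> sets \<mu> \<Longrightarrow> emeasure \<mu> A = inverse (hausdorff_outer hdim V) * hausdorff_outer hdim A"
  unfolding sets_\<mu> using V_in_sets
  by (simp add: gasket_measure_eq emeasure_restrict_space emeasure_hausdorff)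

lemma finite_measure_\<mu>: "finite_measure \<mu>"
proof
  have "V \<in> sets \<mu>" using V_in_sets by (simp add: sets_\<mu>)
  then show "emeasure \<mu> (space \<mu>) \<noteq> \<infinity>"
    using outer_V_pos outer_V_finite
    by (simp add: emeasure_\<mu> ennreal_mult_eq_top_iff less_top ennreal_inverse_eq_top_iff)
qed

lemma emeasure_\<mu>_eq_0: "A \<in> sets \<mu> \<Longrightarrow> emeasure \<mu> A = 0 \<longleftrightarrow> hausdorff_outer hdim A = 0"
  using outer_V_finite by (auto simp: emeasure_\<mu>)

lemma complete_\<mu>:
  assumes "B \<in> null_sets \<mu>" "A \<subseteq> B" shows "A \<in> sets \<mu>"
proof -
  have B: "B \<in> sets \<mu>" "emeasure \<mu> B = 0" using assms by (auto simp: null_sets_def)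
  then have "hausdorff_outer hdim B = 0" by (simp add: emeasure_\<mu>_eq_0)
  then have "hausdorff_outer hdim A = 0" using outer_mono[OF assms(2), of hdim] by simp
  then show ?thesis using null_in_hausdorff B assms(2) by (auto simp: sets_\<mu>)
qed

lemma borel_V_in_sets: "A \<in> sets borel \<Longrightarrow> A \<subseteq> V \<Longrightarrow> A \<in> sets \<mu>"
  using borel_subset_hausdorff by (auto simp: sets_\<mu>)

lemma continuous_measurable:
  assumes "continuous_on V u" shows "u \<in> borel_measurable \<mu>"
proof (rule borel_measurableI)
  fix T :: "'b::topological_space set" assume "open T"
  then obtain T' where T': "open T'" "T' \<inter> V = u -` T \<inter> V"
    using assms unfolding continuous_on_open_invariant by blast
  have "u -` T \<inter> V \<in> sets borel" unfolding T'(2)[symmetric] using T'(1) closed_V by auto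
  then show "u -` T \<inter> space \<mu> \<in> sets \<mu>" by (intro borel_V_in_sets) auto
qed

lemma support_\<mu>:
  assumes "continuous_on V u" "q \<in> V" "u q > (0::real)"
  obtains A d where "A \<in> sets \<mu>" "0 < measure \<mu> A" "0 < d" "\<And>y. y \<in> A \<Longrightarrow> d \<le> u y"
proof -
  obtain r where r: "r > 0" "\<And>y. y \<in> V \<Longrightarrow> dist y q < r \<Longrightarrow> dist (u y) (u q) < u q / 2"
    using assms unfolding continuous_on_iff by (meson half_gt_zero)
  have "diameter V \<ge> 0" using compact_imp_bounded[OF compact_V] by (rule diameter_ge_0)
  obtain m where "(1 / 2) ^ m < r / (diameter V + 1)"
    using real_arch_pow_inv[of "r / (diameter V + 1)" "1 / 2"] r \<open>diameter V \<ge> 0\<close> by auto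
  then have "(diameter V + 1) / 2 ^ m < r" using \<open>diameter V \<ge> 0\<close> by (simp add: field_simps)
  moreover have "diameter V / 2 ^ m \<le> (diameter V + 1) / 2 ^ m" by (intro divide_right_mono) auto
  ultimately have m: "diameter V / 2 ^ m < r" by linarith
  obtain A where A: "A \<subseteq> V" "compact A" "A \<subseteq> cball q (diameter V / 2 ^ m)" "0 < hausdorff_outer hdim A"
    using small_piece[OF assms(2)] by blast
  have sA: "A \<in> sets \<mu>" using A by (intro borel_V_in_sets) (auto intro: borel_compact)
  moreover have "0 < measure \<mu> A"
    using emeasure_\<mu>_eq_0[OF sA] A(4) finite_measure.emeasure_eq_measure[OF finite_measure_\<mu>, of A]
    by (simp add: zero_less_measure_iff)
  moreover have "u q / 2 \<le> u y" if "y \<in> A" for y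
  proof -
    have "dist y q < r" using that A(3) m by (auto simp: dist_commute)
    then have "dist (u y) (u q) < u q / 2" using r(2) that A(1) by blast
    then show ?thesis unfolding dist_real_def by linarith
  qed
  ultimately show thesis using that[of A "u q / 2"] assms(3) by auto
qed

end

text \<open>
  With this, function spaces on the gasket are subspaces to which the results on
  \<^locale>\<open>hilbert_seminorm\<close> apply.
\<close>

instantiation "fun" :: (type, real_vector) real_vector
begin

definition scaleR_fun :: "real \<Rightarrow> ('a \<Rightarrow> 'b) \<Rightarrow> 'a \<Rightarrow> 'b" where
  "scaleR_fun c f = (\<lambda>x. c *\<^sub>R f x)"

instance
  by standard (auto simp: scaleR_fun_def fun_eq_iff algebra_simps)

end

lemma scaleR_fun_apply [simp]: "(c *\<^sub>R f) x = c *\<^sub>R f x"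
  by (simp add: scaleR_fun_def)

context regular_simplex
begin

section \<open>Graph energies\<close>

text \<open>
  The energy scaling factor of the gasket: with it, harmonic extension to the next level preserves
  the energy.
\<close>

definition ren :: real where "ren = (real N + 2) / real N"
definition \<gamma> :: real where "\<gamma> = real N / (real N + 2)"

lemma ren_gamma: "ren > 0" "\<gamma> > 0" "\<gamma> < 1" "ren * \<gamma> = 1" "\<gamma> * ren = 1"
  using N_pos by (auto simp: ren_def \<gamma>_def)

text \<open>
  The energy over the edges of the cells of level \<open>m\<close>. The recursion follows the self-similarity of the
  gasket, so statements about all levels are proved by induction with the functions \<open>u \<circ> S i\<close>.
\<close>

primrec E :: "nat \<Rightarrow> ('a \<Rightarrow> real) \<Rightarrow> ('a \<Rightarrow> real) \<Rightarrow> real" where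
  "E 0 u v = (\<Sum>i\<in>I. \<Sum>j\<in>I. (u (p i) - u (p j)) * (v (p i) - v (p j)))"
| "E (Suc m) u v = ren * (\<Sum>i\<in>I. E m (u \<circ> S i) (v \<circ> S i))"

lemma E_sym: "E m u v = E m v u"
  by (induction m arbitrary: u v) (simp_all add: mult.commute)

lemma fun_comp_simps: "(u + v) \<circ> f = (u \<circ> f) + (v \<circ> f)" "(u - v) \<circ> f = (u \<circ> f) - (v \<circ> f)"
  "(c *\<^sub>R u) \<circ> f = c *\<^sub>R (u \<circ> f)" for u v :: "'b \<Rightarrow> 'c::real_vector"
  by (auto simp: fun_eq_iff)

lemma E_add_left: "E m (u + v) w = E m u w + E m v w"
proof (induction m arbitrary: u v w)
  case 0
  show ?case unfolding E.simps sum.distrib[symmetric]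
    by (intro sum.cong refl) (simp add: algebra_simps)
next
  case (Suc m)
  show ?case unfolding E.simps fun_comp_simps Suc.IH sum.distrib distrib_left ..
qed

lemma E_scale_left: "E m (c *\<^sub>R u) w = c * E m u w"
proof (induction m arbitrary: u w)
  case 0
  show ?case unfolding E.simps sum_distrib_left
    by (intro sum.cong refl) (simp add: algebra_simps)
next
  case (Suc m)
  show ?case unfolding E.simps fun_comp_simps Suc.IH sum_distrib_left[symmetric] by simp
qed

lemma E_diff_left: "E m (u - v) w = E m u w - E m v w"
  using E_add_left[of m u "(-1) *\<^sub>R v" w] E_scale_left[of m "-1" v w] by simp

lemma E_add_right: "E m w (u + v) = E m w u + E m w v"
  using E_add_left E_sym by metis

lemma E_diff_right: "E m w (u - v) = E m w u - E m w v"
  using E_diff_left E_sym by metis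

lemma E_scale_right: "E m w (c *\<^sub>R u) = c * E m w u"
  using E_scale_left E_sym by metis

lemma E_nonneg: "0 \<le> E m u u"
proof (induction m arbitrary: u)
  case 0
  show ?case unfolding E.simps by (intro sum_nonneg) simp
next
  case (Suc m)
  then show ?case using ren_gamma(1) unfolding E.simps by (intro mult_nonneg_nonneg sum_nonneg) auto
qed

lemma E_cong:
  assumes "\<And>x. x \<in> V \<Longrightarrow> u x = u' x" "\<And>x. x \<in> V \<Longrightarrow> v x = v' x"
  shows "E m u v = E m u' v'"
  using assms
proof (induction m arbitrary: u u' v v')
  case 0
  then show ?case by (auto intro!: sum.cong simp: p_in_V)
next
  case (Suc m)
  have "E m (u \<circ> S i) (v \<circ> S i) = E m (u' \<circ> S i) (v' \<circ> S i)" if "i \<in> I" for i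
    by (rule Suc.IH) (use Suc.prems S_in_V that in auto)
  then show ?case by simp
qed

lemma double_diff_sum:
  fixes a b :: "nat \<Rightarrow> real"
  shows "(\<Sum>i\<in>I. \<Sum>j\<in>I. (a i - a j) * (b i - b j)) = 2 * (\<Sum>i\<in>I. (real N * a i - sum a I) * b i)"
proof -
  have "(\<Sum>i\<in>I. \<Sum>j\<in>I. (a i - a j) * (b i - b j)) =
      (\<Sum>i\<in>I. \<Sum>j\<in>I. a i * b i + a j * b j - a j * b i - a i * b j)"
    by (simp add: algebra_simps)
  also have "\<dots> = (\<Sum>i\<in>I. real N * (a i * b i)) + real N * (\<Sum>j\<in>I. a j * b j)
      - (\<Sum>i\<in>I. \<Sum>j\<in>I. a j * b i) - (\<Sum>i\<in>I. \<Sum>j\<in>I. a i * b j)"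
    by (simp add: sum.distrib sum_subtractf)
  also have "(\<Sum>i\<in>I. \<Sum>j\<in>I. a i * b j) = (\<Sum>i\<in>I. \<Sum>j\<in>I. a j * b i)"
    by (rule sum.swap)
  finally show ?thesis
    by (simp add: sum_distrib_left sum_subtractf sum.distrib left_diff_distrib sum_distrib_right algebra_simps)
qed

text \<open>
  The corner values on the cell \<open>i\<close> of the harmonic extension of the corner values \<open>c\<close>. The value at
  the midpoint \<open>S i (p k)\<close> makes the discrete Laplacian of level \<open>1\<close> vanish there.
\<close>

definition refine :: "nat \<Rightarrow> (nat \<Rightarrow> real) \<Rightarrow> nat \<Rightarrow> real" where
  "refine i c k = (if k = i then c i else (c i + c k + sum c I) / (real N + 2))"

lemma refine_sym: "refine i c j = refine j c i"
  by (simp add: refine_def)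

lemma sum_refine: "i \<in> I \<Longrightarrow> sum (refine i c) I = real N * (2 * c i + sum c I) / (real N + 2)"
proof -
  assume i: "i \<in> I"
  have "sum (refine i c) I = (\<Sum>k\<in>I. (c i + c k + sum c I) / (real N + 2) + (if k = i then (real N * c i - sum c I) / (real N + 2) else 0))"
  proof (intro sum.cong refl)
    fix k assume "k \<in> I"
    have "c i = ((c i + c i + sum c I) + (real N * c i - sum c I)) / (real N + 2)"
      by (simp add: field_simps)
    then show "refine i c k = (c i + c k + sum c I) / (real N + 2) + (if k = i then (real N * c i - sum c I) / (real N + 2) else 0)"
      by (simp add: refine_def flip: add_divide_distrib)
  qed
  also have "\<dots> = (real N * c i + sum c I + real N * sum c I) / (real N + 2) + (real N * c i - sum c I) / (real N + 2)"
    using i by (simp add: sum.distrib flip: sum_divide_distrib)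
  also have "\<dots> = real N * (2 * c i + sum c I) / (real N + 2)"
    unfolding add_divide_distrib[symmetric] by (simp add: algebra_simps)
  finally show ?thesis .
qed

text \<open>
  Summation by parts: as \<open>u\<close> is harmonic at the midpoints, only the terms at the corners of the simplex
  remain.
\<close>

lemma E1_harmonic:
  assumes "\<And>i k. i \<in> I \<Longrightarrow> k \<in> I \<Longrightarrow> u (S i (p k)) = refine i (\<lambda>l. u (p l)) k"
  shows "E (Suc 0) u v = E 0 u v"
proof -
  define c where "c l = u (p l)" for l
  define s where "s = sum c I"
  define w where "w i k = v (S i (p k))" for i k
  have w_sym: "w i k = w k i" for i k by (simp add: w_def S_p_sym)
  have w_diag: "w i i = v (p i)" for i by (simp add: w_def S_p)
  have "E (Suc 0) u v = ren * (\<Sum>i\<in>I. \<Sum>j\<in>I. \<Sum>k\<in>I. (refine i c j - refine i c k) * (w i j - w i k))"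
  proof -
    have "E 0 (u \<circ> S i) (v \<circ> S i) = (\<Sum>j\<in>I. \<Sum>k\<in>I. (refine i c j - refine i c k) * (w i j - w i k))" if "i \<in> I" for i
      unfolding E.simps c_def w_def using assms[OF that] by (intro sum.cong refl) simp
    then show ?thesis by simp
  qed
  also have "\<dots> = ren * (\<Sum>i\<in>I. 2 * (\<Sum>j\<in>I. (real N * refine i c j - sum (refine i c) I) * w i j))"
    by (simp only: double_diff_sum)
  also have "\<dots> = ren * (\<Sum>i\<in>I. 2 * (\<Sum>j\<in>I. \<gamma> * ((c j - c i) * w i j) + (if j = i then \<gamma> * (real N * c i - s) * w i i else 0)))"
  proof -
    have "(real N * refine i c j - sum (refine i c) I) * w i j =
        \<gamma> * ((c j - c i) * w i j) + (if j = i then \<gamma> * (real N * c i - s) * w i i else 0)"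
      if "i \<in> I" for i j
    proof -
      have n: "real N + 2 \<noteq> 0" by simp
      have "real N * refine i c j - sum (refine i c) I = \<gamma> * ((c j - c i) + (if j = i then real N * c i - s else 0))"
      proof (cases "j = i")
        case True
        have "real N * c i - real N * (2 * c i + s) / (real N + 2) = (real N * c i * (real N + 2) - real N * (2 * c i + s)) / (real N + 2)"
        proof -
          have "real N * c i = real N * c i * (real N + 2) / (real N + 2)" using n by simp
          then show ?thesis unfolding diff_divide_distrib by (rule arg_cong)
        qed
        also have "\<dots> = real N / (real N + 2) * (real N * c i - s)"
          by (simp add: algebra_simps)
        finally show ?thesis using True unfolding sum_refine[OF that] by (simp add: refine_def \<gamma>_def s_def)
      next
        case False
        then have "real N * refine i c j - sum (refine i c) I = (real N * (c i + c j + s) - real N * (2 * c i + s)) / (real N + 2)"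
          unfolding sum_refine[OF that] by (simp add: refine_def s_def diff_divide_distrib)
        also have "\<dots> = \<gamma> * (c j - c i)" by (simp add: \<gamma>_def algebra_simps)
        finally show ?thesis using False by simp
      qed
      then have "(real N * refine i c j - sum (refine i c) I) * w i j = \<gamma> * ((c j - c i) + (if j = i then real N * c i - s else 0)) * w i j"
        by (rule arg_cong)
      then show ?thesis by (auto simp: algebra_simps)
    qed
    then show ?thesis by simp
  qed
  also have "\<dots> = ren * (2 * \<gamma> * (\<Sum>i\<in>I. \<Sum>j\<in>I. (c j - c i) * w i j) + 2 * \<gamma> * (\<Sum>i\<in>I. (real N * c i - s) * w i i))"
    by (simp add: sum.distrib sum_distrib_left mult.assoc)
  also have "(\<Sum>i\<in>I. \<Sum>j\<in>I. (c j - c i) * w i j) = 0"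
  proof -
    let ?A = "\<Sum>i\<in>I. \<Sum>j\<in>I. (c j - c i) * w i j"
    have "?A = (\<Sum>i\<in>I. \<Sum>j\<in>I. (c i - c j) * w j i)" by (rule sum.swap)
    also have "\<dots> = (\<Sum>i\<in>I. \<Sum>j\<in>I. - ((c j - c i) * w i j))"
      by (intro sum.cong refl) (simp add: w_sym[of _ _] algebra_simps w_sym)
    also have "\<dots> = - ?A" by (simp add: sum_negf)
    finally show ?thesis by simp
  qed
  also have "ren * (2 * \<gamma> * 0 + 2 * \<gamma> * (\<Sum>i\<in>I. (real N * c i - s) * w i i)) = 2 * (\<Sum>i\<in>I. (real N * c i - s) * v (p i))"
    using ren_gamma by (simp add: w_diag mult.assoc[symmetric])
  also have "\<dots> = E 0 u v"
  proof -
    have "s = (\<Sum>i\<in>I. u (p i))" by (simp add: s_def c_def)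
    then show ?thesis by (simp only: E.simps double_diff_sum c_def)
  qed
  finally show ?thesis .
qed

text \<open>
  The function that is \<open>U i\<close>, transported to the cell \<open>i\<close>, on each cell. Cells meet in the points
  \<open>S i (p j)\<close> only, so the choice of \<open>i\<close> is immaterial as soon as \<open>U i (p j) = U j (p i)\<close>.
\<close>

definition glue :: "(nat \<Rightarrow> 'a \<Rightarrow> real) \<Rightarrow> 'a \<Rightarrow> real" where
  "glue U x = (let i = (SOME i. i \<in> I \<and> x \<in> S i ` V) in U i (2 *\<^sub>R x - p i))"

lemma S_inverse: "2 *\<^sub>R S i x - p i = x"
  by (simp add: S_def scaleR_add_right)

lemma glue_S:
  assumes compat: "\<And>i j. i \<in> I \<Longrightarrow> j \<in> I \<Longrightarrow> U i (p j) = U j (p i)"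
    and "x \<in> V" "i \<in> I"
  shows "glue U (S i x) = U i x"
proof -
  define j where "j = (SOME j. j \<in> I \<and> S i x \<in> S j ` V)"
  have j: "j \<in> I" "S i x \<in> S j ` V"
    using someI[of "\<lambda>j. j \<in> I \<and> S i x \<in> S j ` V" i] assms by (auto simp: j_def)
  then obtain y where y: "y \<in> V" "S i x = S j y" by auto
  have "glue U (S i x) = U j (2 *\<^sub>R S i x - p j)"
    unfolding glue_def j_def[symmetric] Let_def ..
  also have "S i x = S j y" by (rule y)
  also have "2 *\<^sub>R S j y - p j = y" by (rule S_inverse)
  also have "U j y = U i x"
  proof (cases "i = j")
    case True then show ?thesis using y by simp
  next
    case False
    then show ?thesis using S_overlap[of x y i j] assms y j compat by metis
  qed
  finally show ?thesis using y(2) by simp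
qed

lemma continuous_glue:
  assumes compat: "\<And>i j. i \<in> I \<Longrightarrow> j \<in> I \<Longrightarrow> U i (p j) = U j (p i)"
    and cont: "\<And>i. i \<in> I \<Longrightarrow> continuous_on V (U i)"
  shows "continuous_on V (glue U)"
proof -
  have "continuous_on (\<Union>i\<in>I. S i ` V) (glue U)"
  proof (rule continuous_on_closed_Union)
    fix i assume i: "i \<in> I"
    have "compact (S i ` V)"
      by (intro compact_continuous_image continuous_S compact_V)
    then show "closed (S i ` V)" by (rule compact_imp_closed)
    have *: "continuous_on (S i ` V) (\<lambda>x. U i (2 *\<^sub>R x - p i))"
      by (rule continuous_on_compose2[OF cont[OF i]]) (auto intro!: continuous_intros simp: S_inverse)
    show "continuous_on (S i ` V) (glue U)"
      by (rule continuous_on_eq[OF *]) (use glue_S[of U, OF compat] i in \<open>auto simp: S_inverse\<close>)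
  qed simp
  then show ?thesis using V_eq by simp
qed

section \<open>Harmonic functions and splines\<close>

text \<open>
  The corner values are refined harmonically \<open>n\<close> times and then interpolated affinely.
\<close>

primrec hiter :: "nat \<Rightarrow> (nat \<Rightarrow> real) \<Rightarrow> 'a \<Rightarrow> real" where
  "hiter 0 c = (\<lambda>x. \<Sum>i\<in>I. c i * bary i x)"
| "hiter (Suc n) c = glue (\<lambda>i. hiter n (refine i c))"

lemma hiter_p: "j \<in> I \<Longrightarrow> hiter n c (p j) = c j"
proof (induction n arbitrary: c j)
  case 0
  have "(\<Sum>i\<in>I. c i * bary i (p j)) = (\<Sum>i\<in>I. if i = j then c i else 0)"
    using 0 by (intro sum.cong) (auto simp: bary_p)
  with 0 show ?case by simp
next
  case (Suc n)
  have "hiter (Suc n) c (p j) = glue (\<lambda>i. hiter n (refine i c)) (S j (p j))" by (simp add: S_p)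
  also have "\<dots> = hiter n (refine j c) (p j)"
    by (rule glue_S) (use Suc p_in_V in \<open>auto simp: refine_sym\<close>)
  also have "\<dots> = c j" using Suc by (simp add: refine_def)
  finally show ?case .
qed

lemma hiter_Suc_S: "x \<in> V \<Longrightarrow> i \<in> I \<Longrightarrow> hiter (Suc n) c (S i x) = hiter n (refine i c) x"
  unfolding hiter.simps by (rule glue_S) (auto simp: hiter_p refine_sym)

lemma continuous_hiter: "continuous_on V (hiter n c)"
proof (induction n arbitrary: c)
  case 0
  show ?case unfolding hiter.simps by (intro continuous_intros continuous_bary)
next
  case (Suc n)
  show ?case unfolding hiter.simps by (rule continuous_glue) (auto simp: hiter_p refine_sym Suc)
qed

text \<open>
  A midpoint value is an average to which every corner contributes, so refinement shrinks the
  oscillation by a fixed factor. This makes the iteration \<^const>\<open>hiter\<close> converge uniformly.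
\<close>

lemma refine_contracts:
  assumes "\<And>k l. k \<in> I \<Longrightarrow> l \<in> I \<Longrightarrow> \<bar>c k - c l\<bar> \<le> e" "i \<in> I" "k \<in> I" "l \<in> I"
  shows "\<bar>refine i c k - refine i c l\<bar> \<le> \<gamma> * e"
proof -
  have e: "0 \<le> e" using assms(1)[OF assms(2,2)] by simp
  have own: "\<bar>c i - (c i + c k + sum c I) / (real N + 2)\<bar> \<le> \<gamma> * e" if "k \<in> I" "k \<noteq> i" for k
  proof -
    have "\<bar>\<Sum>l\<in>I. c i - c l\<bar> \<le> (\<Sum>l\<in>I. if l = i then 0 else e)"
      by (rule order_trans[OF sum_abs]) (use assms in \<open>auto intro!: sum_mono\<close>)
    also have "\<dots> = (\<Sum>l\<in>I. e) - (\<Sum>l\<in>I. if l = i then e else 0)"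
      unfolding sum_subtractf[symmetric] by (intro sum.cong) auto
    also have "\<dots> = real N * e - e" using assms by simp
    finally have "\<bar>(\<Sum>l\<in>I. c i - c l) + (c i - c k)\<bar> \<le> real N * e"
      using assms(1)[OF assms(2) that(1)] by linarith
    moreover have "c i - (c i + c k + sum c I) / (real N + 2) = ((\<Sum>l\<in>I. c i - c l) + (c i - c k)) / (real N + 2)"
      by (simp add: sum_subtractf field_simps)
    ultimately show ?thesis by (simp add: \<gamma>_def abs_divide divide_right_mono)
  qed
  have mm: "\<bar>(c i + c k + sum c I) / (real N + 2) - (c i + c l + sum c I) / (real N + 2)\<bar> \<le> \<gamma> * e"
  proof -
    have "(c i + c k + sum c I) / (real N + 2) - (c i + c l + sum c I) / (real N + 2) = (c k - c l) / (real N + 2)"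
      by (simp add: diff_divide_distrib[symmetric])
    moreover have "\<bar>c k - c l\<bar> \<le> real N * e"
      using assms(1)[OF assms(3,4)] mult_right_mono[of 1 "real N" e] e N_pos N2 by simp
    ultimately show ?thesis by (simp add: \<gamma>_def abs_divide divide_right_mono)
  qed
  show ?thesis
    using own[OF assms(3)] own[OF assms(4)] mm e ren_gamma by (auto simp: refine_def abs_minus_commute)
qed

lemma hiter_0_bound:
  assumes "\<And>k. k \<in> I \<Longrightarrow> \<bar>c k - b\<bar> \<le> e" "x \<in> V"
  shows "\<bar>hiter 0 c x - b\<bar> \<le> e"
proof -
  have "hiter 0 c x - b = (\<Sum>i\<in>I. (c i - b) * bary i x)"
    by (simp add: sum_subtractf left_diff_distrib flip: sum_distrib_left) (simp add: bary_sum)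
  also have "\<bar>\<dots>\<bar> \<le> (\<Sum>i\<in>I. e * bary i x)"
    by (rule order_trans[OF sum_abs], rule sum_mono)
      (use assms bary_nonneg in \<open>auto simp: abs_mult intro!: mult_right_mono\<close>)
  also have "\<dots> = e" by (simp add: bary_sum flip: sum_distrib_left)
  finally show ?thesis .
qed

lemma refine_bound:
  assumes "\<And>k. k \<in> I \<Longrightarrow> \<bar>c k - b\<bar> \<le> e" "i \<in> I" "k \<in> I"
  shows "\<bar>refine i c k - b\<bar> \<le> e"
proof (cases "k = i")
  case False
  have "(c i + c k + sum c I) / (real N + 2) - b = ((c i - b) + (c k - b) + (\<Sum>l\<in>I. c l - b)) / (real N + 2)"
    by (simp add: sum_subtractf field_simps)
  moreover have "\<bar>(c i - b) + (c k - b) + (\<Sum>l\<in>I. c l - b)\<bar> \<le> e + e + (\<Sum>l\<in>I. e)"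
    by (intro order_trans[OF abs_triangle_ineq] add_mono order_trans[OF sum_abs] sum_mono assms)
  ultimately show ?thesis using False
    by (simp add: refine_def abs_divide divide_le_eq algebra_simps)
qed (use assms in \<open>simp add: refine_def\<close>)

lemma hiter_Suc_diff:
  assumes "\<And>k l. k \<in> I \<Longrightarrow> l \<in> I \<Longrightarrow> \<bar>c k - c l\<bar> \<le> e" "x \<in> V"
  shows "\<bar>hiter (Suc n) c x - hiter n c x\<bar> \<le> \<gamma> ^ n * (2 * e)"
  using assms
proof (induction n arbitrary: c e x)
  case 0
  obtain i y where i: "i \<in> I" "y \<in> V" "x = S i y" using V_cases 0 by blast
  have "\<bar>hiter (Suc 0) c x - c i\<bar> \<le> e"
    unfolding i(3) hiter_Suc_S[OF i(2,1)]
    by (rule hiter_0_bound[OF refine_bound i(2)]) (use 0 i in auto)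
  moreover have "\<bar>hiter 0 c x - c i\<bar> \<le> e"
    by (rule hiter_0_bound) (use 0 i in auto)
  ultimately show ?case by simp
next
  case (Suc n)
  obtain i y where i: "i \<in> I" "y \<in> V" "x = S i y" using V_cases Suc by blast
  have "\<bar>hiter (Suc n) (refine i c) y - hiter n (refine i c) y\<bar> \<le> \<gamma> ^ n * (2 * (\<gamma> * e))"
    by (rule Suc.IH[OF refine_contracts]) (use Suc.prems i in auto)
  then show ?case unfolding i(3) hiter_Suc_S[OF i(2,1)] by (simp add: mult_ac)
qed

text \<open>
  The limit of \<^const>\<open>hiter\<close>, written as a telescoping series in order to apply the Weierstrass test.
\<close>

definition harmonic :: "(nat \<Rightarrow> real) \<Rightarrow> 'a \<Rightarrow> real" where
  "harmonic c x = hiter 0 c x + (\<Sum>n. hiter (Suc n) c x - hiter n c x)"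

lemma uniform_limit_hiter: "uniform_limit V (\<lambda>n. hiter n c) (harmonic c) sequentially"
proof -
  define e where "e = Max ((\<lambda>(k, l). \<bar>c k - c l\<bar>) ` (I \<times> I))"
  have e: "\<bar>c k - c l\<bar> \<le> e" if "k \<in> I" "l \<in> I" for k l
    unfolding e_def by (rule Max_ge) (use that in auto)
  have "summable (\<lambda>n. \<gamma> ^ n * (2 * e))"
    using ren_gamma by (intro summable_mult2 summable_geometric) auto
  then have "uniform_limit V (\<lambda>n x. \<Sum>i<n. hiter (Suc i) c x - hiter i c x)
      (\<lambda>x. \<Sum>i. hiter (Suc i) c x - hiter i c x) sequentially"
    by (intro Weierstrass_m_test) (use hiter_Suc_diff[OF e] in auto)
  then have "uniform_limit V (\<lambda>n x. hiter n c x - hiter 0 c x)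
      (\<lambda>x. \<Sum>i. hiter (Suc i) c x - hiter i c x) sequentially"
  proof -
    have "(\<Sum>i<n. hiter (Suc i) c x - hiter i c x) = hiter n c x - hiter 0 c x" for n x
      by (rule sum_lessThan_telescope)
    with \<open>uniform_limit V (\<lambda>n x. \<Sum>i<n. hiter (Suc i) c x - hiter i c x) _ _\<close> show ?thesis by (simp only:)
  qed
  then have "uniform_limit V (\<lambda>n x. hiter 0 c x + (hiter n c x - hiter 0 c x))
      (\<lambda>x. hiter 0 c x + (\<Sum>i. hiter (Suc i) c x - hiter i c x)) sequentially"
    by (intro uniform_limit_intros)
  then show ?thesis by (simp add: harmonic_def[abs_def])
qed

lemma hiter_tendsto: "x \<in> V \<Longrightarrow> (\<lambda>n. hiter n c x) \<longlonglongrightarrow> harmonic c x"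
  using uniform_limit_hiter by (rule tendsto_uniform_limitI)

lemma continuous_harmonic: "continuous_on V (harmonic c)"
  by (rule uniform_limit_theorem[OF _ uniform_limit_hiter]) (auto simp: continuous_hiter)

lemma harmonic_p: "j \<in> I \<Longrightarrow> harmonic c (p j) = c j"
  using hiter_tendsto[OF p_in_V, of j c] by (simp add: hiter_p LIMSEQ_const_iff)

lemma harmonic_S:
  assumes "x \<in> V" "i \<in> I" shows "harmonic c (S i x) = harmonic (refine i c) x"
proof -
  have "(\<lambda>n. hiter (Suc n) c (S i x)) \<longlonglongrightarrow> harmonic c (S i x)"
    using hiter_tendsto[OF S_in_V[OF assms]] by (rule LIMSEQ_Suc)
  then have "(\<lambda>n. hiter n (refine i c) x) \<longlonglongrightarrow> harmonic c (S i x)"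
    by (simp only: hiter_Suc_S[OF assms])
  then show ?thesis using hiter_tendsto[OF assms(1)] LIMSEQ_unique by blast
qed

lemma E_harmonic: "E m (harmonic c) v = E 0 (harmonic c) v"
proof (induction m arbitrary: c v)
  case (Suc m)
  have "E m (harmonic c \<circ> S i) w = E 0 (harmonic c \<circ> S i) w" if "i \<in> I" for i w
  proof -
    have "E k (harmonic c \<circ> S i) w = E k (harmonic (refine i c)) w" for k
      by (rule E_cong) (use that harmonic_S in auto)
    then show ?thesis using Suc.IH by simp
  qed
  then have "E (Suc m) (harmonic c) v = E (Suc 0) (harmonic c) v" by simp
  also have "\<dots> = E 0 (harmonic c) v"
    by (rule E1_harmonic) (simp add: harmonic_S p_in_V harmonic_p refine_def cong: sum.cong)
  finally show ?case .
qed simp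

text \<open>
  The function that agrees with \<open>u\<close> on \<open>Vs k\<close> and is harmonic in every cell of level \<open>k\<close>.
\<close>

primrec spline :: "nat \<Rightarrow> ('a \<Rightarrow> real) \<Rightarrow> 'a \<Rightarrow> real" where
  "spline 0 u = harmonic (\<lambda>i. u (p i))"
| "spline (Suc k) u = glue (\<lambda>i. spline k (u \<circ> S i))"

lemma spline_p: "j \<in> I \<Longrightarrow> spline k u (p j) = u (p j)"
proof (induction k arbitrary: u j)
  case (Suc k)
  have "spline (Suc k) u (p j) = glue (\<lambda>i. spline k (u \<circ> S i)) (S j (p j))" by (simp add: S_p)
  also have "\<dots> = spline k (u \<circ> S j) (p j)"
    by (rule glue_S) (use Suc p_in_V S_p_sym in auto)
  finally show ?case using Suc by (simp add: S_p)
qed (simp add: harmonic_p)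

lemma spline_S: "x \<in> V \<Longrightarrow> i \<in> I \<Longrightarrow> spline (Suc k) u (S i x) = spline k (u \<circ> S i) x"
  unfolding spline.simps by (rule glue_S) (auto simp: spline_p S_p_sym)

lemma continuous_spline: "continuous_on V (spline k u)"
proof (induction k arbitrary: u)
  case (Suc k)
  show ?case unfolding spline.simps by (rule continuous_glue) (auto simp: spline_p S_p_sym Suc)
qed (simp add: continuous_harmonic)

lemma E_spline: "E (k + m) (spline k u) v = E k u v"
proof (induction k arbitrary: u v)
  case 0
  have "E (0 + m) (spline 0 u) v = E 0 (harmonic (\<lambda>i. u (p i))) v" using E_harmonic by simp
  then show ?case by (simp add: harmonic_p)
next
  case (Suc k)
  have "E (k + m) (spline (Suc k) u \<circ> S i) (v \<circ> S i) = E k (u \<circ> S i) (v \<circ> S i)" if "i \<in> I" for i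
  proof -
    have "E (k + m) (spline (Suc k) u \<circ> S i) (v \<circ> S i) = E (k + m) (spline k (u \<circ> S i)) (v \<circ> S i)"
      by (rule E_cong) (use that in \<open>simp_all only: comp_apply spline_S\<close>)
    then show ?thesis using Suc.IH by (rule trans)
  qed
  then show ?case unfolding add_Suc E.simps by (intro arg_cong[of _ _ "(*) ren"] sum.cong refl)
qed

text \<open>
  The spline is the orthogonal projection of \<open>u\<close> in energy; thus splines approximate \<open>u\<close> in energy as
  soon as the energies of \<open>u\<close> converge.
\<close>

lemma E_minus_spline: "E (k + m) (u - spline k u) (u - spline k u) = E (k + m) u u - E k u u"
proof -
  have "E (k + m) (u - spline k u) (u - spline k u) =
      E (k + m) u u - 2 * E (k + m) (spline k u) u + E (k + m) (spline k u) (spline k u)"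
    by (simp add: E_diff_left E_diff_right E_sym[of "k + m" u "spline k u"])
  also have "E (k + m) (spline k u) (spline k u) = E k u u"
    by (metis E_spline E_sym add_0_right)
  finally show ?thesis unfolding E_spline by linarith
qed

lemma E_mono: "k \<le> m \<Longrightarrow> E k u u \<le> E m u u"
  using E_minus_spline[of k "m - k" u] E_nonneg[of m "u - spline k u"] by simp

section \<open>The energy over close pairs\<close>

abbreviation "W \<equiv> energy_approx N p"

lemma W_eq: "W m u v = ren ^ m * (\<Sum>z\<in>close_pairs m. (u (fst z) - u (snd z)) * (v (fst z) - v (snd z)))"
  by (simp add: energy_approx_def ren_def close_pairs_def case_prod_beta)

lemma W_sym: "W m u v = W m v u"
  by (simp add: W_eq mult.commute)

lemma W_add_left: "W m (u + v) w = W m u w + W m v w"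
  unfolding W_eq distrib_left[symmetric] sum.distrib[symmetric]
  by (intro arg_cong[of _ _ "(*) _"] sum.cong refl) (simp add: algebra_simps)

lemma W_scale_left: "W m (c *\<^sub>R u) w = c * W m u w"
proof -
  have "W m (c *\<^sub>R u) w = ren ^ m * (\<Sum>z\<in>close_pairs m. c * ((u (fst z) - u (snd z)) * (w (fst z) - w (snd z))))"
    unfolding W_eq by (intro arg_cong[of _ _ "(*) _"] sum.cong refl) (simp add: algebra_simps)
  then show ?thesis by (simp add: W_eq flip: sum_distrib_left)
qed

lemma W_diff_left: "W m (u - v) w = W m u w - W m v w"
  using W_add_left[of m u "(-1) *\<^sub>R v" w] W_scale_left[of m "-1" v w] by simp

lemma W_add_right: "W m w (u + v) = W m w u + W m w v"
  using W_add_left W_sym by metis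

lemma W_diff_right: "W m w (u - v) = W m w u - W m w v"
  using W_diff_left W_sym by metis

lemma W_cong:
  assumes "\<And>x. x \<in> V \<Longrightarrow> u x = u' x" "\<And>x. x \<in> V \<Longrightarrow> v x = v' x"
  shows "W m u v = W m u' v'"
proof -
  have "(u (fst z) - u (snd z)) * (v (fst z) - v (snd z)) = (u' (fst z) - u' (snd z)) * (v' (fst z) - v' (snd z))"
    if "z \<in> close_pairs m" for z
  proof -
    have "fst z \<in> V" "snd z \<in> V" using that subsetD[OF Vs_subset[of m]] by (auto simp: close_pairs_def)
    then show ?thesis using assms by simp
  qed
  then show ?thesis by (simp add: W_eq)
qed

lemma W_0: "W 0 u v = E 0 u v"
proof -
  define P where "P = Sigma I (\<lambda>i. I - {i})"
  define \<phi> where "\<phi> = (\<lambda>z. (u (fst z) - u (snd z)) * (v (fst z) - v (snd z)))"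
  have cp: "close_pairs 0 = map_prod p p ` P"
    by (force simp: close_pairs_0 P_def)
  have inj: "inj_on (map_prod p p) P"
    by (auto simp: inj_on_def P_def p_inj)
  have "W 0 u v = (\<Sum>z\<in>P. \<phi> (map_prod p p z))"
    by (simp add: W_eq cp sum.reindex[OF inj] \<phi>_def)
  also have "\<dots> = (\<Sum>i\<in>I. \<Sum>j\<in>I - {i}. \<phi> (p i, p j))"
    unfolding P_def by (subst sum.Sigma) (auto simp: case_prod_beta map_prod_def)
  also have "\<dots> = (\<Sum>i\<in>I. \<Sum>j\<in>I. \<phi> (p i, p j))"
  proof (rule sum.cong[OF refl])
    fix i assume "i \<in> I"
    then show "(\<Sum>j\<in>I - {i}. \<phi> (p i, p j)) = (\<Sum>j\<in>I. \<phi> (p i, p j))"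
      by (subst sum.remove[of I i]) (auto simp: \<phi>_def)
  qed
  finally show ?thesis by (simp add: \<phi>_def)
qed

text \<open>
  The part of the energy of level \<open>m + 1\<close> that comes from the pairs across the largest holes.
\<close>

definition hole_energy :: "nat \<Rightarrow> ('a \<Rightarrow> real) \<Rightarrow> real" where
  "hole_energy m u = (if m = 0 then 0 else ren ^ Suc m * (\<Sum>(i, j, k)\<in>triples.
     (u (S i ((S j ^^ m) (p k))) - u (S j ((S i ^^ m) (p k))))\<^sup>2))"

lemma W_Suc: "W (Suc m) u u = ren * (\<Sum>i\<in>I. W m (u \<circ> S i) (u \<circ> S i)) + hole_energy m u"
proof -
  have "W (Suc m) u u = ren ^ Suc m * (\<Sum>i\<in>I. \<Sum>z\<in>close_pairs m. (u (S i (fst z)) - u (S i (snd z))) * (u (S i (fst z)) - u (S i (snd z)))) + hole_energy m u"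
    unfolding W_eq sum_close_pairs_Suc hole_energy_def
    by (simp add: distrib_left hole_pair_def case_prod_beta power2_eq_square)
  also have "ren ^ Suc m * (\<Sum>i\<in>I. \<Sum>z\<in>close_pairs m. (u (S i (fst z)) - u (S i (snd z))) * (u (S i (fst z)) - u (S i (snd z))))
      = ren * (\<Sum>i\<in>I. W m (u \<circ> S i) (u \<circ> S i))"
    by (simp add: W_eq sum_distrib_left mult.assoc)
  finally show ?thesis .
qed

lemma W_nonneg: "0 \<le> W m u u"
proof -
  have "0 \<le> (\<Sum>z\<in>close_pairs m. (u (fst z) - u (snd z)) * (u (fst z) - u (snd z)))"
    by (rule sum_nonneg) (rule zero_le_square)
  then show ?thesis unfolding W_eq using ren_gamma(1) by simp
qed

lemma hole_energy_nonneg: "0 \<le> hole_energy m u"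
  using ren_gamma(1) by (auto simp: hole_energy_def intro!: mult_nonneg_nonneg sum_nonneg)

lemma W_ge_E: "E m u u \<le> W m u u"
proof (induction m arbitrary: u)
  case (Suc m)
  have "ren * (\<Sum>i\<in>I. E m (u \<circ> S i) (u \<circ> S i)) \<le> ren * (\<Sum>i\<in>I. W m (u \<circ> S i) (u \<circ> S i))"
    using ren_gamma(1) by (intro mult_left_mono sum_mono Suc.IH) auto
  then show ?case using hole_energy_nonneg[of m u] by (simp add: W_Suc)
qed (simp add: W_0)

text \<open>
  The energy of level \<open>m\<close> of the edges at the corner \<open>p j\<close>, each edge counted once.
\<close>

definition corner :: "nat \<Rightarrow> nat \<Rightarrow> ('a \<Rightarrow> real) \<Rightarrow> real" where
  "corner j m u = ren ^ m * (\<Sum>k\<in>I. (u ((S j ^^ m) (p k)) - u (p j))\<^sup>2)"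

lemma corner_Suc: "corner j (Suc m) u = ren * corner j m (u \<circ> S j)"
  by (simp add: corner_def S_p mult.assoc)

lemma sum_triples: "(\<Sum>t\<in>triples. \<phi> t) = (\<Sum>i\<in>I. \<Sum>j\<in>I - {i}. \<Sum>k\<in>I - {i} - {j}. \<phi> (i, j, k))" for \<phi> :: "_ \<Rightarrow> real"
proof -
  have "triples = Sigma I (\<lambda>i. Sigma (I - {i}) (\<lambda>j. I - {i} - {j}))"
    by (auto simp: triples_def)
  then show ?thesis by (simp add: sum.Sigma case_prod_beta)
qed

lemma sum_triples_swap: "(\<Sum>(i, j, k)\<in>triples. \<phi> i j k) = (\<Sum>(i, j, k)\<in>triples. \<phi> j i k)" for \<phi> :: "nat \<Rightarrow> nat \<Rightarrow> nat \<Rightarrow> real"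
  by (rule sum.reindex_bij_witness[of _ "\<lambda>(i, j, k). (j, i, k)" "\<lambda>(i, j, k). (j, i, k)"])
    (auto simp: triples_def)

text \<open>
  A hole pair consists of two neighbours of the junction \<open>S i (p j)\<close>, one in each of the two cells that
  meet there; its energy is charged to the two edges to the junction.
\<close>

lemma hole_energy_le: "hole_energy m u \<le> 4 * ren * (\<Sum>i\<in>I. \<Sum>j\<in>I - {i}. corner j m (u \<circ> S i))"
proof -
  define A where "A i j k = (u (S i ((S j ^^ m) (p k))) - u (S i (p j)))\<^sup>2" for i j k
  have c: "corner j m (u \<circ> S i) = ren ^ m * (\<Sum>k\<in>I. A i j k)" for i j
    by (simp add: corner_def A_def)
  have "(\<Sum>(i, j, k)\<in>triples. (u (S i ((S j ^^ m) (p k))) - u (S j ((S i ^^ m) (p k))))\<^sup>2)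
      \<le> (\<Sum>(i, j, k)\<in>triples. 2 * A i j k + 2 * A j i k)"
  proof (rule sum_mono, clarify)
    fix i j k
    have *: "(x - y)\<^sup>2 \<le> 2 * (x - q)\<^sup>2 + 2 * (y - q)\<^sup>2" for x y q :: real
    proof -
      have "2 * (x - q)\<^sup>2 + 2 * (y - q)\<^sup>2 - (x - y)\<^sup>2 = (x + y - 2 * q)\<^sup>2"
        by (simp add: power2_eq_square algebra_simps)
      then show ?thesis using zero_le_power2[of "x + y - 2 * q"] by linarith
    qed
    show "(u (S i ((S j ^^ m) (p k))) - u (S j ((S i ^^ m) (p k))))\<^sup>2 \<le> 2 * A i j k + 2 * A j i k"
      unfolding A_def using * S_p_sym[of j i] by metis
  qed
  also have "\<dots> = (\<Sum>(i, j, k)\<in>triples. 2 * A i j k) + (\<Sum>(i, j, k)\<in>triples. 2 * A j i k)"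
    by (simp add: sum.distrib case_prod_beta)
  also have "(\<Sum>(i, j, k)\<in>triples. 2 * A j i k) = (\<Sum>(i, j, k)\<in>triples. 2 * A i j k)"
    by (rule sum_triples_swap)
  also have "(\<Sum>(i, j, k)\<in>triples. 2 * A i j k) + (\<Sum>(i, j, k)\<in>triples. 2 * A i j k) = 4 * (\<Sum>(i, j, k)\<in>triples. A i j k)"
    by (simp add: case_prod_beta flip: sum_distrib_left)
  also have "(\<Sum>(i, j, k)\<in>triples. A i j k) = (\<Sum>i\<in>I. \<Sum>j\<in>I - {i}. \<Sum>k\<in>I - {i} - {j}. A i j k)"
    by (simp add: sum_triples)
  also have "\<dots> \<le> (\<Sum>i\<in>I. \<Sum>j\<in>I - {i}. \<Sum>k\<in>I. A i j k)"
    by (intro sum_mono sum_mono2) (auto simp: A_def)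
  finally have le: "(\<Sum>(i, j, k)\<in>triples. (u (S i ((S j ^^ m) (p k))) - u (S j ((S i ^^ m) (p k))))\<^sup>2)
     \<le> 4 * (\<Sum>i\<in>I. \<Sum>j\<in>I - {i}. \<Sum>k\<in>I. A i j k)" by simp
  have "4 * ren * (\<Sum>i\<in>I. \<Sum>j\<in>I - {i}. corner j m (u \<circ> S i)) = ren ^ Suc m * (4 * (\<Sum>i\<in>I. \<Sum>j\<in>I - {i}. \<Sum>k\<in>I. A i j k))"
    by (simp add: c flip: sum_distrib_left)
  moreover have "ren ^ Suc m * (\<Sum>(i, j, k)\<in>triples. (u (S i ((S j ^^ m) (p k))) - u (S j ((S i ^^ m) (p k))))\<^sup>2)
     \<le> ren ^ Suc m * (4 * (\<Sum>i\<in>I. \<Sum>j\<in>I - {i}. \<Sum>k\<in>I. A i j k))"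
    using ren_gamma(1) by (intro mult_left_mono le) simp
  moreover have "0 \<le> ren ^ Suc m * (4 * (\<Sum>i\<in>I. \<Sum>j\<in>I - {i}. \<Sum>k\<in>I. A i j k))"
    using ren_gamma(1) by (intro mult_nonneg_nonneg sum_nonneg) (auto simp: A_def)
  ultimately show ?thesis
    by (cases "m = 0") (simp_all only: hole_energy_def simp_thms if_True if_False)
qed

text \<open>
  The subtracted term keeps the constants independent of \<open>m\<close>. The corner energies of
  \<open>u \<circ> S i\<close> at \<open>p j\<close> with \<open>j \<noteq> i\<close> pay for the hole pairs at the junction \<open>S i (p j)\<close>; those with \<open>j = i\<close>
  remain as corner energies of \<open>u\<close> and are available at coarser levels.
\<close>

lemma W_le_aux: "W m u u \<le> 5 * E m u u - 4 * (\<Sum>j\<in>I. corner j m u)"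
proof (induction m arbitrary: u)
  case 0
  have "(\<Sum>j\<in>I. corner j 0 u) = E 0 u u"
    unfolding E.simps corner_def by (subst sum.swap) (simp add: power2_eq_square)
  then show ?case by (simp add: W_0)
next
  case (Suc m)
  have "W (Suc m) u u \<le> ren * (\<Sum>i\<in>I. W m (u \<circ> S i) (u \<circ> S i)) + 4 * ren * (\<Sum>i\<in>I. \<Sum>j\<in>I - {i}. corner j m (u \<circ> S i))"
    unfolding W_Suc using hole_energy_le by simp
  also have "ren * (\<Sum>i\<in>I. W m (u \<circ> S i) (u \<circ> S i)) \<le> ren * (\<Sum>i\<in>I. 5 * E m (u \<circ> S i) (u \<circ> S i) - 4 * (\<Sum>j\<in>I. corner j m (u \<circ> S i)))"
    using ren_gamma(1) by (intro mult_left_mono sum_mono Suc.IH) auto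
  also have "\<dots> + 4 * ren * (\<Sum>i\<in>I. \<Sum>j\<in>I - {i}. corner j m (u \<circ> S i)) =
      5 * E (Suc m) u u - 4 * ren * (\<Sum>i\<in>I. (\<Sum>j\<in>I. corner j m (u \<circ> S i)) - (\<Sum>j\<in>I - {i}. corner j m (u \<circ> S i)))"
    by (simp add: sum_subtractf algebra_simps flip: sum_distrib_left)
  also have "(\<Sum>i\<in>I. (\<Sum>j\<in>I. corner j m (u \<circ> S i)) - (\<Sum>j\<in>I - {i}. corner j m (u \<circ> S i))) = (\<Sum>i\<in>I. corner i m (u \<circ> S i))"
    by (intro sum.cong refl) (simp add: sum_diff1)
  finally show ?case
    by (simp add: corner_Suc mult.assoc flip: sum_distrib_left)
qed

lemma W_le: "W m u u \<le> 5 * E m u u"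
proof -
  have "0 \<le> (\<Sum>j\<in>I. corner j m u)"
    using ren_gamma(1) by (auto simp: corner_def intro!: sum_nonneg mult_nonneg_nonneg)
  with W_le_aux[of m u] show ?thesis by linarith
qed

text \<open>
  Refinement towards \<open>p j\<close> acts on the differences \<open>c k - c j\<close>: constant ones are multiplied by
  \<open>\<gamma>\<close>, those of sum \<open>0\<close> by \<open>1 / (N + 2)\<close>.
\<close>

lemma harmonic_corner:
  assumes "j \<in> I" "k \<in> I" "k \<noteq> j"
  shows "harmonic c ((S j ^^ m) (p k)) = c j + \<gamma> ^ m * ((sum c I - real N * c j) / (real N - 1))
     + (1 / (real N + 2)) ^ m * (c k - c j - (sum c I - real N * c j) / (real N - 1))"
proof (induction m arbitrary: c)
  case 0
  then show ?case using assms by (simp add: harmonic_p)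
next
  case (Suc m)
  define q where "q = 1 / (real N + 2)"
  define D where "D = sum c I - real N * c j"
  define M where "M = 1 / (real N - 1)"
  have NM: "real N * M = 1 + M" using N2 by (simp add: M_def field_simps)
  have g: "\<gamma> = real N * q" by (simp add: \<gamma>_def q_def)
  have q2: "real N * q + 2 * q = 1" by (simp add: q_def add_divide_distrib[symmetric])
  have D': "sum (refine j c) I - real N * refine j c j = \<gamma> * D"
  proof -
    have "sum (refine j c) I - real N * refine j c j = real N * q * (2 * c j + sum c I) - real N * (real N * q + 2 * q) * c j"
      unfolding sum_refine[OF assms(1)] q2 by (simp add: refine_def q_def)
    then show ?thesis by (simp add: g D_def algebra_simps)
  qed
  have k': "refine j c k - refine j c j = q * (c k - c j + D)"
  proof -
    have "refine j c k - refine j c j = q * (c j + c k + sum c I) - (real N * q + 2 * q) * c j"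
      unfolding q2 using assms by (simp add: refine_def q_def)
    then show ?thesis by (simp add: D_def algebra_simps)
  qed
  have j': "refine j c j = c j" by (simp add: refine_def)
  have V: "(S j ^^ m) (p k) \<in> V"
    using S_iter_in_Vs[of "p k" j m] Vs_subset assms by (auto simp: Vs_0)
  have "harmonic c ((S j ^^ Suc m) (p k)) = harmonic (refine j c) ((S j ^^ m) (p k))"
    using harmonic_S[OF V assms(1)] by simp
  also have "\<dots> = refine j c j + \<gamma> ^ m * ((\<gamma> * D) * M) + q ^ m * ((refine j c k - refine j c j) - (\<gamma> * D) * M)"
    unfolding Suc.IH D' q_def M_def by simp
  also have "(refine j c k - refine j c j) - (\<gamma> * D) * M = q * (c k - c j - D * M) - q * D * (real N * M - (1 + M))"
    unfolding k' g by (simp add: algebra_simps)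
  finally show ?case
    unfolding j' NM by (simp add: D_def M_def q_def mult_ac)
qed

definition hole_factor :: "nat \<Rightarrow> real" where
  "hole_factor m = 2 * \<gamma> ^ Suc m / (real N - 1) + (1 / (real N + 2)) ^ m * (1 / (real N + 2) - 2 * \<gamma> / (real N - 1))"

text \<open>
  In the expansion at the junction, the common part of the differences is a multiple of \<open>c i - c j\<close> on
  one side and its negative on the other, and the dependence on \<open>k\<close> is the same on both sides. This is
  why harmonic functions have a hole energy proportional to their energy.
\<close>

lemma harmonic_hole_diff:
  assumes t: "(i, j, k) \<in> triples"
  shows "harmonic c (S i ((S j ^^ m) (p k))) - harmonic c (S j ((S i ^^ m) (p k))) = hole_factor m * (c i - c j)"
proof -
  have I: "i \<in> I" "j \<in> I" "k \<in> I" "i \<noteq> j" "k \<noteq> i" "k \<noteq> j" using t by (auto simp: triples_def)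
  define q where "q = 1 / (real N + 2)"
  define M where "M = 1 / (real N - 1)"
  define s where "s = sum c I"
  have g: "\<gamma> = real N * q" by (simp add: \<gamma>_def q_def)
  have q2: "real N * q + 2 * q = 1" by (simp add: q_def add_divide_distrib[symmetric])
  have dM: "x / (real N - 1) = x * M" for x by (simp add: M_def)
  have *: "harmonic c (S i ((S j ^^ m) (p k))) = q * (c i + c j + s) + \<gamma> ^ m * (\<gamma> * (c i - c j) * M)
      + q ^ m * (q * (c k - c j) - \<gamma> * (c i - c j) * M)"
    if I: "i \<in> I" "j \<in> I" "k \<in> I" "i \<noteq> j" "k \<noteq> i" "k \<noteq> j" for i j
  proof -
    have V: "(S j ^^ m) (p k) \<in> V"
      using S_iter_in_Vs[of "p k" j m] Vs_subset I by (auto simp: Vs_0)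
    have e: "refine i c j = q * (c i + c j + s)" "refine i c k = q * (c i + c k + s)"
      using I by (auto simp: refine_def q_def s_def)
    have "sum (refine i c) I - real N * refine i c j = real N * q * (2 * c i + s) - real N * (q * (c i + c j + s))"
      unfolding sum_refine[OF I(1)] e by (simp add: q_def s_def)
    then have D: "sum (refine i c) I - real N * refine i c j = \<gamma> * (c i - c j)"
      by (simp add: g algebra_simps)
    show ?thesis
      unfolding harmonic_S[OF V I(1)] harmonic_corner[OF I(2,3,6)] D unfolding e dM q_def[symmetric]
      by (simp add: algebra_simps)
  qed
  show ?thesis
    unfolding *[OF I] *[OF I(2,1,3) I(4)[symmetric] I(6,5)] hole_factor_def
    unfolding dM q_def[symmetric] by (simp add: algebra_simps)
qed

text \<open>
  The ratio of the energy over close pairs of level \<open>m\<close> to the energy, for harmonic functions. The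
  series converges because the hole factors are of order \<open>\<gamma> ^ l\<close> while \<open>ren * \<gamma> = 1\<close>.
\<close>

definition W_factor :: "nat \<Rightarrow> real" where
  "W_factor m = 1 + (\<Sum>l<m. if l = 0 then 0 else ren ^ Suc l * (real N - 2) * (hole_factor l)\<^sup>2)"

lemma hole_energy_harmonic:
  "hole_energy m (harmonic c) = (if m = 0 then 0 else ren ^ Suc m * (real N - 2) * (hole_factor m)\<^sup>2) * E 0 (harmonic c) (harmonic c)"
proof -
  have "(\<Sum>(i, j, k)\<in>triples. (harmonic c (S i ((S j ^^ m) (p k))) - harmonic c (S j ((S i ^^ m) (p k))))\<^sup>2)
      = (\<Sum>(i, j, k)\<in>triples. (hole_factor m)\<^sup>2 * (c i - c j)\<^sup>2)"
    by (intro sum.cong refl) (auto simp: harmonic_hole_diff power_mult_distrib)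
  also have "\<dots> = (\<Sum>i\<in>I. \<Sum>j\<in>I - {i}. (real N - 2) * ((hole_factor m)\<^sup>2 * (c i - c j)\<^sup>2))"
  proof -
    have "card (I - {i} - {j}) = N - 2" if "i \<in> I" "j \<in> I - {i}" for i j
      using that by (simp add: card_Diff_singleton)
    then show ?thesis using N2
      by (simp add: sum_triples of_nat_diff)
  qed
  also have "\<dots> = (\<Sum>i\<in>I. \<Sum>j\<in>I. (real N - 2) * ((hole_factor m)\<^sup>2 * (c i - c j)\<^sup>2))"
  proof (rule sum.cong[OF refl])
    fix i assume "i \<in> I"
    then show "(\<Sum>j\<in>I - {i}. (real N - 2) * ((hole_factor m)\<^sup>2 * (c i - c j)\<^sup>2)) = (\<Sum>j\<in>I. (real N - 2) * ((hole_factor m)\<^sup>2 * (c i - c j)\<^sup>2))"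
      by (subst sum.remove[of I i]) auto
  qed
  also have "\<dots> = (real N - 2) * (hole_factor m)\<^sup>2 * E 0 (harmonic c) (harmonic c)"
    by (simp add: harmonic_p power2_eq_square sum_distrib_left mult.assoc)
  finally show ?thesis by (simp add: hole_energy_def)
qed

lemma W_harmonic: "W m (harmonic c) (harmonic c) = W_factor m * E 0 (harmonic c) (harmonic c)"
proof (induction m arbitrary: c)
  case 0
  then show ?case by (simp add: W_0 W_factor_def del: E.simps)
next
  case (Suc m)
  have "W m (harmonic c \<circ> S i) (harmonic c \<circ> S i) = W_factor m * E 0 (harmonic c \<circ> S i) (harmonic c \<circ> S i)" if i: "i \<in> I" for i
  proof -
    have eq: "(harmonic c \<circ> S i) x = harmonic (refine i c) x" if "x \<in> V" for x using that i harmonic_S by simp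
    have "W m (harmonic c \<circ> S i) (harmonic c \<circ> S i) = W m (harmonic (refine i c)) (harmonic (refine i c))"
      by (rule W_cong) (rule eq, assumption)+
    moreover have "E 0 (harmonic c \<circ> S i) (harmonic c \<circ> S i) = E 0 (harmonic (refine i c)) (harmonic (refine i c))"
      by (rule E_cong) (rule eq, assumption)+
    ultimately show ?thesis using Suc.IH by (simp only:)
  qed
  then have "ren * (\<Sum>i\<in>I. W m (harmonic c \<circ> S i) (harmonic c \<circ> S i)) = W_factor m * E (Suc 0) (harmonic c) (harmonic c)"
    by (simp add: sum_distrib_left mult_ac del: E.simps(1))
  also have "E (Suc 0) (harmonic c) (harmonic c) = E 0 (harmonic c) (harmonic c)" by (rule E_harmonic)
  finally have *: "ren * (\<Sum>i\<in>I. W m (harmonic c \<circ> S i) (harmonic c \<circ> S i)) = W_factor m * E 0 (harmonic c) (harmonic c)" .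
  show ?case unfolding W_Suc hole_energy_harmonic * W_factor_def
    by (simp add: algebra_simps del: E.simps)
qed

definition W_const :: real where "W_const = lim W_factor"

lemma hole_factor_bound: "\<exists>C. \<forall>m. \<bar>hole_factor m\<bar> \<le> C * \<gamma> ^ m"
proof -
  define C where "C = 2 * \<gamma> / (real N - 1) + \<bar>1 / (real N + 2) - 2 * \<gamma> / (real N - 1)\<bar>"
  have "\<bar>hole_factor m\<bar> \<le> C * \<gamma> ^ m" for m
  proof -
    have N1: "0 < real N - 1" using N2 by simp
    have "(1 / (real N + 2)) ^ m \<le> \<gamma> ^ m"
      using N2 by (intro power_mono) (auto simp: \<gamma>_def divide_right_mono)
    then have "\<bar>(1 / (real N + 2)) ^ m * (1 / (real N + 2) - 2 * \<gamma> / (real N - 1))\<bar>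
        \<le> \<gamma> ^ m * \<bar>1 / (real N + 2) - 2 * \<gamma> / (real N - 1)\<bar>"
      unfolding abs_mult using ren_gamma(2) by (intro mult_mono) auto
    moreover have "\<bar>2 * \<gamma> ^ Suc m / (real N - 1)\<bar> = \<gamma> ^ m * (2 * \<gamma> / (real N - 1))"
      using N1 ren_gamma by (simp add: abs_mult)
    ultimately have "\<bar>hole_factor m\<bar> \<le> \<gamma> ^ m * (2 * \<gamma> / (real N - 1)) + \<gamma> ^ m * \<bar>1 / (real N + 2) - 2 * \<gamma> / (real N - 1)\<bar>"
      unfolding hole_factor_def by linarith
    then show ?thesis by (simp add: C_def algebra_simps)
  qed
  then show ?thesis by blast
qed

lemma geometric_ren: "ren ^ Suc m * (C * \<gamma> ^ m)\<^sup>2 = ren * C\<^sup>2 * \<gamma> ^ m"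
proof -
  have "ren ^ m * \<gamma> ^ m = 1" using ren_gamma by (simp flip: power_mult_distrib)
  then have "ren ^ Suc m * (C * \<gamma> ^ m)\<^sup>2 = ren * C\<^sup>2 * (ren ^ m * \<gamma> ^ m) * \<gamma> ^ m"
    by (simp add: power2_eq_square mult_ac)
  with \<open>ren ^ m * \<gamma> ^ m = 1\<close> show ?thesis by simp
qed

lemma W_factor_tendsto: "W_factor \<longlonglongrightarrow> W_const" and W_const_ge_1: "1 \<le> W_const"
proof -
  define a where "a l = (if l = 0 then 0 else ren ^ Suc l * (real N - 2) * (hole_factor l)\<^sup>2)" for l
  obtain C where C: "\<And>m. \<bar>hole_factor m\<bar> \<le> C * \<gamma> ^ m" using hole_factor_bound by blast
  have a0: "0 \<le> a l" for l using N2 ren_gamma(1) by (auto simp: a_def)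
  have le: "a l \<le> (real N - 2) * (ren * C\<^sup>2) * \<gamma> ^ l" for l
  proof -
    have "(hole_factor l)\<^sup>2 \<le> (C * \<gamma> ^ l)\<^sup>2"
      using power_mono[OF C[of l], of 2] by simp
    then have "(real N - 2) * (ren ^ Suc l * (hole_factor l)\<^sup>2) \<le> (real N - 2) * (ren ^ Suc l * (C * \<gamma> ^ l)\<^sup>2)"
      using N2 ren_gamma(1) by (intro mult_left_mono) auto
    moreover have "a l \<le> (real N - 2) * (ren ^ Suc l * (hole_factor l)\<^sup>2)"
      using N2 ren_gamma(1) by (auto simp: a_def)
    ultimately show ?thesis unfolding geometric_ren by (simp add: mult.assoc)
  qed
  have "summable (\<lambda>l. (real N - 2) * (ren * C\<^sup>2) * \<gamma> ^ l)"
    using ren_gamma by (intro summable_mult summable_geometric) auto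
  then have "summable a"
    by (rule summable_comparison_test'[where N = 0]) (use a0 le in auto)
  then have "(\<lambda>m. 1 + (\<Sum>l<m. a l)) \<longlonglongrightarrow> 1 + suminf a"
    by (intro tendsto_intros summable_LIMSEQ)
  moreover have "W_factor = (\<lambda>m. 1 + (\<Sum>l<m. a l))" by (simp add: fun_eq_iff W_factor_def a_def)
  ultimately have *: "W_factor \<longlonglongrightarrow> 1 + suminf a" by simp
  then have "W_const = 1 + suminf a" by (simp add: W_const_def limI)
  with * \<open>summable a\<close> a0 show "W_factor \<longlonglongrightarrow> W_const" "1 \<le> W_const"
    by (auto simp: suminf_nonneg)
qed

text \<open>
  At a corner, the differences of a spline are of order \<open>\<gamma> ^ n\<close>. Their squares beat the factor
  \<open>ren ^ n\<close>, so the pairs across one fixed hole do not contribute in the limit.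
\<close>

lemma spline_corner_decay:
  assumes "j \<in> I" "l \<in> I"
  shows "\<exists>C. \<forall>n. \<bar>spline k u ((S j ^^ n) (p l)) - u (p j)\<bar> \<le> C * \<gamma> ^ n"
proof (induction k arbitrary: u)
  case 0
  show ?case
  proof (cases "l = j")
    case True
    have "(S j ^^ n) (p j) = p j" for n by (simp add: S_iter)
    with True assms show ?thesis by (intro exI[of _ 0]) (simp add: harmonic_p)
  next
    case False
    define c where "c = (\<lambda>i. u (p i))"
    define D where "D = (sum c I - real N * c j) / (real N - 1)"
    have "\<bar>spline 0 u ((S j ^^ n) (p l)) - u (p j)\<bar> \<le> (\<bar>D\<bar> + \<bar>c l - c j - D\<bar>) * \<gamma> ^ n" for n
    proof -
      have "(1 / (real N + 2)) ^ n \<le> \<gamma> ^ n"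
        using N2 by (intro power_mono) (auto simp: \<gamma>_def divide_right_mono)
      then have "\<bar>(1 / (real N + 2)) ^ n * (c l - c j - D)\<bar> \<le> \<gamma> ^ n * \<bar>c l - c j - D\<bar>"
        unfolding abs_mult using ren_gamma(2) by (intro mult_mono) auto
      moreover have "\<bar>\<gamma> ^ n * D\<bar> = \<gamma> ^ n * \<bar>D\<bar>" using ren_gamma by (simp add: abs_mult)
      moreover have "spline 0 u ((S j ^^ n) (p l)) - u (p j) = \<gamma> ^ n * D + (1 / (real N + 2)) ^ n * (c l - c j - D)"
        using harmonic_corner[OF assms False, of c n] by (simp add: c_def D_def)
      ultimately show ?thesis unfolding distrib_right by (smt (verit) mult.commute)
    qed
    then show ?thesis by blast
  qed
next
  case (Suc k)
  obtain C where C: "\<And>n. \<bar>spline k (u \<circ> S j) ((S j ^^ n) (p l)) - u (p j)\<bar> \<le> C * \<gamma> ^ n"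
    using Suc.IH[of "u \<circ> S j"] unfolding comp_apply[of u "S j" "p j"] S_p by blast
  define C' where "C' = max (C / \<gamma>) \<bar>u (p l) - u (p j)\<bar>"
  have "\<bar>spline (Suc k) u ((S j ^^ n) (p l)) - u (p j)\<bar> \<le> C' * \<gamma> ^ n" for n
  proof (cases n)
    case 0
    have "spline (Suc k) u (p l) = u (p l)" by (rule spline_p[OF assms(2)])
    with 0 show ?thesis by (simp add: C'_def del: spline.simps)
  next
    case (Suc n')
    have V: "(S j ^^ n') (p l) \<in> V"
      using S_iter_in_Vs[of "p l" j n'] Vs_subset assms by (auto simp: Vs_0)
    have "\<bar>spline (Suc k) u ((S j ^^ n) (p l)) - u (p j)\<bar> \<le> C * \<gamma> ^ n'"
      using C[of n'] spline_S[OF V assms(1), of k u] Suc by (simp del: spline.simps)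
    also have "\<dots> = C / \<gamma> * \<gamma> ^ n" using ren_gamma Suc by simp
    also have "\<dots> \<le> C' * \<gamma> ^ n" using ren_gamma by (intro mult_right_mono) (auto simp: C'_def)
    finally show ?thesis .
  qed
  then show ?case by blast
qed

lemma hole_energy_spline: "(\<lambda>m. hole_energy m (spline (Suc k) u)) \<longlonglongrightarrow> 0"
proof -
  let ?w = "spline (Suc k) u"
  have *: "(\<lambda>m. ren ^ Suc m * (?w (S i ((S j ^^ m) (p l))) - ?w (S j ((S i ^^ m) (p l))))\<^sup>2) \<longlonglongrightarrow> 0"
    if I: "i \<in> I" "j \<in> I" "l \<in> I" for i j l
  proof -
    have V: "(S j ^^ m) (p l) \<in> V" if "j \<in> I" for j m
      using S_iter_in_Vs[of "p l" j m] Vs_subset I that by (auto simp: Vs_0)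
    obtain C where C: "\<And>m. \<bar>spline k (u \<circ> S i) ((S j ^^ m) (p l)) - u (S i (p j))\<bar> \<le> C * \<gamma> ^ m"
      using spline_corner_decay[OF I(2,3), of k "u \<circ> S i"] by auto
    obtain C' where C': "\<And>m. \<bar>spline k (u \<circ> S j) ((S i ^^ m) (p l)) - u (S j (p i))\<bar> \<le> C' * \<gamma> ^ m"
      using spline_corner_decay[OF I(1,3), of k "u \<circ> S j"] by auto
    have d: "\<bar>?w (S i ((S j ^^ m) (p l))) - ?w (S j ((S i ^^ m) (p l)))\<bar> \<le> (C + C') * \<gamma> ^ m" for m
      using C[of m] C'[of m] S_p_sym[of i j] unfolding spline_S[OF V[OF I(2)] I(1)] spline_S[OF V[OF I(1)] I(2)]
      by (simp add: distrib_right)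
    have b: "ren ^ Suc m * (?w (S i ((S j ^^ m) (p l))) - ?w (S j ((S i ^^ m) (p l))))\<^sup>2 \<le> ren * (C + C')\<^sup>2 * \<gamma> ^ m" for m
    proof -
      have "(?w (S i ((S j ^^ m) (p l))) - ?w (S j ((S i ^^ m) (p l))))\<^sup>2 \<le> ((C + C') * \<gamma> ^ m)\<^sup>2"
        using power_mono[OF d[of m], of 2] by simp
      then show ?thesis
        unfolding geometric_ren[symmetric] using ren_gamma(1) by (intro mult_left_mono) auto
    qed
    have lim: "(\<lambda>m. ren * (C + C')\<^sup>2 * \<gamma> ^ m) \<longlonglongrightarrow> ren * (C + C')\<^sup>2 * 0"
      using ren_gamma by (intro tendsto_intros LIMSEQ_power_zero) auto
    show ?thesis
      by (rule Lim_null_comparison[where g = "\<lambda>m. ren * (C + C')\<^sup>2 * \<gamma> ^ m"])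
        (use b ren_gamma(1) lim in \<open>auto simp: abs_mult simp del: spline.simps power_Suc\<close>)
  qed
  have "(\<lambda>m. \<Sum>(i, j, l)\<in>triples. ren ^ Suc m * (?w (S i ((S j ^^ m) (p l))) - ?w (S j ((S i ^^ m) (p l))))\<^sup>2) \<longlonglongrightarrow> 0"
    by (rule tendsto_null_sum) (use * in \<open>auto simp: triples_def simp del: spline.simps power_Suc\<close>)
  moreover have "hole_energy m ?w = (if m = 0 then 0 else (\<Sum>(i, j, l)\<in>triples. ren ^ Suc m * (?w (S i ((S j ^^ m) (p l))) - ?w (S j ((S i ^^ m) (p l))))\<^sup>2))" for m
    by (simp add: hole_energy_def sum_distrib_left case_prod_beta del: spline.simps power_Suc)
  then have "\<forall>\<^sub>F m in sequentially. (\<Sum>(i, j, l)\<in>triples. ren ^ Suc m * (?w (S i ((S j ^^ m) (p l))) - ?w (S j ((S i ^^ m) (p l))))\<^sup>2) = hole_energy m ?w"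
    by (auto simp: eventually_sequentially simp del: spline.simps power_Suc intro!: exI[of _ 1])
  ultimately show ?thesis by (rule Lim_transform_eventually)
qed

lemma W_spline_tendsto: "(\<lambda>m. W m (spline k u) (spline k u)) \<longlonglongrightarrow> W_const * E k u u"
proof (induction k arbitrary: u)
  case 0
  have "(\<lambda>m. W_factor m * E 0 (harmonic (\<lambda>i. u (p i))) (harmonic (\<lambda>i. u (p i)))) \<longlonglongrightarrow> W_const * E 0 (harmonic (\<lambda>i. u (p i))) (harmonic (\<lambda>i. u (p i)))"
    by (intro tendsto_intros W_factor_tendsto)
  moreover have "E 0 (harmonic (\<lambda>i. u (p i))) (harmonic (\<lambda>i. u (p i))) = E 0 u u" by (simp add: harmonic_p)
  ultimately show ?case by (simp add: W_harmonic del: E.simps)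
next
  case (Suc k)
  let ?w = "spline (Suc k) u"
  have "W m (?w \<circ> S i) (?w \<circ> S i) = W m (spline k (u \<circ> S i)) (spline k (u \<circ> S i))" if "i \<in> I" for i m
    by (rule W_cong) (use that in \<open>simp_all only: comp_apply spline_S\<close>)
  then have "(\<Sum>i\<in>I. W m (?w \<circ> S i) (?w \<circ> S i)) = (\<Sum>i\<in>I. W m (spline k (u \<circ> S i)) (spline k (u \<circ> S i)))" for m
    by (intro sum.cong refl)
  then have eq: "W (Suc m) ?w ?w = ren * (\<Sum>i\<in>I. W m (spline k (u \<circ> S i)) (spline k (u \<circ> S i))) + hole_energy m ?w" for m
    unfolding W_Suc by simp
  have "(\<lambda>m. W (Suc m) ?w ?w) \<longlonglongrightarrow> ren * (\<Sum>i\<in>I. W_const * E k (u \<circ> S i) (u \<circ> S i)) + 0"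
    unfolding eq by (intro tendsto_intros Suc.IH hole_energy_spline)
  also have "ren * (\<Sum>i\<in>I. W_const * E k (u \<circ> S i) (u \<circ> S i)) + 0 = W_const * E (Suc k) u u"
    by (simp add: sum_distrib_left mult_ac)
  finally show ?case by (rule LIMSEQ_imp_Suc)
qed

definition bounded_energy :: "('a \<Rightarrow> real) \<Rightarrow> bool" where
  "bounded_energy u \<longleftrightarrow> (\<exists>B. \<forall>m. E m u u \<le> B)"

definition En :: "('a \<Rightarrow> real) \<Rightarrow> real" where "En u = lim (\<lambda>m. E m u u)"

lemma E_tendsto: "bounded_energy u \<Longrightarrow> (\<lambda>m. E m u u) \<longlonglongrightarrow> En u"
  and E_le_En: "bounded_energy u \<Longrightarrow> E m u u \<le> En u"
proof -
  assume "bounded_energy u"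
  then obtain B where B: "\<And>m. E m u u \<le> B" by (auto simp: bounded_energy_def)
  have inc: "incseq (\<lambda>m. E m u u)" by (auto simp: incseq_def intro: E_mono)
  obtain L where L: "(\<lambda>m. E m u u) \<longlonglongrightarrow> L" "\<forall>m. E m u u \<le> L"
    using incseq_convergent[OF inc, of B] B by auto
  then have "En u = L" by (simp add: En_def limI)
  with L show "(\<lambda>m. E m u u) \<longlonglongrightarrow> En u" "E m u u \<le> En u" by auto
qed

lemma En_le: "(\<And>m. E m u u \<le> B) \<Longrightarrow> En u \<le> B"
  by (rule LIMSEQ_le_const2[OF E_tendsto]) (auto simp: bounded_energy_def)

lemma bounded_energy_add:
  assumes "bounded_energy u" "bounded_energy v" shows "bounded_energy (u + v)"
proof -
  obtain B C where B: "\<And>m. E m u u \<le> B" and C: "\<And>m. E m v v \<le> C"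
    using assms by (auto simp: bounded_energy_def)
  have "E m (u + v) (u + v) \<le> 2 * B + 2 * C" for m
  proof -
    have "E m (u + v) (u + v) + E m (u - v) (u - v) = 2 * E m u u + 2 * E m v v"
      unfolding E_add_left E_add_right E_diff_left E_diff_right by simp
    with E_nonneg[of m "u - v"] B[of m] C[of m] show ?thesis by linarith
  qed
  then show ?thesis by (auto simp: bounded_energy_def)
qed

lemma bounded_energy_scale: "bounded_energy u \<Longrightarrow> bounded_energy (c *\<^sub>R u)"
proof -
  assume "bounded_energy u"
  then obtain B where B: "\<And>m. E m u u \<le> B" by (auto simp: bounded_energy_def)
  have "E m (c *\<^sub>R u) (c *\<^sub>R u) \<le> c\<^sup>2 * B" for m
    unfolding E_scale_left E_scale_right using mult_left_mono[OF B[of m], of "c\<^sup>2"]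
    by (simp add: power2_eq_square mult.assoc)
  then show ?thesis by (auto simp: bounded_energy_def)
qed

lemma bounded_energy_diff: "bounded_energy u \<Longrightarrow> bounded_energy v \<Longrightarrow> bounded_energy (u - v)"
  using bounded_energy_add[of u "(-1) *\<^sub>R v"] bounded_energy_scale[of v "-1"] by simp

lemma W_perturb:
  assumes "\<eta> > 0"
  shows "\<bar>W m u u - W m w w\<bar> \<le> \<eta> * W m w w + (1 + 1 / \<eta>) * W m (u - w) (u - w)"
proof -
  let ?d = "u - w"
  have u: "W m u u = W m w w + 2 * W m w ?d + W m ?d ?d"
    unfolding W_diff_left W_diff_right by (simp add: W_sym[of m w u])
  have *: "\<bar>2 * W m w ?d\<bar> \<le> \<eta> * W m w w + 1 / \<eta> * W m ?d ?d"
  proof -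
    have "0 \<le> \<eta>\<^sup>2 * W m w w + 2 * \<eta> * s * W m w ?d + s\<^sup>2 * W m ?d ?d" for s
    proof -
      have "0 \<le> W m (\<eta> *\<^sub>R w + s *\<^sub>R ?d) (\<eta> *\<^sub>R w + s *\<^sub>R ?d)" by (rule W_nonneg)
      then show ?thesis
        unfolding W_add_left W_add_right W_scale_left W_sym[of m _ "_ *\<^sub>R _"] W_scale_left W_sym[of m ?d w]
        by (simp add: power2_eq_square algebra_simps)
    qed
    from this[of 1] this[of "-1"] have "\<eta> * \<bar>2 * W m w ?d\<bar> \<le> \<eta>\<^sup>2 * W m w w + W m ?d ?d"
      using assms by (cases "0 \<le> W m w ?d") (simp_all add: abs_if)
    then have "\<eta> * \<bar>2 * W m w ?d\<bar> \<le> \<eta> * (\<eta> * W m w w + 1 / \<eta> * W m ?d ?d)"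
      using assms by (simp add: power2_eq_square distrib_left)
    then show ?thesis using assms by (simp only: mult_le_cancel_left_pos)
  qed
  have "\<bar>W m u u - W m w w\<bar> \<le> \<bar>2 * W m w ?d\<bar> + W m ?d ?d"
  proof -
    have "\<bar>a + d\<bar> \<le> \<bar>a\<bar> + d" if "0 \<le> d" for a d :: real
      using that abs_triangle_ineq[of a d] by linarith
    from this[OF W_nonneg[of m ?d], of "2 * W m w ?d"] show ?thesis
      unfolding u by (simp only: add_diff_cancel_left' add.assoc)
  qed
  with * show ?thesis by (simp add: distrib_right)
qed

text \<open>
  Density of the splines: the error \<open>u - spline k u\<close> has energy \<open>En u - E k u u\<close> in the limit, and \<open>W_le\<close> controls its
  influence uniformly in \<open>m\<close>.
\<close>

lemma W_tendsto:
  assumes u: "bounded_energy u"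
  shows "(\<lambda>m. W m u u) \<longlonglongrightarrow> W_const * En u"
proof (rule LIMSEQ_I)
  fix e :: real assume "e > 0"
  define L where "L = En u"
  have L0: "0 \<le> L" using E_nonneg[of 0 u] E_le_En[OF u, of 0] by (simp add: L_def del: E.simps)
  define \<eta> where "\<eta> = e / (4 * (5 * L + 1))"
  have \<eta>: "\<eta> > 0" "\<eta> * (5 * L) < e / 4"
  proof -
    show "\<eta> > 0" using \<open>e > 0\<close> L0 by (simp add: \<eta>_def)
    then have "\<eta> * (5 * L) < \<eta> * (5 * L + 1)" by simp
    also have "\<dots> = e / 4" using L0 by (simp add: \<eta>_def field_simps)
    finally show "\<eta> * (5 * L) < e / 4" .
  qed
  define A where "A = 5 * (1 + 1 / \<eta>) + W_const"
  have A: "A > 0" using \<eta> W_const_ge_1 by (simp add: A_def add_pos_pos)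
  have "\<forall>\<^sub>F k in sequentially. L - e / (4 * A) < E k u u"
    using A \<open>e > 0\<close> by (intro order_tendstoD(1)[OF E_tendsto[OF u]]) (simp add: L_def)
  then obtain k where k: "L - e / (4 * A) < E k u u" by (auto simp: eventually_sequentially)
  define D where "D = L - E k u u"
  have D: "0 \<le> D" "A * D < e / 4"
    using k A E_le_En[OF u, of k] by (auto simp: D_def L_def field_simps)
  let ?w = "spline k u"
  obtain m0 where m0: "\<And>m. m \<ge> m0 \<Longrightarrow> \<bar>W m ?w ?w - W_const * E k u u\<bar> < e / 4"
    using LIMSEQ_D[OF W_spline_tendsto, of "e / 4" k u] \<open>e > 0\<close> by auto
  have "\<bar>W m u u - W_const * L\<bar> < e" if m: "m \<ge> max m0 k" for m
  proof -
    have "k \<le> m" using m by simp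
    then obtain i where i: "m = k + i" using le_Suc_ex by blast
    have "E m ?w ?w = E k u ?w" unfolding i by (rule E_spline)
    also have "\<dots> = E (k + 0) ?w u" by (simp only: E_sym[of k u] add_0_right)
    also have "\<dots> = E k u u" by (rule E_spline)
    finally have Ew: "E m ?w ?w = E k u u" .
    have "W m ?w ?w \<le> 5 * E k u u" using W_le[of m ?w] unfolding Ew .
    also have "\<dots> \<le> 5 * L" using E_le_En[OF u, of k] by (simp add: L_def)
    finally have w: "W m ?w ?w \<le> 5 * L" .
    have "E m (u - ?w) (u - ?w) \<le> D"
      unfolding i E_minus_spline D_def L_def using E_le_En[OF u] by simp
    then have d: "W m (u - ?w) (u - ?w) \<le> 5 * D" using W_le[of m "u - ?w"] by linarith
    have "\<bar>W m u u - W m ?w ?w\<bar> \<le> \<eta> * W m ?w ?w + (1 + 1 / \<eta>) * W m (u - ?w) (u - ?w)"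
      by (rule W_perturb[OF \<eta>(1)])
    also have "\<dots> \<le> \<eta> * (5 * L) + (1 + 1 / \<eta>) * (5 * D)"
      using \<eta>(1) by (intro add_mono mult_left_mono w d) auto
    also have "\<dots> < e / 4 + 5 * (1 + 1 / \<eta>) * D"
    proof -
      have "(1 + 1 / \<eta>) * (5 * D) = 5 * (1 + 1 / \<eta>) * D" by (simp only: mult_ac)
      with \<eta>(2) show ?thesis by linarith
    qed
    finally have 1: "\<bar>W m u u - W m ?w ?w\<bar> < e / 4 + 5 * (1 + 1 / \<eta>) * D" .
    have 2: "W_const * L - W_const * E k u u = W_const * D" by (simp add: D_def algebra_simps)
    have 3: "5 * (1 + 1 / \<eta>) * D + W_const * D = A * D" by (simp add: A_def distrib_right)
    have 4: "\<bar>W m ?w ?w - W_const * E k u u\<bar> < e / 4" using m0 m by simp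
    have 5: "0 \<le> W_const * D" using W_const_ge_1 D by simp
    show ?thesis using 1 2 3 4 5 D(2) \<open>e > 0\<close> unfolding abs_less_iff by linarith
  qed
  then show "\<exists>m0. \<forall>m\<ge>m0. norm (W m u u - W_const * En u) < e"
    unfolding L_def real_norm_def by blast
qed

lemma energy_form_tendsto:
  assumes "bounded_energy u" "bounded_energy v"
  shows "(\<lambda>m. W m u v) \<longlonglongrightarrow> energy_form N p u v"
proof -
  have eq: "W m u v = (W m (u + v) (u + v) - W m (u - v) (u - v)) / 4" for m
    unfolding W_add_left W_add_right W_diff_left W_diff_right by (simp add: W_sym[of m v u])
  have "(\<lambda>m. W m u v) \<longlonglongrightarrow> (W_const * En (u + v) - W_const * En (u - v)) / 4"
    unfolding eq using assms by (intro tendsto_intros W_tendsto bounded_energy_add bounded_energy_diff) auto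
  then show ?thesis unfolding energy_form_def by (metis limI)
qed

lemma energy_form_self: "bounded_energy u \<Longrightarrow> energy_form N p u u = W_const * En u"
  using LIMSEQ_unique[OF energy_form_tendsto W_tendsto] by blast

text \<open>
  If the energies \<open>E m u u\<close> are unbounded, they increase to infinity, and \<open>W m u u\<close> dominates them. So the
  limit in the definition of the energy exists in either case.
\<close>

lemma energy_finite_iff: "energy N p u < \<infinity> \<longleftrightarrow> bounded_energy u"
proof
  assume u: "bounded_energy u"
  have "(\<lambda>m. ereal (W m u u)) \<longlonglongrightarrow> ereal (W_const * En u)"
    by (intro tendsto_ereal W_tendsto u)
  then have "energy N p u = ereal (W_const * En u)"
    unfolding energy_def by (rule limI)
  then show "energy N p u < \<infinity>" by simp
next
  assume fin: "energy N p u < \<infinity>"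
  show "bounded_energy u"
  proof (rule ccontr)
    assume nb: "\<not> bounded_energy u"
    have "(\<lambda>m. ereal (W m u u)) \<longlonglongrightarrow> \<infinity>"
      unfolding tendsto_PInfty
    proof
      fix r
      obtain k where k: "r < E k u u" using nb by (auto simp: bounded_energy_def not_le)
      have "ereal r < ereal (W m u u)" if "m \<ge> k" for m
        using k E_mono[OF that, of u] W_ge_E[of m u] by simp
      then show "\<forall>\<^sub>F m in sequentially. ereal r < ereal (W m u u)"
        by (auto simp: eventually_sequentially)
    qed
    then have "energy N p u = \<infinity>" unfolding energy_def by (rule limI)
    with fin show False by simp
  qed
qed

lemma H01_iff: "u \<in> H01 N p \<longleftrightarrow> continuous_on V u \<and> (\<forall>i\<in>I. u (p i) = 0) \<and> bounded_energy u"
  unfolding H01_def energy_finite_iff boundary_eq by auto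

section \<open>Energy controls oscillation\<close>

text \<open>
  The sum of the geometric series in \<open>sqrt \<gamma>\<close>: a vertex of level \<open>n\<close> is joined to a corner of the simplex by
  a chain of corners of smaller and smaller cells, and a cell of level \<open>k\<close> carries at most the share \<open>\<gamma> ^ k\<close> of
  the energy.
\<close>

definition osc_const :: real where "osc_const = 1 / (1 - sqrt \<gamma>)"

lemma osc_const: "osc_const \<ge> 1" "osc_const * sqrt \<gamma> + 1 = osc_const"
proof -
  have s: "0 \<le> sqrt \<gamma>" "sqrt \<gamma> < 1" using ren_gamma by auto
  then show "osc_const \<ge> 1" by (simp add: osc_const_def)
  show "osc_const * sqrt \<gamma> + 1 = osc_const"
    using s by (simp add: osc_const_def field_simps)
qed

lemma E_cell:
  assumes "\<And>m. E m u u \<le> e" "i \<in> I"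
  shows "E m (u \<circ> S i) (u \<circ> S i) \<le> \<gamma> * e"
proof -
  have "E m (u \<circ> S i) (u \<circ> S i) \<le> (\<Sum>i\<in>I. E m (u \<circ> S i) (u \<circ> S i))"
    using assms by (intro member_le_sum[of i I "\<lambda>i. E m (u \<circ> S i) (u \<circ> S i)"] E_nonneg) auto
  also have "\<dots> = \<gamma> * E (Suc m) u u"
    using ren_gamma(5) by (simp only: E.simps mult.assoc[symmetric] mult_1_left)
  also have "\<dots> \<le> \<gamma> * e" by (intro mult_left_mono assms(1)) (use ren_gamma in simp)
  finally show ?thesis .
qed

lemma osc_corners:
  assumes "\<And>m. E m u u \<le> e" "i \<in> I" "j \<in> I"
  shows "\<bar>u (p i) - u (p j)\<bar> \<le> sqrt e"
proof (rule real_le_rsqrt)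
  let ?a = "\<lambda>i j. (u (p i) - u (p j)) * (u (p i) - u (p j))"
  have "?a i j \<le> (\<Sum>j\<in>I. ?a i j)"
    using assms by (intro member_le_sum[of j I "?a i"]) auto
  also have "\<dots> \<le> (\<Sum>i\<in>I. \<Sum>j\<in>I. ?a i j)"
    using assms by (intro member_le_sum[of i I "\<lambda>i. \<Sum>j\<in>I. ?a i j"] sum_nonneg) auto
  also have "\<dots> \<le> e" using assms(1)[of 0] by simp
  finally show "\<bar>u (p i) - u (p j)\<bar>\<^sup>2 \<le> e" by (simp add: power2_eq_square)
qed

lemma osc_Vs:
  assumes "\<And>m. E m u u \<le> e" "y \<in> Vs n" "j \<in> I"
  shows "\<bar>u y - u (p j)\<bar> \<le> osc_const * sqrt e"
  using assms
proof (induction n arbitrary: u e y j)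
  case 0
  then obtain i where i: "i \<in> I" "y = p i" by (auto simp: Vs_0)
  have "0 \<le> e" using 0(1)[of 0] E_nonneg[of 0 u] by linarith
  then have "sqrt e \<le> osc_const * sqrt e" using osc_const by (simp add: mult_le_cancel_right1)
  then show ?case using osc_corners[OF 0(1) i(1) 0(3)] i by simp
next
  case (Suc n)
  then obtain i z where i: "i \<in> I" "z \<in> Vs n" "y = S i z" by (auto simp: Vs_Suc)
  have "\<bar>(u \<circ> S i) z - (u \<circ> S i) (p i)\<bar> \<le> osc_const * sqrt (\<gamma> * e)"
    by (rule Suc.IH[OF E_cell[OF Suc.prems(1) i(1)] i(2,1)])
  then have "\<bar>u y - u (p i)\<bar> \<le> osc_const * sqrt \<gamma> * sqrt e"
    by (simp add: i S_p real_sqrt_mult)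
  moreover have "\<bar>u (p i) - u (p j)\<bar> \<le> 1 * sqrt e"
    using osc_corners[OF Suc.prems(1) i(1) Suc.prems(3)] by simp
  ultimately have "\<bar>u y - u (p j)\<bar> \<le> osc_const * sqrt \<gamma> * sqrt e + 1 * sqrt e" by linarith
  then show ?case unfolding distrib_right[symmetric] osc_const(2) .
qed

lemma osc_V:
  assumes "continuous_on V u" "\<And>m. E m u u \<le> e" "y \<in> V" "j \<in> I"
  shows "\<bar>u y - u (p j)\<bar> \<le> osc_const * sqrt e"
proof -
  have "norm (u y - u (p j)) \<le> osc_const * sqrt e"
  proof (rule continuous_on_closure_norm_le[of Vstar "\<lambda>y. u y - u (p j)"])
    show "continuous_on (closure Vstar) (\<lambda>y. u y - u (p j))"
      using assms(1) unfolding gasket_eq_closure[symmetric] by (intro continuous_intros)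
    show "\<forall>y\<in>Vstar. norm (u y - u (p j)) \<le> osc_const * sqrt e"
      using osc_Vs[OF assms(2)] assms(4) by (auto simp: Vstar_def)
    show "y \<in> closure Vstar" using assms(3) by (simp add: gasket_eq_closure)
  qed
  then show ?thesis by simp
qed

lemma continuous_cell: "continuous_on V u \<Longrightarrow> i \<in> I \<Longrightarrow> continuous_on V (u \<circ> S i)"
  by (rule continuous_on_compose[OF continuous_S], rule continuous_on_subset) (auto simp: S_in_V)

lemma near_corner_estimate:
  assumes "continuous_on V u" "\<And>m. E m u u \<le> e" "x \<in> V" "j \<in> I" "1 - 1 / 2 ^ n < bary j x"
  shows "\<bar>u x - u (p j)\<bar> \<le> osc_const * sqrt (\<gamma> ^ n * e)"
  using assms
proof (induction n arbitrary: u e x)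
  case 0
  then show ?case using osc_V by simp
next
  case (Suc n)
  have "(1::real) / 2 ^ Suc n \<le> 1 / 2" by (simp add: field_simps)
  then have "1 / 2 < bary j x" using Suc.prems(5) by linarith
  then obtain y where y: "y \<in> V" "x = S j y" using V_near_corner Suc.prems(3,4) by blast
  have "bary j x = (bary j y + 1) / 2" using Suc.prems(4) by (simp add: y bary_S)
  with Suc.prems(5) have b: "1 - 1 / 2 ^ n < bary j y" by (simp add: field_simps)
  have "\<bar>(u \<circ> S j) y - (u \<circ> S j) (p j)\<bar> \<le> osc_const * sqrt (\<gamma> ^ n * (\<gamma> * e))"
    by (rule Suc.IH[OF continuous_cell[OF Suc.prems(1,4)] E_cell[OF Suc.prems(2,4)] y(1) Suc.prems(4) b])
  then show ?case by (simp add: y S_p mult_ac)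
qed

text \<open>
  Two close points lie either in a common cell of level \<open>1\<close>, where rescaling allows induction, or in two cells
  that meet, and then both are near the junction. The second case uses \<open>near_corner_estimate\<close>
  instead of the induction hypothesis, so the constant does not grow with \<open>n\<close>.
\<close>

lemma modulus_of_continuity:
  assumes "continuous_on V u" "\<And>m. E m u u \<le> e" "x \<in> V" "y \<in> V" "norm (x - y) < 1 / 2 ^ (n + 2)"
  shows "\<bar>u x - u y\<bar> \<le> 2 * osc_const * sqrt (\<gamma> ^ n * e)"
  using assms
proof (induction n arbitrary: u e x y)
  case 0
  show ?case
    using osc_V[OF 0(1,2) 0(3) N_pos(2)] osc_V[OF 0(1,2) 0(4) N_pos(2)] by simp
next
  case (Suc n)
  obtain i x' where i: "i \<in> I" "x' \<in> V" "x = S i x'" using V_cases Suc.prems by blast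
  obtain j y' where j: "j \<in> I" "y' \<in> V" "y = S j y'" using V_cases Suc.prems by blast
  show ?case
  proof (cases "i = j")
    case True
    have "norm (x' - y') = 2 * norm (x - y)"
      using norm_S_diff[of i x' y'] True i j by simp
    with Suc.prems(5) have n: "norm (x' - y') < 1 / 2 ^ (n + 2)"
      by (simp add: field_simps)
    have "\<bar>(u \<circ> S i) x' - (u \<circ> S i) y'\<bar> \<le> 2 * osc_const * sqrt (\<gamma> ^ n * (\<gamma> * e))"
      by (rule Suc.IH[OF continuous_cell[OF Suc.prems(1) i(1)] E_cell[OF Suc.prems(2) i(1)] i(2) j(2) n])
    then show ?thesis using True i j by (simp add: mult_ac)
  next
    case False
    define q :: real where "q = 1 / 2 ^ n"
    have d: "norm (x - y) < q / 8" using Suc.prems(5) by (simp add: q_def field_simps)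
    have "1 / 2 \<le> bary i x" "1 / 2 \<le> bary j y" using bary_S_ge i j by auto
    moreover have "bary j y - bary j x \<le> 2 * norm (x - y)" "bary i x - bary i y \<le> 2 * norm (x - y)"
      using bary_lipschitz[OF j(1), of x y] bary_lipschitz[OF i(1), of x y] by auto
    moreover have "bary j x = bary j x' / 2" "bary i y = bary i y' / 2"
      using False i j by (auto simp: bary_S)
    moreover have "0 < q" by (simp add: q_def)
    ultimately have "1 - q < bary j x' \<and> 1 - q < bary i y'"
      using d by linarith
    then have "\<bar>(u \<circ> S i) x' - (u \<circ> S i) (p j)\<bar> \<le> osc_const * sqrt (\<gamma> ^ n * (\<gamma> * e))"
       "\<bar>(u \<circ> S j) y' - (u \<circ> S j) (p i)\<bar> \<le> osc_const * sqrt (\<gamma> ^ n * (\<gamma> * e))"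
      using near_corner_estimate[OF continuous_cell[OF Suc.prems(1) i(1)] E_cell[OF Suc.prems(2) i(1)] i(2) j(1)]
        near_corner_estimate[OF continuous_cell[OF Suc.prems(1) j(1)] E_cell[OF Suc.prems(2) j(1)] j(2) i(1)]
      unfolding q_def by auto
    then show ?thesis using i j S_p_sym[of i j] by (simp add: mult_ac)
  qed
qed

section \<open>The Hilbert space of functions of finite energy\<close>

lemma E_tendsto_pointwise:
  assumes "\<And>x. x \<in> V \<Longrightarrow> (\<lambda>k. U k x) \<longlonglongrightarrow> u x"
  shows "(\<lambda>k. E m (U k) (U k)) \<longlonglongrightarrow> E m u u"
  using assms
proof (induction m arbitrary: U u)
  case 0
  then show ?case unfolding E.simps by (intro tendsto_intros) (auto simp: p_in_V)
next
  case (Suc m)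
  have "(\<lambda>k. E m (U k \<circ> S i) (U k \<circ> S i)) \<longlonglongrightarrow> E m (u \<circ> S i) (u \<circ> S i)" if "i \<in> I" for i
    by (rule Suc.IH) (use Suc.prems that S_in_V in auto)
  then show ?case unfolding E.simps by (intro tendsto_intros) auto
qed

lemma H01_sup_bound:
  assumes "u \<in> H01 N p" "x \<in> V"
  shows "\<bar>u x\<bar> \<le> osc_const * sqrt (energy_form N p u u)"
proof -
  have u: "continuous_on V u" "u (p 1) = 0" "bounded_energy u" using assms N_pos by (auto simp: H01_iff)
  have En0: "0 \<le> En u" using E_le_En[OF u(3), of 0] E_nonneg[of 0 u] by linarith
  have "En u \<le> W_const * En u"
    using mult_right_mono[OF W_const_ge_1 En0] by simp
  then have "sqrt (En u) \<le> sqrt (energy_form N p u u)"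
    by (simp add: energy_form_self[OF u(3)])
  then have "osc_const * sqrt (En u) \<le> osc_const * sqrt (energy_form N p u u)"
    using osc_const(1) by (intro mult_left_mono) auto
  with osc_V[OF u(1) E_le_En[OF u(3)] assms(2) N_pos(2)] u(2) show ?thesis by simp
qed

lemma H01_subspace: "subspace (H01 N p)"
proof (rule subspaceI)
  have "E m 0 0 = 0" for m using E_scale_left[of m 0 0 0] by simp
  then have "bounded_energy 0" by (auto simp: bounded_energy_def)
  moreover have "continuous_on V 0" by (simp add: zero_fun_def)
  ultimately show "0 \<in> H01 N p" by (simp add: H01_iff)
next
  fix u v assume "u \<in> H01 N p" "v \<in> H01 N p"
  moreover from this have "continuous_on V (u + v)"
    unfolding plus_fun_def H01_iff by (intro continuous_intros) auto
  ultimately show "u + v \<in> H01 N p" by (simp add: H01_iff bounded_energy_add)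
next
  fix c u assume "u \<in> H01 N p"
  moreover from this have "continuous_on V (c *\<^sub>R u)"
    unfolding scaleR_fun_def H01_iff by (intro continuous_intros) auto
  ultimately show "c *\<^sub>R u \<in> H01 N p" by (simp add: H01_iff bounded_energy_scale)
qed

text \<open>
  A Cauchy sequence in energy converges uniformly. Each \<open>E m\<close> is a finite sum and passes to the
  pointwise limit, which carries over the Cauchy estimate to the differences \<open>X n - u\<close>.
\<close>

lemma H01_limit:
  assumes X: "\<And>n. X n \<in> H01 N p"
    and C: "\<And>e. e > 0 \<Longrightarrow> \<exists>n0. \<forall>m\<ge>n0. \<forall>n\<ge>n0. sqrt (energy_form N p (X m - X n) (X m - X n)) < e"
  shows "\<exists>x\<in>H01 N p. (\<lambda>n. sqrt (energy_form N p (X n - x) (X n - x))) \<longlonglongrightarrow> 0"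
proof -
  have XX: "X m - X n \<in> H01 N p" for m n using X H01_subspace subspace_diff by blast
  have oc: "osc_const > 0" using osc_const(1) by linarith
  have "uniformly_Cauchy_on V X"
    unfolding uniformly_Cauchy_on_def
  proof (intro allI impI)
    fix e :: real assume "e > 0"
    then obtain n0 where n0: "\<And>m n. m \<ge> n0 \<Longrightarrow> n \<ge> n0 \<Longrightarrow> sqrt (energy_form N p (X m - X n) (X m - X n)) < e / osc_const"
      using C[of "e / osc_const"] oc by auto
    have "dist (X m x) (X n x) < e" if "m \<ge> n0" "n \<ge> n0" "x \<in> V" for m n x
    proof -
      have "\<bar>X m x - X n x\<bar> \<le> osc_const * sqrt (energy_form N p (X m - X n) (X m - X n))"
        using H01_sup_bound[OF XX that(3), of m n] by simp
      also have "\<dots> < e" using n0[OF that(1,2)] oc by (simp add: field_simps)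
      finally show ?thesis by (simp add: dist_real_def)
    qed
    then show "\<exists>n0. \<forall>x\<in>V. \<forall>m\<ge>n0. \<forall>n\<ge>n0. dist (X m x) (X n x) < e" by blast
  qed
  then obtain u where u: "uniform_limit V X u sequentially"
    using Cauchy_uniformly_convergent uniformly_convergent_on_def by blast
  have lim: "(\<lambda>n. X n x) \<longlonglongrightarrow> u x" if "x \<in> V" for x
    by (rule tendsto_uniform_limitI[OF u that])
  have cont: "continuous_on V u"
    by (rule uniform_limit_theorem[OF _ u]) (use X in \<open>auto simp: H01_iff\<close>)
  have zero: "u (p i) = 0" if "i \<in> I" for i
  proof -
    have "(\<lambda>n. 0) \<longlonglongrightarrow> u (p i)" using lim[OF p_in_V[OF that]] X that by (simp add: H01_iff)
    then show ?thesis by (simp add: LIMSEQ_const_iff)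
  qed
  have small: "E m (X n - u) (X n - u) \<le> e\<^sup>2"
    if n0: "\<And>m n. m \<ge> n0 \<Longrightarrow> n \<ge> n0 \<Longrightarrow> sqrt (energy_form N p (X m - X n) (X m - X n)) < e" and "n \<ge> n0" for n0 n e m
  proof (rule LIMSEQ_le_const2)
    show "(\<lambda>k. E m (X n - X k) (X n - X k)) \<longlonglongrightarrow> E m (X n - u) (X n - u)"
      by (rule E_tendsto_pointwise) (auto intro!: tendsto_intros lim)
    have "E m (X n - X k) (X n - X k) \<le> e\<^sup>2" if "k \<ge> n0" for k
    proof -
      let ?d = "X n - X k"
      have be: "bounded_energy ?d" using XX by (simp add: H01_iff)
      have "0 \<le> En ?d" using E_le_En[OF be, of 0] E_nonneg[of 0 ?d] by linarith
      then have "En ?d \<le> energy_form N p ?d ?d"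
        using mult_right_mono[OF W_const_ge_1, of "En ?d"] by (simp add: energy_form_self[OF be])
      moreover have "energy_form N p ?d ?d \<le> e\<^sup>2"
      proof -
        have s: "sqrt (energy_form N p ?d ?d) < e" using n0[OF \<open>n \<ge> n0\<close> that] .
        have "0 \<le> energy_form N p ?d ?d" using \<open>0 \<le> En ?d\<close> W_const_ge_1 by (simp add: energy_form_self[OF be])
        then show ?thesis using s by (metis less_imp_le real_sqrt_ge_zero real_sqrt_pow2 power_mono)
      qed
      ultimately show ?thesis using E_le_En[OF be, of m] by linarith
    qed
    then show "\<exists>N. \<forall>k\<ge>N. E m (X n - X k) (X n - X k) \<le> e\<^sup>2" by blast
  qed
  have be: "bounded_energy (X n - u)" if "\<And>m n. m \<ge> n0 \<Longrightarrow> n \<ge> n0 \<Longrightarrow> sqrt (energy_form N p (X m - X n) (X m - X n)) < e" and "n \<ge> n0" for n0 n e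
    using small[OF that] unfolding bounded_energy_def by blast
  obtain n1 where n1: "\<And>m n. m \<ge> n1 \<Longrightarrow> n \<ge> n1 \<Longrightarrow> sqrt (energy_form N p (X m - X n) (X m - X n)) < 1"
    using C[of 1] by auto
  have "bounded_energy (X n1 - (X n1 - u))"
    by (rule bounded_energy_diff[OF _ be[OF n1]]) (use X in \<open>auto simp: H01_iff\<close>)
  then have "bounded_energy u" by simp
  then have uH: "u \<in> H01 N p" using cont zero by (simp add: H01_iff)
  have "(\<lambda>n. sqrt (energy_form N p (X n - u) (X n - u))) \<longlonglongrightarrow> 0"
  proof (rule LIMSEQ_I)
    fix r :: real assume "r > 0"
    define e where "e = r / (2 * sqrt W_const)"
    have W0: "sqrt W_const > 0" using W_const_ge_1 by simp
    have e: "e > 0" "sqrt W_const * e < r" using \<open>r > 0\<close> W0 by (auto simp: e_def)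
    obtain n0 where n0: "\<And>m n. m \<ge> n0 \<Longrightarrow> n \<ge> n0 \<Longrightarrow> sqrt (energy_form N p (X m - X n) (X m - X n)) < e"
      using C[OF e(1)] by auto
    have "norm (sqrt (energy_form N p (X n - u) (X n - u)) - 0) < r" if "n \<ge> n0" for n
    proof -
      let ?d = "X n - u"
      have b: "bounded_energy ?d" by (rule be[OF n0 that])
      have "En ?d \<le> e\<^sup>2" by (rule En_le) (rule small[OF n0 that])
      then have "energy_form N p ?d ?d \<le> W_const * e\<^sup>2"
        using W_const_ge_1 by (simp add: energy_form_self[OF b] mult_left_mono)
      then have "sqrt (energy_form N p ?d ?d) \<le> sqrt W_const * e"
        using e(1) by (metis real_sqrt_le_mono real_sqrt_mult real_sqrt_abs abs_of_pos)
      moreover have "0 \<le> energy_form N p ?d ?d"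
        using E_le_En[OF b, of 0] E_nonneg[of 0 ?d] W_const_ge_1 by (simp add: energy_form_self[OF b] del: E.simps)
      ultimately show ?thesis using e(2) by simp
    qed
    then show "\<exists>no. \<forall>n\<ge>no. norm (sqrt (energy_form N p (X n - u) (X n - u)) - 0) < r" by blast
  qed
  with uH show ?thesis by blast
qed

sublocale hilbert_seminorm "H01 N p" "energy_form N p"
proof
  show "subspace (H01 N p)" by (rule H01_subspace)
next
  fix u v w assume H: "u \<in> H01 N p" "v \<in> H01 N p" "w \<in> H01 N p"
  then have b: "bounded_energy u" "bounded_energy v" "bounded_energy w" by (auto simp: H01_iff)
  have "(\<lambda>m. W m (u + v) w) \<longlonglongrightarrow> energy_form N p u w + energy_form N p v w"
    unfolding W_add_left by (intro tendsto_intros energy_form_tendsto b)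
  then show "energy_form N p (u + v) w = energy_form N p u w + energy_form N p v w"
    using LIMSEQ_unique energy_form_tendsto[OF bounded_energy_add[OF b(1,2)] b(3)] by blast
next
  fix c u w assume H: "u \<in> H01 N p" "w \<in> H01 N p"
  then have b: "bounded_energy u" "bounded_energy w" by (auto simp: H01_iff)
  have "(\<lambda>m. W m (c *\<^sub>R u) w) \<longlonglongrightarrow> c * energy_form N p u w"
    unfolding W_scale_left by (intro tendsto_intros energy_form_tendsto b)
  then show "energy_form N p (c *\<^sub>R u) w = c * energy_form N p u w"
    using LIMSEQ_unique energy_form_tendsto[OF bounded_energy_scale[OF b(1)] b(2)] by blast
next
  fix u v assume H: "u \<in> H01 N p" "v \<in> H01 N p"
  then have b: "bounded_energy u" "bounded_energy v" by (auto simp: H01_iff)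
  show "energy_form N p u v = energy_form N p v u"
    unfolding energy_form_def by (simp add: W_sym)
next
  fix u assume "u \<in> H01 N p"
  then have b: "bounded_energy u" by (auto simp: H01_iff)
  show "0 \<le> energy_form N p u u"
    by (rule LIMSEQ_le_const[OF energy_form_tendsto[OF b b]]) (use W_nonneg in blast)
qed (use H01_limit in blast)

lemma sup_bound: "u \<in> H01 N p \<Longrightarrow> x \<in> V \<Longrightarrow> \<bar>u x\<bar> \<le> osc_const * nrm u"
  using H01_sup_bound by (simp add: nrm_def)

text \<open>
  The compact embedding into the continuous functions, by the theorem of Arzela and Ascoli.
\<close>

lemma bounded_sequence_subseq:
  assumes X: "\<And>n. X n \<in> H01 N p" and R: "\<And>n. nrm (X n) \<le> R"
  obtains g k where "continuous_on V g" "strict_mono (k :: nat \<Rightarrow> nat)" "uniform_limit V (X \<circ> k) g sequentially"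
proof -
  have R0: "0 \<le> R" using R[of 0] nrm_nonneg[OF X, of 0] by linarith
  have Eb: "E m (X n) (X n) \<le> R\<^sup>2" for m n
  proof -
    have b: "bounded_energy (X n)" using X by (simp add: H01_iff)
    have En0: "0 \<le> En (X n)" using E_le_En[OF b, of 0] E_nonneg[of 0 "X n"] by linarith
    have "E m (X n) (X n) \<le> En (X n)" by (rule E_le_En[OF b])
    also have "\<dots> \<le> W_const * En (X n)" using mult_right_mono[OF W_const_ge_1 En0] by simp
    also have "\<dots> = (nrm (X n))\<^sup>2" using nrm_sq[OF X] energy_form_self[OF b] by simp
    also have "\<dots> \<le> R\<^sup>2" using R[of n] nrm_nonneg[OF X] by (intro power_mono) auto
    finally show ?thesis .
  qed
  have cont: "continuous_on V (X n)" for n using X by (simp add: H01_iff)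
  show thesis
  proof (rule Arzela_Ascoli[OF compact_V, of X "osc_const * R"])
    show "norm (X n x) \<le> osc_const * R" if "x \<in> V" for n x
    proof -
      have "norm (X n x) \<le> osc_const * nrm (X n)" using sup_bound[OF X that, of n] by simp
      also have "\<dots> \<le> osc_const * R" by (intro mult_left_mono R) (use osc_const(1) in simp)
      finally show ?thesis .
    qed
  next
    fix x :: 'a and e :: real assume x: "x \<in> V" and "e > 0"
    have "(\<lambda>n. 2 * osc_const * sqrt (\<gamma> ^ n * R\<^sup>2)) \<longlonglongrightarrow> 2 * osc_const * sqrt (0 * R\<^sup>2)"
      using ren_gamma by (intro tendsto_intros LIMSEQ_power_zero) auto
    then have "\<forall>\<^sub>F n in sequentially. 2 * osc_const * sqrt (\<gamma> ^ n * R\<^sup>2) < e"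
      using \<open>e > 0\<close> by (intro order_tendstoD(2)) auto
    then obtain m where m: "2 * osc_const * sqrt (\<gamma> ^ m * R\<^sup>2) < e" by (auto simp: eventually_sequentially)
    have "norm (X n x - X n y) < e" if "y \<in> V" "norm (x - y) < 1 / 2 ^ (m + 2)" for n y
      unfolding real_norm_def using le_less_trans[OF modulus_of_continuity[OF cont Eb x that] m] .
    then show "\<exists>d. 0 < d \<and> (\<forall>n y. y \<in> V \<and> norm (x - y) < d \<longrightarrow> norm (X n x - X n y) < e)"
      by (intro exI[of _ "1 / 2 ^ (m + 2)"]) auto
  next
    fix g k assume g: "continuous_on V g" "strict_mono (k :: nat \<Rightarrow> nat)"
      "\<And>e. 0 < e \<Longrightarrow> \<exists>N. \<forall>n x. n \<ge> N \<and> x \<in> V \<longrightarrow> norm (X (k n) x - g x) < e"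
    have "uniform_limit V (X \<circ> k) g sequentially"
      unfolding uniform_limit_sequentially_iff dist_norm comp_def using g(3) by blast
    with g show thesis using that by blast
  qed
qed

text \<open>
  The spline of level \<open>1\<close> with value \<open>1\<close> at the midpoints and \<open>0\<close> at the corners.
\<close>

lemma H01_nontrivial: "\<exists>e\<in>H01 N p. \<exists>y\<in>V. e y \<noteq> 0"
proof -
  define \<phi> where "\<phi> x = (if x \<in> p ` I then 0 else 1 :: real)" for x
  define e where "e = spline 1 \<phi>"
  define q where "q = S 1 (p 2)"
  have "E m e e \<le> E 1 \<phi> \<phi>" for m
  proof -
    have "E m e e \<le> E (1 + m) e e" by (rule E_mono) simp
    also have "\<dots> = E 1 \<phi> e" unfolding e_def by (rule E_spline)
    also have "\<dots> = E (1 + 0) e \<phi>" by (simp only: E_sym[of 1 \<phi>] add_0_right)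
    also have "\<dots> = E 1 \<phi> \<phi>" unfolding e_def by (rule E_spline)
    finally show ?thesis .
  qed
  then have "bounded_energy e" by (auto simp: bounded_energy_def)
  moreover have "continuous_on V e" unfolding e_def by (rule continuous_spline)
  moreover have "e (p i) = 0" if "i \<in> I" for i
    unfolding e_def spline_p[OF that] using that by (simp add: \<phi>_def)
  ultimately have "e \<in> H01 N p" by (simp add: H01_iff)
  moreover have "q \<in> V" unfolding q_def by (intro S_in_V p_in_V N_pos)
  moreover have "e q = 1"
  proof -
    have "e q = spline 0 (\<phi> \<circ> S 1) (p 2)"
      unfolding e_def q_def One_nat_def by (rule spline_S[unfolded One_nat_def]) (use p_in_V N_pos in auto)
    also have "\<dots> = \<phi> q" using spline_p[OF N_pos(3), of 0 "\<phi> \<circ> S 1"] by (simp add: q_def)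
    also have "q \<notin> p ` I"
    proof
      assume "q \<in> p ` I"
      then obtain j where j: "j \<in> I" "q = p j" by auto
      have "bary 1 q = 1 / 2" using N_pos by (simp add: q_def bary_S bary_p)
      moreover have "bary 1 q = (if 1 = j then 1 else 0)" using j N_pos by (simp add: bary_p)
      ultimately show False by (auto split: if_splits)
    qed
    then have "\<phi> q = 1" by (simp add: \<phi>_def)
    finally show ?thesis .
  qed
  ultimately show ?thesis by (intro bexI[of _ e] bexI[of _ q]) auto
qed

end

section \<open>The Ambrosetti-Rabinowitz condition\<close>

locale ambrosetti_rabinowitz =
  fixes f F :: "real \<Rightarrow> real" and \<theta> :: real
  assumes cont_f: "continuous_on UNIV f"
    and F_deriv: "\<And>t. (F has_real_derivative f t) (at t)"
    and F_0: "F 0 = 0"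
    and theta: "2 < \<theta>"
    and AR: "\<And>t. t \<noteq> 0 \<Longrightarrow> 0 < F t \<and> \<theta> * F t \<le> t * f t"
begin

lemma F_nonneg: "0 \<le> F t"
  using AR[of t] F_0 by (cases "t = 0") auto

lemma AR': "\<theta> * F t \<le> t * f t"
  using AR[of t] F_0 by (cases "t = 0") auto

lemma cont_F: "continuous_on A F"
  by (meson F_deriv DERIV_isCont continuous_at_imp_continuous_on)

text \<open>
  The Ambrosetti-Rabinowitz inequality says that \<open>F (\<sigma> * r) * r powr - \<theta>\<close> is nondecreasing in \<open>r > 0\<close>
  for either sign \<open>\<sigma>\<close>.
\<close>

lemma F_ratio_mono:
  assumes "\<sigma> = 1 \<or> \<sigma> = - 1" "0 < s" "s \<le> t"
  shows "F (\<sigma> * s) * t powr \<theta> \<le> F (\<sigma> * t) * s powr \<theta>"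
proof -
  have "F (\<sigma> * s) * s powr - \<theta> \<le> F (\<sigma> * t) * t powr - \<theta>"
  proof (rule DERIV_nonneg_imp_nondecreasing[OF assms(3)])
    fix r assume r: "s \<le> r" "r \<le> t"
    then have "0 < r" using assms by simp
    have D: "((\<lambda>r. F (\<sigma> * r) * r powr - \<theta>) has_real_derivative
        f (\<sigma> * r) * \<sigma> * r powr - \<theta> + - \<theta> * r powr (- \<theta> - 1) * F (\<sigma> * r)) (at r)"
      using \<open>0 < r\<close>
      by (auto intro!: derivative_eq_intros DERIV_chain2[OF F_deriv] simp: field_simps)
    have "r powr - \<theta> = r * r powr (- \<theta> - 1)"
      using \<open>0 < r\<close> by (simp add: powr_diff)
    then have "f (\<sigma> * r) * \<sigma> * r powr - \<theta> + - \<theta> * r powr (- \<theta> - 1) * F (\<sigma> * r)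
        = r powr (- \<theta> - 1) * ((\<sigma> * r) * f (\<sigma> * r) - \<theta> * F (\<sigma> * r))"
      by (simp add: algebra_simps)
    also have "\<dots> \<ge> 0" using AR'[of "\<sigma> * r"] by simp
    finally show "\<exists>y. ((\<lambda>r. F (\<sigma> * r) * r powr - \<theta>) has_real_derivative y) (at r) \<and> 0 \<le> y"
      using D by blast
  qed
  then have "F (\<sigma> * s) * s powr - \<theta> * (s powr \<theta> * t powr \<theta>) \<le> F (\<sigma> * t) * t powr - \<theta> * (s powr \<theta> * t powr \<theta>)"
    by (intro mult_right_mono) auto
  then show ?thesis
    using assms by (simp add: powr_minus field_simps)
qed

lemma F_small:
  assumes "0 < \<eta>" shows "\<exists>r>0. \<forall>t. \<bar>t\<bar> \<le> r \<longrightarrow> F t \<le> \<eta> * t\<^sup>2"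
proof -
  define C where "C = max (F 1) (F (- 1))"
  have C: "0 < C" using AR[of 1] by (simp add: C_def less_max_iff_disj)
  define r where "r = min 1 ((\<eta> / C) powr (1 / (\<theta> - 2)))"
  have r: "0 < r" "r \<le> 1" using C assms by (auto simp: r_def)
  have Cr: "C * r powr (\<theta> - 2) \<le> \<eta>"
  proof -
    have "r powr (\<theta> - 2) \<le> ((\<eta> / C) powr (1 / (\<theta> - 2))) powr (\<theta> - 2)"
      using r theta by (intro powr_mono2) (auto simp: r_def)
    also have "\<dots> = \<eta> / C" using theta C assms by (simp add: powr_powr)
    finally show ?thesis using C by (simp add: field_simps)
  qed
  have "F t \<le> \<eta> * t\<^sup>2" if t: "\<bar>t\<bar> \<le> r" for t
  proof (cases "t = 0")
    case False
    define \<sigma> where "\<sigma> = sgn t"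
    have \<sigma>: "\<sigma> = 1 \<or> \<sigma> = - 1" "\<sigma> * \<bar>t\<bar> = t" using False by (auto simp: \<sigma>_def sgn_real_def)
    have "F t \<le> F \<sigma> * \<bar>t\<bar> powr \<theta>"
      using F_ratio_mono[OF \<sigma>(1), of "\<bar>t\<bar>" 1] False t r \<sigma>(2) by simp
    also have "\<dots> \<le> C * \<bar>t\<bar> powr \<theta>"
      using \<sigma>(1) by (intro mult_right_mono) (auto simp: C_def)
    also have "\<bar>t\<bar> powr \<theta> = \<bar>t\<bar> powr (\<theta> - 2) * t\<^sup>2"
      using powr_add[of "\<bar>t\<bar>" "\<theta> - 2" 2] False by simp
    also have "C * (\<bar>t\<bar> powr (\<theta> - 2) * t\<^sup>2) \<le> C * (r powr (\<theta> - 2) * t\<^sup>2)"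
      using t theta C by (intro mult_left_mono mult_right_mono powr_mono2) auto
    also have "\<dots> \<le> \<eta> * t\<^sup>2" unfolding mult.assoc[symmetric] by (intro mult_right_mono Cr) simp
    finally show ?thesis .
  qed (simp add: F_0)
  with r show ?thesis by blast
qed

lemma F_large: "\<exists>T>0. \<forall>t\<ge>T. L * t\<^sup>2 \<le> F t"
proof -
  define c where "c = F 1"
  have c: "0 < c" using AR[of 1] by (simp add: c_def)
  define T where "T = max 1 ((max L 1 / c) powr (1 / (\<theta> - 2)))"
  have "L * t\<^sup>2 \<le> F t" if t: "T \<le> t" for t
  proof -
    have t1: "1 \<le> t" using t by (simp add: T_def)
    have "max L 1 / c = ((max L 1 / c) powr (1 / (\<theta> - 2))) powr (\<theta> - 2)"
      using theta c by (simp add: powr_powr)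
    also have "\<dots> \<le> t powr (\<theta> - 2)"
      using t theta by (intro powr_mono2) (auto simp: T_def)
    finally have "L \<le> c * t powr (\<theta> - 2)" using c by (simp add: field_simps)
    then have "L * t\<^sup>2 \<le> c * t powr (\<theta> - 2) * t\<^sup>2" by (intro mult_right_mono) auto
    also have "\<dots> = c * t powr \<theta>"
    proof -
      have "t powr \<theta> = t powr (\<theta> - 2) * t powr 2" by (simp flip: powr_add)
      also have "t powr 2 = t\<^sup>2" using t1 by simp
      finally show ?thesis by simp
    qed
    also have "\<dots> \<le> F t" using F_ratio_mono[of 1 1 t] t1 by (simp add: c_def)
    finally show ?thesis .
  qed
  then show ?thesis by (intro exI[of _ T]) (auto simp: T_def)
qed

text \<open>
  The mean value theorem with the uniform continuity of \<open>f\<close>. Integrated over the gasket, this replaces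
  differentiation under the integral sign.
\<close>

lemma F_linearise:
  assumes "0 < \<epsilon>"
  shows "\<exists>\<delta>>0. \<forall>t w. \<bar>t\<bar> \<le> Q \<longrightarrow> \<bar>w\<bar> \<le> \<delta> \<longrightarrow> \<bar>F (t + w) - F t - f t * w\<bar> \<le> \<epsilon> * \<bar>w\<bar>"
proof -
  have "uniformly_continuous_on {-(Q + 1)..Q + 1} f"
    using cont_f by (intro compact_uniformly_continuous) (auto intro: continuous_on_subset)
  then obtain d where d: "0 < d" "\<And>s t. s \<in> {-(Q + 1)..Q + 1} \<Longrightarrow> t \<in> {-(Q + 1)..Q + 1} \<Longrightarrow> dist s t < d \<Longrightarrow> dist (f s) (f t) < \<epsilon>"
    unfolding uniformly_continuous_on_def using assms by metis
  define \<delta> where "\<delta> = min 1 (d / 2)"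
  have \<delta>: "0 < \<delta>" "\<delta> < d" "\<delta> \<le> 1" using d by (auto simp: \<delta>_def)
  have "\<bar>F (t + w) - F t - f t * w\<bar> \<le> \<epsilon> * \<bar>w\<bar>" if t: "\<bar>t\<bar> \<le> Q" and w: "\<bar>w\<bar> \<le> \<delta>" for t w
  proof -
    have "\<exists>\<xi>. \<bar>\<xi> - t\<bar> \<le> \<bar>w\<bar> \<and> F (t + w) - F t = f \<xi> * w"
    proof (cases "w = 0")
      case False
      then consider "0 < w" | "w < 0" by linarith
      then show ?thesis
      proof cases
        case 1
        then obtain z where "z > t" "z < t + w" "F (t + w) - F t = (t + w - t) * f z"
          using MVT2[of t "t + w" F f] F_deriv by auto
        then show ?thesis by (intro exI[of _ z]) auto
      next
        case 2
        then obtain z where "z > t + w" "z < t" "F t - F (t + w) = (t - (t + w)) * f z"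
          using MVT2[of "t + w" t F f] F_deriv by auto
        then show ?thesis by (intro exI[of _ z] conjI) (simp, simp add: algebra_simps)
      qed
    qed auto
    then obtain \<xi> where \<xi>: "\<bar>\<xi> - t\<bar> \<le> \<bar>w\<bar>" "F (t + w) - F t = f \<xi> * w" by blast
    have "dist (f \<xi>) (f t) < \<epsilon>"
      using \<xi> t w \<delta> by (intro d(2)) (auto simp: dist_real_def abs_le_iff)
    then have "\<bar>(f \<xi> - f t) * w\<bar> \<le> \<epsilon> * \<bar>w\<bar>"
      unfolding abs_mult by (intro mult_right_mono) (auto simp: dist_real_def)
    then show ?thesis by (simp add: \<xi> left_diff_distrib)
  qed
  with \<delta> show ?thesis by blast
qed

end

section \<open>The functional of the boundary value problem\<close>

text \<open>
  The function \<open>b\<close> stands for \<open>g0 * h(u0)\<close>.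
\<close>

locale gasket_problem = regular_simplex N p + ambrosetti_rabinowitz f F \<theta>
  for N :: nat and p :: "nat \<Rightarrow> 'a::euclidean_space" and f F \<theta> +
  fixes a b :: "'a \<Rightarrow> real" and b1 b2 :: real
  assumes a: "integrable \<mu> a" "AE y in \<mu>. a y \<le> 0"
    and b: "b \<in> borel_measurable \<mu>" "AE y in \<mu>. b1 \<le> b y \<and> b y \<le> b2" and b1: "0 < b1"
begin

lemma integrable_b: "integrable \<mu> b"
proof (rule finite_measure.integrable_const_bound[OF finite_measure_\<mu> _ b(1)])
  show "AE y in \<mu>. norm (b y) \<le> b2" using b(2) by eventually_elim (use b1 in auto)
qed

lemma integrable_mult_continuous:
  assumes k: "integrable \<mu> k" and w: "continuous_on V w"
  shows "integrable \<mu> (\<lambda>y. k y * w y :: real)"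
proof -
  have "bounded (w ` V)"
    by (intro compact_imp_bounded compact_continuous_image w compact_V)
  then obtain B where B: "\<And>y. y \<in> V \<Longrightarrow> \<bar>w y\<bar> \<le> B" by (auto simp: bounded_iff)
  have "integrable \<mu> (\<lambda>y. B * k y)" using k by simp
  then show ?thesis
  proof (rule Bochner_Integration.integrable_bound)
    show "(\<lambda>y. k y * w y) \<in> borel_measurable \<mu>"
      using k continuous_measurable[OF w] by auto
    show "AE y in \<mu>. norm (k y * w y) \<le> norm (B * k y)"
    proof (rule AE_I2)
      fix y assume "y \<in> space \<mu>"
      then have "\<bar>w y\<bar> \<le> \<bar>B\<bar>" using B[of y] by simp
      then show "norm (k y * w y) \<le> norm (B * k y)"
        using mult_left_mono[of "\<bar>w y\<bar>" "\<bar>B\<bar>" "\<bar>k y\<bar>"] by (simp add: abs_mult mult.commute)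
    qed
  qed
qed

lemma integral_mult_bound:
  fixes k w :: "'a \<Rightarrow> real"
  assumes k: "integrable \<mu> k" and w: "continuous_on V w" and B: "\<And>y. y \<in> V \<Longrightarrow> \<bar>w y\<bar> \<le> B"
  shows "\<bar>\<integral>y. k y * w y \<partial>\<mu>\<bar> \<le> (\<integral>y. \<bar>k y\<bar> \<partial>\<mu>) * B"
proof -
  have "\<bar>\<integral>y. k y * w y \<partial>\<mu>\<bar> \<le> (\<integral>y. \<bar>k y * w y\<bar> \<partial>\<mu>)" using integral_norm_bound[of \<mu> "\<lambda>y. k y * w y"] by simp
  also have "\<dots> \<le> (\<integral>y. \<bar>k y\<bar> * B \<partial>\<mu>)"
    using k by (intro integral_mono integrable_abs integrable_mult_continuous[OF k w] integrable_mult_left)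
      (auto simp: abs_mult intro!: mult_left_mono B)
  also have "\<dots> = (\<integral>y. \<bar>k y\<bar> \<partial>\<mu>) * B" by simp
  finally show ?thesis .
qed

abbreviation "H \<equiv> H01 N p"
abbreviation "ip \<equiv> energy_form N p"

lemma H_cont: "x \<in> H \<Longrightarrow> continuous_on V x"
  by (simp add: H01_iff)

lemma cont_comp: "x \<in> H \<Longrightarrow> continuous_on V (\<lambda>y. f (x y))" "x \<in> H \<Longrightarrow> continuous_on V (\<lambda>y. F (x y))"
  using H_cont by (auto intro: continuous_on_compose2[OF cont_f] continuous_on_compose2[OF cont_F[of UNIV]])

definition la :: real where "la = (\<integral>y. \<bar>a y\<bar> \<partial>\<mu>)"
definition lb :: real where "lb = (\<integral>y. \<bar>b y\<bar> \<partial>\<mu>)"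

lemma lab_nonneg: "0 \<le> la" "0 \<le> lb" by (auto simp: la_def lb_def)

text \<open>
  The derivative at \<open>x\<close> in the direction \<open>v\<close> of the integral part of \<open>- \<Phi>\<close>.
\<close>

definition lin :: "('a \<Rightarrow> real) \<Rightarrow> ('a \<Rightarrow> real) \<Rightarrow> real" where
  "lin x v = (\<integral>y. a y * (x y * v y) \<partial>\<mu>) + (\<integral>y. b y * (f (x y) * v y) \<partial>\<mu>)"

definition \<Phi> :: "('a \<Rightarrow> real) \<Rightarrow> real" where
  "\<Phi> x = ip x x / 2 - (\<integral>y. a y * (x y * x y) \<partial>\<mu>) / 2 - (\<integral>y. b y * F (x y) \<partial>\<mu>)"

lemma integrable_a: "x \<in> H \<Longrightarrow> v \<in> H \<Longrightarrow> integrable \<mu> (\<lambda>y. a y * (x y * v y))"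
  by (intro integrable_mult_continuous a continuous_intros H_cont)

lemma integrable_bf: "x \<in> H \<Longrightarrow> v \<in> H \<Longrightarrow> integrable \<mu> (\<lambda>y. b y * (f (x y) * v y))"
  by (intro integrable_mult_continuous integrable_b continuous_on_mult cont_comp H_cont)

lemma integrable_bF: "x \<in> H \<Longrightarrow> integrable \<mu> (\<lambda>y. b y * F (x y))"
  by (intro integrable_mult_continuous integrable_b cont_comp)

lemma lin_add:
  assumes "x \<in> H" "v \<in> H" "w \<in> H" shows "lin x (v + w) = lin x v + lin x w"
  using integrable_a[OF assms(1,2)] integrable_a[OF assms(1,3)] integrable_bf[OF assms(1,2)] integrable_bf[OF assms(1,3)]
  by (simp add: lin_def distrib_left)

lemma lin_scale: "lin x (c *\<^sub>R v) = c * lin x v"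
proof -
  have "(\<integral>y. a y * (x y * (c *\<^sub>R v) y) \<partial>\<mu>) = (\<integral>y. c * (a y * (x y * v y)) \<partial>\<mu>)"
    "(\<integral>y. b y * (f (x y) * (c *\<^sub>R v) y) \<partial>\<mu>) = (\<integral>y. c * (b y * (f (x y) * v y)) \<partial>\<mu>)"
    by (simp_all add: mult_ac)
  then show ?thesis by (simp add: lin_def distrib_left)
qed

lemma bounded_on_V:
  assumes "x \<in> H" "y \<in> V" "nrm x \<le> R" shows "\<bar>x y\<bar> \<le> osc_const * R"
proof -
  have "osc_const * nrm x \<le> osc_const * R" using assms osc_const(1) by (intro mult_left_mono) auto
  with sup_bound[OF assms(1,2)] show ?thesis by linarith
qed

lemma lin_diff_bound:
  assumes x: "x \<in> H" "x' \<in> H" "v \<in> H"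
    and \<alpha>: "\<And>y. y \<in> V \<Longrightarrow> \<bar>x y - x' y\<bar> \<le> \<alpha>" and \<beta>: "\<And>y. y \<in> V \<Longrightarrow> \<bar>f (x y) - f (x' y)\<bar> \<le> \<beta>"
  shows "\<bar>lin x v - lin x' v\<bar> \<le> (la * \<alpha> + lb * \<beta>) * osc_const * nrm v"
proof -
  have sv: "\<bar>v y\<bar> \<le> osc_const * nrm v" if "y \<in> V" for y using sup_bound x that by blast
  have ab0: "0 \<le> \<alpha>" "0 \<le> \<beta>" using \<alpha>[of "p 1"] \<beta>[of "p 1"] p_in_V N_pos by (auto intro: order_trans[OF abs_ge_zero])
  have "lin x v - lin x' v = (\<integral>y. a y * ((x y - x' y) * v y) \<partial>\<mu>) + (\<integral>y. b y * ((f (x y) - f (x' y)) * v y) \<partial>\<mu>)"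
    using integrable_a[OF x(1,3)] integrable_a[OF x(2,3)] integrable_bf[OF x(1,3)] integrable_bf[OF x(2,3)]
    by (simp add: lin_def left_diff_distrib right_diff_distrib)
  moreover have "\<bar>\<integral>y. a y * ((x y - x' y) * v y) \<partial>\<mu>\<bar> \<le> la * (\<alpha> * (osc_const * nrm v))"
    unfolding la_def
  proof (intro integral_mult_bound a continuous_intros H_cont x)
    fix y assume "y \<in> V"
    then show "\<bar>(x y - x' y) * v y\<bar> \<le> \<alpha> * (osc_const * nrm v)"
      unfolding abs_mult using \<alpha> sv ab0 by (intro mult_mono) auto
  qed
  moreover have "\<bar>\<integral>y. b y * ((f (x y) - f (x' y)) * v y) \<partial>\<mu>\<bar> \<le> lb * (\<beta> * (osc_const * nrm v))"
    unfolding lb_def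
  proof (intro integral_mult_bound integrable_b continuous_intros cont_comp H_cont x)
    fix y assume "y \<in> V"
    then show "\<bar>(f (x y) - f (x' y)) * v y\<bar> \<le> \<beta> * (osc_const * nrm v)"
      unfolding abs_mult using \<beta> sv ab0 by (intro mult_mono) auto
  qed
  ultimately show ?thesis by (simp add: algebra_simps)
qed

lemma lin_bound: "x \<in> H \<Longrightarrow> \<exists>L. \<forall>v\<in>H. \<bar>lin x v\<bar> \<le> L * nrm v"
proof -
  assume x: "x \<in> H"
  have "bounded ((\<lambda>y. f (x y)) ` V)"
    by (intro compact_imp_bounded compact_continuous_image cont_comp x compact_V)
  then obtain B where B: "\<And>y. y \<in> V \<Longrightarrow> \<bar>f (x y)\<bar> \<le> B" by (auto simp: bounded_iff)
  have "\<bar>lin x v\<bar> \<le> (la * (osc_const * nrm x) + lb * B) * osc_const * nrm v" if v: "v \<in> H" for v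
  proof -
    have sv: "\<bar>v y\<bar> \<le> osc_const * nrm v" if "y \<in> V" for y using sup_bound v that by blast
    have B0: "0 \<le> B" using B[of "p 1"] p_in_V N_pos by (auto intro: order_trans[OF abs_ge_zero])
    have n0: "0 \<le> osc_const * nrm x" using x osc_const(1) by simp
    have "\<bar>\<integral>y. a y * (x y * v y) \<partial>\<mu>\<bar> \<le> la * ((osc_const * nrm x) * (osc_const * nrm v))"
      unfolding la_def
    proof (intro integral_mult_bound a continuous_intros H_cont x v)
      fix y assume "y \<in> V"
      then show "\<bar>x y * v y\<bar> \<le> (osc_const * nrm x) * (osc_const * nrm v)"
        unfolding abs_mult using sup_bound[OF x] sv n0 by (intro mult_mono) auto
    qed
    moreover have "\<bar>\<integral>y. b y * (f (x y) * v y) \<partial>\<mu>\<bar> \<le> lb * (B * (osc_const * nrm v))"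
      unfolding lb_def
    proof (intro integral_mult_bound integrable_b continuous_intros cont_comp H_cont x v)
      fix y assume "y \<in> V"
      then show "\<bar>f (x y) * v y\<bar> \<le> B * (osc_const * nrm v)"
        unfolding abs_mult using B sv B0 by (intro mult_mono) auto
    qed
    ultimately show ?thesis by (simp add: lin_def algebra_simps)
  qed
  then show ?thesis by blast
qed

definition repr :: "('a \<Rightarrow> real) \<Rightarrow> ('a \<Rightarrow> real)" where
  "repr x = (SOME r. r \<in> H \<and> (\<forall>v\<in>H. ip r v = lin x v))"

lemma repr: "x \<in> H \<Longrightarrow> repr x \<in> H" "x \<in> H \<Longrightarrow> v \<in> H \<Longrightarrow> ip (repr x) v = lin x v"
proof -
  assume x: "x \<in> H"
  obtain L where L: "\<forall>v\<in>H. \<bar>lin x v\<bar> \<le> L * nrm v" using lin_bound[OF x] by blast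
  have "\<exists>r\<in>H. \<forall>v\<in>H. ip r v = lin x v"
    by (rule Riesz_representation[of _ L]) (use L x lin_add lin_scale in auto)
  then have "\<exists>r. r \<in> H \<and> (\<forall>v\<in>H. ip r v = lin x v)" by blast
  from someI_ex[OF this] have *: "repr x \<in> H \<and> (\<forall>v\<in>H. ip (repr x) v = lin x v)"
    unfolding repr_def .
  then show "repr x \<in> H" by blast
  show "ip (repr x) v = lin x v" if "v \<in> H" using * that by blast
qed

text \<open>
  Uniform closeness of the functions suffices here. Together with the compact embedding, this makes
  \<open>repr\<close> a compact map.
\<close>

lemma repr_uniform:
  assumes "0 < e"
  shows "\<exists>\<delta>>0. \<forall>x\<in>H. \<forall>x'\<in>H. (\<forall>y\<in>V. \<bar>x y\<bar> \<le> Q \<and> \<bar>x' y\<bar> \<le> Q \<and> \<bar>x y - x' y\<bar> < \<delta>) \<longrightarrow> nrm (repr x - repr x') < e"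
proof -
  define c where "c = e / (2 * osc_const * (la + lb + 1))"
  have oc: "0 < osc_const" using osc_const(1) by linarith
  have c: "0 < c" using assms oc lab_nonneg by (simp add: c_def add_nonneg_pos)
  have "uniformly_continuous_on {-Q..Q} f"
    using cont_f by (intro compact_uniformly_continuous) (auto intro: continuous_on_subset)
  then obtain d where d: "0 < d" "\<And>s t. s \<in> {-Q..Q} \<Longrightarrow> t \<in> {-Q..Q} \<Longrightarrow> dist s t < d \<Longrightarrow> dist (f s) (f t) < c"
    unfolding uniformly_continuous_on_def using c by metis
  have "nrm (repr x - repr x') < e"
    if x: "x \<in> H" "x' \<in> H" and close: "\<forall>y\<in>V. \<bar>x y\<bar> \<le> Q \<and> \<bar>x' y\<bar> \<le> Q \<and> \<bar>x y - x' y\<bar> < min c d" for x x'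
  proof -
    let ?r = "repr x - repr x'"
    have r: "?r \<in> H" using repr x by auto
    have "(nrm ?r)\<^sup>2 = lin x ?r - lin x' ?r"
      using repr(1)[OF x(1)] repr(1)[OF x(2)] r by (simp add: nrm_sq ip_diff_left repr(2) x)
    also have "\<dots> \<le> (la * c + lb * c) * osc_const * nrm ?r"
    proof (rule order_trans[OF abs_ge_self lin_diff_bound[OF x r]])
      fix y assume y: "y \<in> V"
      show "\<bar>x y - x' y\<bar> \<le> c" using close y by fastforce
      have "dist (f (x y)) (f (x' y)) < c"
        using close y by (intro d(2)) (auto simp: dist_real_def abs_le_iff)
      then show "\<bar>f (x y) - f (x' y)\<bar> \<le> c" by (simp add: dist_real_def)
    qed
    finally have *: "nrm ?r * nrm ?r \<le> (c * (la + lb) * osc_const) * nrm ?r"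
      by (simp add: power2_eq_square algebra_simps)
    have "c * (la + lb) * osc_const < e"
    proof -
      have "c * (la + lb) * osc_const \<le> c * (la + lb + 1) * osc_const"
        using c oc by (intro mult_right_mono mult_left_mono) auto
      also have "\<dots> = e / 2"
      proof -
        have canc: "e / (2 * r * z) * z * r = e / 2" if "z \<noteq> 0" "r \<noteq> 0" for z r using that by simp
        have "la + lb + 1 \<noteq> 0" "osc_const \<noteq> 0" using oc lab_nonneg by linarith+
        then show ?thesis unfolding c_def by (rule canc)
      qed
      finally show ?thesis using assms by linarith
    qed
    moreover have "nrm ?r \<le> c * (la + lb) * osc_const \<or> nrm ?r = 0"
    proof (rule disjCI)
      assume "nrm ?r \<noteq> 0"
      then have "0 < nrm ?r" using nrm_nonneg[OF r] by simp
      with * show "nrm ?r \<le> c * (la + lb) * osc_const" by (simp only: mult_le_cancel_right_pos)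
    qed
    ultimately show ?thesis using assms by auto
  qed
  with c d show ?thesis by (intro exI[of _ "min c d"]) auto
qed

definition grad :: "('a \<Rightarrow> real) \<Rightarrow> ('a \<Rightarrow> real)" where "grad x = x - repr x"

lemma grad: "x \<in> H \<Longrightarrow> grad x \<in> H" "x \<in> H \<Longrightarrow> v \<in> H \<Longrightarrow> ip (grad x) v = ip x v - lin x v"
  using repr by (auto simp: grad_def ip_diff_left)

lemma first_order:
  assumes "0 < \<epsilon>"
  shows "\<exists>s>0. \<forall>x\<in>H. \<forall>w\<in>H. nrm x \<le> R \<longrightarrow> nrm w \<le> s \<longrightarrow> \<bar>\<Phi> (x + w) - \<Phi> x - ip (grad x) w\<bar> \<le> \<epsilon> * nrm w"
proof -
  have oc: "0 < osc_const" using osc_const(1) by linarith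
  define \<epsilon>' where "\<epsilon>' = \<epsilon> / (2 * (lb * osc_const + 1))"
  have \<epsilon>': "0 < \<epsilon>'" "lb * osc_const * \<epsilon>' \<le> \<epsilon> / 2"
  proof -
    have "0 \<le> lb * osc_const" using lab_nonneg oc by simp
    then show "0 < \<epsilon>'" using assms by (simp add: \<epsilon>'_def)
    then have "lb * osc_const * \<epsilon>' \<le> (lb * osc_const + 1) * \<epsilon>'" by (simp add: distrib_right)
    also have "\<dots> = \<epsilon> / 2"
    proof -
      have canc: "z * (\<epsilon> / (2 * z)) = \<epsilon> / 2" if "z \<noteq> 0" for z using that by simp
      have "lb * osc_const + 1 \<noteq> 0" using \<open>0 \<le> lb * osc_const\<close> by linarith
      then show ?thesis unfolding \<epsilon>'_def by (rule canc)
    qed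
    finally show "lb * osc_const * \<epsilon>' \<le> \<epsilon> / 2" .
  qed
  obtain \<delta> where \<delta>: "0 < \<delta>" "\<And>t w. \<bar>t\<bar> \<le> osc_const * R \<Longrightarrow> \<bar>w\<bar> \<le> \<delta> \<Longrightarrow> \<bar>F (t + w) - F t - f t * w\<bar> \<le> \<epsilon>' * \<bar>w\<bar>"
    using F_linearise[OF \<epsilon>'(1), of "osc_const * R"] by blast
  define k where "k = 1 + la * osc_const\<^sup>2"
  have k: "0 < k" using lab_nonneg by (simp add: k_def add_pos_nonneg)
  define s where "s = min (\<delta> / osc_const) (\<epsilon> / k)"
  have s: "0 < s" "osc_const * s \<le> \<delta>" "k * s \<le> \<epsilon>"
  proof -
    show "0 < s" using \<delta> oc assms k by (simp add: s_def)
    have "s \<le> \<delta> / osc_const" "s \<le> \<epsilon> / k" by (auto simp: s_def)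
    then show "osc_const * s \<le> \<delta>" "k * s \<le> \<epsilon>" using oc k by (simp_all add: field_simps)
  qed
  have "\<bar>\<Phi> (x + w) - \<Phi> x - ip (grad x) w\<bar> \<le> \<epsilon> * nrm w" if x: "x \<in> H" "w \<in> H" "nrm x \<le> R" "nrm w \<le> s" for x w
  proof -
    have xw: "x + w \<in> H" using x by simp
    have ww: "\<bar>w y\<bar> \<le> osc_const * nrm w" if "y \<in> V" for y using sup_bound x that by blast
    define Ia where "Ia = (\<integral>y. a y * (w y * w y) \<partial>\<mu>)"
    define Ib where "Ib = (\<integral>y. b y * (F (x y + w y) - F (x y) - f (x y) * w y) \<partial>\<mu>)"
    have 1: "ip (x + w) (x + w) = ip x x + 2 * ip x w + ip w w"
      using x ip_sym[of x w] by (simp add: ip_simps)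
    have 2: "(\<integral>y. a y * ((x + w) y * (x + w) y) \<partial>\<mu>) = (\<integral>y. a y * (x y * x y) \<partial>\<mu>) + 2 * (\<integral>y. a y * (x y * w y) \<partial>\<mu>) + Ia"
    proof -
      have "(\<integral>y. a y * ((x + w) y * (x + w) y) \<partial>\<mu>) = (\<integral>y. a y * (x y * x y) + 2 * (a y * (x y * w y)) + a y * (w y * w y) \<partial>\<mu>)"
        by (intro Bochner_Integration.integral_cong refl) (simp add: algebra_simps)
      then show ?thesis
        using integrable_a[OF x(1,1)] integrable_a[OF x(1,2)] integrable_a[OF x(2,2)] by (simp add: Ia_def)
    qed
    have 3: "Ib = (\<integral>y. b y * F ((x + w) y) \<partial>\<mu>) - (\<integral>y. b y * F (x y) \<partial>\<mu>) - (\<integral>y. b y * (f (x y) * w y) \<partial>\<mu>)"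
      using integrable_bF[OF xw] integrable_bF[OF x(1)] integrable_bf[OF x(1,2)]
      by (simp add: Ib_def right_diff_distrib)
    have eq: "\<Phi> (x + w) - \<Phi> x - ip (grad x) w = ip w w / 2 - Ia / 2 - Ib"
      unfolding \<Phi>_def 1 2 3 grad(2)[OF x(1,2)] lin_def by (simp add: field_simps)
    have bIa: "\<bar>Ia\<bar> \<le> la * ((osc_const * nrm w) * (osc_const * nrm w))"
      unfolding Ia_def la_def
    proof (intro integral_mult_bound a continuous_intros H_cont x)
      fix y assume "y \<in> V"
      then show "\<bar>w y * w y\<bar> \<le> (osc_const * nrm w) * (osc_const * nrm w)"
        unfolding abs_mult using ww by (intro mult_mono) (auto intro: order_trans[OF abs_ge_zero])
    qed
    have bIb: "\<bar>Ib\<bar> \<le> lb * (\<epsilon>' * (osc_const * nrm w))"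
    proof -
      have "continuous_on V (\<lambda>y. F (x y + w y))" using cont_comp(2)[OF xw] by simp
      then have cI: "continuous_on V (\<lambda>y. F (x y + w y) - F (x y) - f (x y) * w y)"
        by (rule continuous_on_diff[OF continuous_on_diff[OF _ cont_comp(2)[OF x(1)]]
          continuous_on_mult[OF cont_comp(1)[OF x(1)] H_cont[OF x(2)]]])
      show ?thesis
        unfolding Ib_def lb_def
      proof (rule integral_mult_bound[OF integrable_b cI])
        fix y assume y: "y \<in> V"
        have "osc_const * nrm w \<le> osc_const * s" using x oc by (intro mult_left_mono) auto
        then have "\<bar>w y\<bar> \<le> \<delta>" using ww[OF y] s by linarith
        then have "\<bar>F (x y + w y) - F (x y) - f (x y) * w y\<bar> \<le> \<epsilon>' * \<bar>w y\<bar>"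
          by (intro \<delta>(2) bounded_on_V x y)
        also have "\<dots> \<le> \<epsilon>' * (osc_const * nrm w)" using \<epsilon>' ww[OF y] by (intro mult_left_mono) auto
        finally show "\<bar>F (x y + w y) - F (x y) - f (x y) * w y\<bar> \<le> \<epsilon>' * (osc_const * nrm w)" .
      qed
    qed
    have "\<bar>ip w w / 2 - Ia / 2 - Ib\<bar> \<le> ip w w / 2 + \<bar>Ia\<bar> / 2 + \<bar>Ib\<bar>"
      using ip_nonneg[OF x(2)] by linarith
    also have "\<dots> \<le> ip w w / 2 + la * ((osc_const * nrm w) * (osc_const * nrm w)) / 2 + lb * (\<epsilon>' * (osc_const * nrm w))"
      using bIa bIb by linarith
    also have "\<dots> = (k * nrm w / 2 + lb * osc_const * \<epsilon>') * nrm w"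
      by (simp add: k_def nrm_sq[OF x(2), symmetric] power2_eq_square algebra_simps add_divide_distrib)
    also have "\<dots> \<le> (\<epsilon> / 2 + \<epsilon> / 2) * nrm w"
    proof (intro mult_right_mono add_mono \<epsilon>')
      have "k * nrm w \<le> k * s" using x k by (intro mult_left_mono) auto
      then show "k * nrm w / 2 \<le> \<epsilon> / 2" using s by linarith
    qed (use x in simp)
    finally show ?thesis unfolding eq by simp
  qed
  with s show ?thesis by blast
qed

lemma grad_cont:
  assumes X: "\<And>n. X n \<in> H" and x: "x \<in> H" and lim: "(\<lambda>n. nrm (X n - x)) \<longlonglongrightarrow> 0"
  shows "(\<lambda>n. nrm (grad (X n) - grad x)) \<longlonglongrightarrow> 0"
proof -
  have oc: "0 < osc_const" using osc_const(1) by linarith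
  have rlim: "(\<lambda>n. nrm (repr (X n) - repr x)) \<longlonglongrightarrow> 0"
  proof (rule LIMSEQ_I)
    fix e :: real assume "0 < e"
    obtain \<delta> where \<delta>: "0 < \<delta>" "\<forall>z\<in>H. \<forall>z'\<in>H. (\<forall>y\<in>V. \<bar>z y\<bar> \<le> osc_const * (nrm x + 1) \<and> \<bar>z' y\<bar> \<le> osc_const * (nrm x + 1) \<and> \<bar>z y - z' y\<bar> < \<delta>) \<longrightarrow> nrm (repr z - repr z') < e"
      using repr_uniform[OF \<open>0 < e\<close>, of "osc_const * (nrm x + 1)"] by blast
    obtain n0 where n0: "\<And>n. n \<ge> n0 \<Longrightarrow> nrm (X n - x) < min 1 (\<delta> / osc_const)"
      using order_tendstoD(2)[OF lim, of "min 1 (\<delta> / osc_const)"] \<delta> oc by (auto simp: eventually_sequentially)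
    have "nrm (repr (X n) - repr x) < e" if "n \<ge> n0" for n
    proof -
      have d: "X n - x \<in> H" using X x by simp
      have n: "nrm (X n - x) < 1" "osc_const * nrm (X n - x) < \<delta>"
        using n0[OF that] oc by (auto simp: field_simps)
      have "nrm (X n) \<le> nrm x + 1" using nrm_diff_triangle[OF X x, of n] n by linarith
      have "\<forall>y\<in>V. \<bar>X n y\<bar> \<le> osc_const * (nrm x + 1) \<and> \<bar>x y\<bar> \<le> osc_const * (nrm x + 1) \<and> \<bar>X n y - x y\<bar> < \<delta>"
      proof (intro ballI conjI)
        fix y assume y: "y \<in> V"
        show "\<bar>X n y\<bar> \<le> osc_const * (nrm x + 1)" by (rule bounded_on_V[OF X y]) fact
        show "\<bar>x y\<bar> \<le> osc_const * (nrm x + 1)" by (rule bounded_on_V[OF x y]) simp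
        show "\<bar>X n y - x y\<bar> < \<delta>" using le_less_trans[OF sup_bound[OF d y] n(2)] by simp
      qed
      with \<delta>(2) X x show ?thesis by blast
    qed
    then show "\<exists>n0. \<forall>n\<ge>n0. norm (nrm (repr (X n) - repr x) - 0) < e"
      using nrm_nonneg[OF H_closed(3)[OF repr(1)[OF X] repr(1)[OF x]]] by (intro exI[of _ n0]) simp
  qed
  have sum0: "(\<lambda>n. nrm (X n - x) + nrm (repr (X n) - repr x)) \<longlonglongrightarrow> 0"
    using tendsto_add[OF lim rlim] by simp
  show ?thesis
  proof (rule Lim_null_comparison[OF _ sum0], intro always_eventually allI)
    fix n
    have H: "X n - x \<in> H" "repr (X n) - repr x \<in> H" "grad (X n) - grad x \<in> H"
      using X x repr grad by auto
    have "grad (X n) - grad x = (X n - x) + - (repr (X n) - repr x)"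
      by (simp add: grad_def)
    then have "nrm (grad (X n) - grad x) \<le> nrm (X n - x) + nrm (repr (X n) - repr x)"
      using nrm_triangle[OF H(1) H_closed(5)[OF H(2)]] nrm_minus[OF H(2)] by simp
    with nrm_nonneg[OF H(3)] show "norm (nrm (grad (X n) - grad x)) \<le> nrm (X n - x) + nrm (repr (X n) - repr x)" by simp
  qed
qed

text \<open>
  A subsequence converges uniformly; its images under \<open>repr\<close> form a Cauchy sequence in energy by \<open>repr_uniform\<close>, and
  \<open>X n = grad (X n) + repr (X n)\<close> inherits this as the gradients tend to \<open>0\<close>.
\<close>

lemma palais_smale:
  assumes X: "\<And>n. X n \<in> H" and R: "\<And>n. nrm (X n) \<le> R" and g0: "(\<lambda>n. nrm (grad (X n))) \<longlonglongrightarrow> 0"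
  shows "\<exists>x\<in>H. \<exists>r. strict_mono r \<and> (\<lambda>n. nrm (X (r n) - x)) \<longlonglongrightarrow> 0"
proof -
  obtain z k where k: "strict_mono (k :: nat \<Rightarrow> nat)" "uniform_limit V (X \<circ> k) z sequentially"
    using bounded_sequence_subseq[of X R] X R by metis
  define Y where "Y n = X (k n)" for n
  have Y: "Y n \<in> H" for n using X by (simp add: Y_def)
  have gY: "(\<lambda>n. nrm (grad (Y n))) \<longlonglongrightarrow> 0"
    using LIMSEQ_subseq_LIMSEQ[OF g0 k(1)] by (simp add: Y_def comp_def)
  have "\<exists>x\<in>H. (\<lambda>n. sqrt (ip (Y n - x) (Y n - x))) \<longlonglongrightarrow> 0"
  proof (rule complete)
    fix e :: real assume "0 < e"
    then have "0 < e / 3" by simp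
    obtain \<delta> where \<delta>: "0 < \<delta>" "\<forall>z\<in>H. \<forall>z'\<in>H. (\<forall>y\<in>V. \<bar>z y\<bar> \<le> osc_const * R \<and> \<bar>z' y\<bar> \<le> osc_const * R \<and> \<bar>z y - z' y\<bar> < \<delta>) \<longrightarrow> nrm (repr z - repr z') < e / 3"
      using repr_uniform[OF \<open>0 < e / 3\<close>, of "osc_const * R"] by blast
    obtain n1 where n1: "\<And>n y. n \<ge> n1 \<Longrightarrow> y \<in> V \<Longrightarrow> dist (Y n y) (z y) < \<delta> / 2"
      using k(2) \<delta>(1) unfolding uniform_limit_sequentially_iff Y_def comp_def by (meson half_gt_zero)
    obtain n2 where n2: "\<And>n. n \<ge> n2 \<Longrightarrow> nrm (grad (Y n)) < e / 3"
      using order_tendstoD(2)[OF gY \<open>0 < e / 3\<close>] by (auto simp: eventually_sequentially)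
    have "nrm (Y m - Y n) < e" if mn: "m \<ge> max n1 n2" "n \<ge> max n1 n2" for m n
    proof -
      have "\<forall>y\<in>V. \<bar>Y m y\<bar> \<le> osc_const * R \<and> \<bar>Y n y\<bar> \<le> osc_const * R \<and> \<bar>Y m y - Y n y\<bar> < \<delta>"
      proof (intro ballI conjI)
        fix y assume y: "y \<in> V"
        show "\<bar>Y m y\<bar> \<le> osc_const * R" "\<bar>Y n y\<bar> \<le> osc_const * R"
          using R by (auto intro!: bounded_on_V Y y simp: Y_def X)
        have "dist (Y m y) (z y) < \<delta> / 2" "dist (Y n y) (z y) < \<delta> / 2" using n1 mn y by auto
        then show "\<bar>Y m y - Y n y\<bar> < \<delta>" unfolding dist_real_def by linarith
      qed
      then have r: "nrm (repr (Y m) - repr (Y n)) < e / 3" using \<delta>(2) Y by blast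
      have H: "grad (Y m) \<in> H" "- grad (Y n) \<in> H" "repr (Y m) - repr (Y n) \<in> H"
        using Y grad repr by auto
      have "Y m - Y n = grad (Y m) + (- grad (Y n) + (repr (Y m) - repr (Y n)))"
        by (simp add: grad_def)
      then have "nrm (Y m - Y n) \<le> nrm (grad (Y m)) + (nrm (grad (Y n)) + nrm (repr (Y m) - repr (Y n)))"
        using nrm_triangle3[OF H] nrm_minus[OF grad(1)[OF Y], of n] by simp
      also have "\<dots> < e / 3 + (e / 3 + e / 3)"
        using n2[of m] n2[of n] mn r by (intro add_strict_mono) auto
      finally show ?thesis by simp
    qed
    then show "\<exists>n0. \<forall>m\<ge>n0. \<forall>n\<ge>n0. sqrt (ip (Y m - Y n) (Y m - Y n)) < e"
      unfolding nrm_def by blast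
  qed (rule Y)
  then show ?thesis using k(1) unfolding nrm_def[symmetric] Y_def by blast
qed

lemma integral_a_nonpos:
  assumes "x \<in> H" shows "(\<integral>y. a y * (x y * x y) \<partial>\<mu>) \<le> 0"
proof -
  have "AE y in \<mu>. 0 \<le> - (a y * (x y * x y))"
    using a(2) by eventually_elim (simp add: mult_nonpos_nonneg)
  then have "0 \<le> (\<integral>y. - (a y * (x y * x y)) \<partial>\<mu>)" by (rule integral_nonneg_AE)
  then show ?thesis by simp
qed

text \<open>
  The combination \<open>\<Phi> x - ip (grad x) x / \<theta>\<close> is at least \<open>(1 / 2 - 1 / \<theta>) * (nrm x)\<^sup>2\<close>: the integral of
  \<open>a\<close> has the good sign, and so has that of \<open>b\<close> by the Ambrosetti-Rabinowitz inequality.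
\<close>

lemma AR_bounded: "\<exists>R0. \<forall>x\<in>H. \<Phi> x \<le> C \<longrightarrow> nrm (grad x) \<le> 1 \<longrightarrow> nrm x \<le> R0"
proof -
  define q where "q = 1 / 2 - 1 / \<theta>"
  have q: "0 < q" using theta by (simp add: q_def field_simps)
  define R0 where "R0 = max 1 ((\<bar>C\<bar> + 1) / q)"
  have "nrm x \<le> R0" if x: "x \<in> H" "\<Phi> x \<le> C" "nrm (grad x) \<le> 1" for x
  proof (rule ccontr)
    assume "\<not> nrm x \<le> R0"
    then have n: "1 < nrm x" "(\<bar>C\<bar> + 1) / q < nrm x" by (auto simp: R0_def)
    define A where "A = (\<integral>y. a y * (x y * x y) \<partial>\<mu>)"
    have A: "A \<le> 0" using integral_a_nonpos[OF x(1)] by (simp add: A_def)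
    define D where "D = (\<integral>y. b y * (f (x y) * x y / \<theta> - F (x y)) \<partial>\<mu>)"
    have "0 \<le> D"
      unfolding D_def
    proof (rule integral_nonneg_AE)
      show "AE y in \<mu>. 0 \<le> b y * (f (x y) * x y / \<theta> - F (x y))"
        using b(2)
      proof eventually_elim
        case (elim y)
        have "F (x y) \<le> f (x y) * x y / \<theta>"
          using AR'[of "x y"] theta by (simp add: field_simps)
        with elim b1 show ?case by (intro mult_nonneg_nonneg) auto
      qed
    qed
    have D: "D = (\<integral>y. b y * (f (x y) * x y) \<partial>\<mu>) / \<theta> - (\<integral>y. b y * F (x y) \<partial>\<mu>)"
      using integrable_bf[OF x(1,1)] integrable_bF[OF x(1)]
      by (simp add: D_def right_diff_distrib)
    have "\<Phi> x - ip (grad x) x / \<theta> = q * ip x x - q * A + D"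
      unfolding \<Phi>_def grad(2)[OF x(1,1)] lin_def D A_def[symmetric] q_def
      by (simp add: algebra_simps add_divide_distrib diff_divide_distrib)
    moreover have "q * A \<le> 0" using q A by (simp add: mult_nonneg_nonpos)
    ultimately have 1: "q * ip x x \<le> \<Phi> x - ip (grad x) x / \<theta>" using \<open>0 \<le> D\<close> by linarith
    have "\<bar>ip (grad x) x\<bar> \<le> 1 * nrm x"
      using Cauchy_Schwarz[OF grad(1)[OF x(1)] x(1)] mult_right_mono[OF x(3), of "nrm x"] n by linarith
    moreover have "\<bar>ip (grad x) x / \<theta>\<bar> \<le> \<bar>ip (grad x) x\<bar>"
      using theta mult_left_mono[of 1 \<theta> "\<bar>ip (grad x) x\<bar>"] by (simp add: abs_divide divide_le_eq)
    ultimately have "q * ip x x \<le> \<bar>C\<bar> + nrm x" using 1 x(2) by linarith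
    also have "\<dots> \<le> (\<bar>C\<bar> + 1) * nrm x" using n mult_left_mono[of 1 "nrm x" "\<bar>C\<bar>"] by (simp add: distrib_right)
    finally have "(q * nrm x) * nrm x \<le> (\<bar>C\<bar> + 1) * nrm x"
      by (simp add: nrm_sq[OF x(1), symmetric] power2_eq_square mult.assoc)
    then have "q * nrm x \<le> \<bar>C\<bar> + 1" using n by (simp add: mult_le_cancel_right)
    then show False using n(2) q by (simp add: field_simps)
  qed
  then show ?thesis by blast
qed

lemma near_zero: "\<exists>\<rho>>0. \<forall>x\<in>H. nrm x \<le> \<rho> \<longrightarrow> 1 / 4 * (nrm x)\<^sup>2 \<le> \<Phi> x"
proof -
  have oc: "0 < osc_const" using osc_const(1) by linarith
  define k where "k = lb * osc_const\<^sup>2"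
  have k: "0 \<le> k" using lab_nonneg by (simp add: k_def)
  define \<eta> where "\<eta> = 1 / (4 * (k + 1))"
  have \<eta>: "0 < \<eta>" "k * \<eta> \<le> 1 / 4" using k by (auto simp: \<eta>_def field_simps)
  obtain r where r: "0 < r" "\<And>t. \<bar>t\<bar> \<le> r \<Longrightarrow> F t \<le> \<eta> * t\<^sup>2" using F_small[OF \<eta>(1)] by blast
  define \<rho> where "\<rho> = r / osc_const"
  have "1 / 4 * (nrm x)\<^sup>2 \<le> \<Phi> x" if x: "x \<in> H" "nrm x \<le> \<rho>" for x
  proof -
    have "\<bar>\<integral>y. b y * F (x y) \<partial>\<mu>\<bar> \<le> lb * (\<eta> * (osc_const * nrm x)\<^sup>2)"
      unfolding lb_def
    proof (intro integral_mult_bound integrable_b cont_comp x)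
      fix y assume y: "y \<in> V"
      have "\<bar>x y\<bar> \<le> r" using bounded_on_V[OF x(1) y x(2)] oc by (simp add: \<rho>_def)
      then have "\<bar>F (x y)\<bar> \<le> \<eta> * (x y)\<^sup>2" using r(2) F_nonneg by simp
      also have "\<dots> \<le> \<eta> * (osc_const * nrm x)\<^sup>2"
        using \<eta> sup_bound[OF x(1) y] power_mono[of "\<bar>x y\<bar>" "osc_const * nrm x" 2] by (intro mult_left_mono) auto
      finally show "\<bar>F (x y)\<bar> \<le> \<eta> * (osc_const * nrm x)\<^sup>2" .
    qed
    also have "\<dots> = (k * \<eta>) * (nrm x)\<^sup>2" by (simp add: k_def power_mult_distrib mult_ac)
    also have "\<dots> \<le> 1 / 4 * (nrm x)\<^sup>2" by (intro mult_right_mono \<eta>) simp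
    finally have "(\<integral>y. b y * F (x y) \<partial>\<mu>) \<le> 1 / 4 * (nrm x)\<^sup>2" by linarith
    then show ?thesis
      unfolding \<Phi>_def using integral_a_nonpos[OF x(1)] nrm_sq[OF x(1)] by linarith
  qed
  then show ?thesis using r oc by (intro exI[of _ \<rho>]) (auto simp: \<rho>_def)
qed

text \<open>
  Along a ray the quadratic part of \<open>\<Phi>\<close> grows like \<open>t\<^sup>2\<close>. On a set of positive measure the direction \<open>e\<close> is at least
  \<open>d\<close>, and there \<open>F\<close> eventually exceeds any given multiple of the square.
\<close>

lemma far_away: "\<exists>e\<in>H. \<Phi> e < 0"
proof -
  obtain e0 y0 where e0: "e0 \<in> H" "y0 \<in> V" "e0 y0 \<noteq> 0" using H01_nontrivial by blast
  define e where "e = (if 0 < e0 y0 then e0 else - e0)"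
  have e: "e \<in> H" "0 < e y0" using e0 by (auto simp: e_def)
  obtain A d where A: "A \<in> sets \<mu>" "0 < measure \<mu> A" "0 < d" "\<And>y. y \<in> A \<Longrightarrow> d \<le> e y"
    using support_\<mu>[OF H_cont[OF e(1)] e0(2) e(2)] by blast
  define J where "J = ip e e / 2 - (\<integral>y. a y * (e y * e y) \<partial>\<mu>) / 2"
  define c where "c = b1 * d\<^sup>2 * measure \<mu> A"
  have c: "0 < c" using b1 A by (simp add: c_def)
  define L where "L = (\<bar>J\<bar> + 1) / c"
  have L: "0 < L" "L * c = \<bar>J\<bar> + 1" using c by (auto simp: L_def)
  obtain T where T: "0 < T" "\<And>t. T \<le> t \<Longrightarrow> L * t\<^sup>2 \<le> F t" using F_large[of L] by blast
  define t where "t = T / d"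
  have t: "0 < t" "t * d = T" using T A by (auto simp: t_def)
  have te: "t *\<^sub>R e \<in> H" using e by simp
  have quad: "ip (t *\<^sub>R e) (t *\<^sub>R e) / 2 - (\<integral>y. a y * ((t *\<^sub>R e) y * (t *\<^sub>R e) y) \<partial>\<mu>) / 2 = t\<^sup>2 * J"
  proof -
    have "(\<integral>y. a y * ((t *\<^sub>R e) y * (t *\<^sub>R e) y) \<partial>\<mu>) = (\<integral>y. t\<^sup>2 * (a y * (e y * e y)) \<partial>\<mu>)"
      by (intro Bochner_Integration.integral_cong refl) (simp add: power2_eq_square mult_ac)
    also have "\<dots> = t\<^sup>2 * (\<integral>y. a y * (e y * e y) \<partial>\<mu>)" by simp
    finally show ?thesis
      using e by (simp add: J_def ip_scale_left ip_scale_right power2_eq_square right_diff_distrib)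
  qed
  have "(\<integral>y. b1 * (L * (t * d)\<^sup>2) * indicator A y \<partial>\<mu>) \<le> (\<integral>y. b y * F ((t *\<^sub>R e) y) \<partial>\<mu>)"
  proof (rule integral_mono_AE)
    show "integrable \<mu> (\<lambda>y. b1 * (L * (t * d)\<^sup>2) * indicator A y)"
      using A(1) finite_measure.emeasure_finite[OF finite_measure_\<mu>, of A]
      by (intro integrable_mult_right integrable_real_indicator) (auto simp: less_top)
    show "integrable \<mu> (\<lambda>y. b y * F ((t *\<^sub>R e) y))" by (rule integrable_bF[OF te])
    show "AE y in \<mu>. b1 * (L * (t * d)\<^sup>2) * indicator A y \<le> b y * F ((t *\<^sub>R e) y)"
      using b(2)
    proof eventually_elim
      case (elim y)
      show ?case
      proof (cases "y \<in> A")
        case True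
        have td: "t * d \<le> t * e y" using A(4)[OF True] t by (intro mult_left_mono) auto
        then have "T \<le> (t *\<^sub>R e) y" using t by simp
        then have "L * ((t *\<^sub>R e) y)\<^sup>2 \<le> F ((t *\<^sub>R e) y)" by (rule T(2))
        moreover have "L * (t * d)\<^sup>2 \<le> L * ((t *\<^sub>R e) y)\<^sup>2"
          using td L t T by (intro mult_left_mono power_mono) auto
        ultimately have "L * (t * d)\<^sup>2 \<le> F ((t *\<^sub>R e) y)" by linarith
        then have "b1 * (L * (t * d)\<^sup>2) \<le> b y * F ((t *\<^sub>R e) y)"
          using elim b1 L by (intro mult_mono) auto
        then show ?thesis using True by simp
      next
        case False
        then show ?thesis using elim b1 F_nonneg by simp
      qed
    qed
  qed
  also have "(\<integral>y. b1 * (L * (t * d)\<^sup>2) * indicator A y \<partial>\<mu>) = b1 * (L * (t * d)\<^sup>2) * measure \<mu> A"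
    using A(1) finite_measure.emeasure_finite[OF finite_measure_\<mu>, of A]
      sets.sets_into_space[OF A(1)] by (simp add: Int_absorb2)
  also have "\<dots> = t\<^sup>2 * (L * c)" by (simp add: c_def power_mult_distrib mult_ac)
  finally have "\<Phi> (t *\<^sub>R e) \<le> t\<^sup>2 * J - t\<^sup>2 * (L * c)"
    unfolding \<Phi>_def quad by linarith
  also have "\<dots> = t\<^sup>2 * (J - \<bar>J\<bar> - 1)" by (simp add: L right_diff_distrib distrib_left)
  also have "\<dots> < 0" using t by (intro mult_pos_neg) auto
  finally show ?thesis using te by blast
qed

theorem nontrivial_solution:
  "\<exists>x\<in>H. (\<forall>v\<in>H. ip x v - lin x v = 0) \<and> (\<exists>y\<in>V. x y \<noteq> 0)"
proof -
  obtain \<rho> where \<rho>: "0 < \<rho>" "\<forall>x\<in>H. nrm x \<le> \<rho> \<longrightarrow> 1 / 4 * (nrm x)\<^sup>2 \<le> \<Phi> x" using near_zero by blast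
  obtain e where e: "e \<in> H" "\<Phi> e < 0" using far_away by blast
  have "ip 0 0 = 0" using nrm_sq[of 0] by simp
  then have "\<Phi> 0 = 0" by (simp add: \<Phi>_def F_0)
  have "\<exists>x\<in>H. nrm (grad x) = 0 \<and> nrm x \<noteq> 0"
  proof (rule mountain_pass[where \<Phi> = \<Phi> and g = grad and \<rho> = \<rho> and ?c0.0 = "1 / 4" and e = e, rotated 10])
    show "\<exists>x\<in>H. \<exists>r. strict_mono r \<and> (\<lambda>n. nrm (X (r n) - x)) \<longlonglongrightarrow> 0"
      if "\<And>n. X n \<in> H" "\<And>n. nrm (X n) \<le> R" "(\<lambda>n. nrm (grad (X n))) \<longlonglongrightarrow> 0" for X R
      using that by (rule palais_smale)
  qed (use grad(1) first_order grad_cont \<rho> e AR_bounded \<open>\<Phi> 0 = 0\<close> in auto)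
  then obtain x where x: "x \<in> H" "nrm (grad x) = 0" "nrm x \<noteq> 0" by blast
  have "ip x v - lin x v = 0" if "v \<in> H" for v
    using Cauchy_Schwarz[OF grad(1)[OF x(1)] that] x(2) grad(2)[OF x(1) that] by simp
  moreover have "\<exists>y\<in>V. x y \<noteq> 0"
  proof (rule ccontr)
    assume "\<not> ?thesis"
    then have z: "x y = 0 y" if "y \<in> V" for y using that by auto
    have "W m x x = W m 0 0" for m by (rule W_cong) (rule z, assumption)+
    then have "ip x x = ip 0 0" by (simp add: energy_form_def)
    with \<open>ip 0 0 = 0\<close> x show False by (simp add: nrm_def)
  qed
  ultimately show ?thesis using x(1) by blast
qed

end

section \<open>Existence of a nontrivial solution\<close>

lemma integral_function_derivative:
  fixes f :: "real \<Rightarrow> real"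
  assumes f: "continuous_on UNIV f"
  shows "((\<lambda>u. LBINT y=ereal 0..ereal u. f y) has_real_derivative f t) (at t)"
proof -
  define a b where "a = - \<bar>t\<bar> - 1" and "b = \<bar>t\<bar> + 1"
  have "((\<lambda>u. LBINT y=ereal 0..ereal u. f y) has_vector_derivative f t) (at t within {a..b})"
    by (rule interval_integral_FTC2) (use f in \<open>auto simp: a_def b_def intro: continuous_on_subset\<close>)
  moreover have "a < t" "t < b" unfolding a_def b_def by linarith+
  then have "at t within {a..b} = at t" by (intro at_within_interior) simp
  ultimately show ?thesis
    by (simp only: has_real_derivative_iff_has_vector_derivative)
qed

lemma square_integrable_diff:
  assumes "square_integrable M u" "square_integrable M v"
  shows "integrable M (\<lambda>y. (u y - v y)\<^sup>2)"
proof -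
  have m: "u \<in> borel_measurable M" "v \<in> borel_measurable M"
    and i: "integrable M (\<lambda>y. (u y)\<^sup>2)" "integrable M (\<lambda>y. (v y)\<^sup>2)"
    using assms by (auto simp: square_integrable_def)
  have "integrable M (\<lambda>y. 2 * (u y)\<^sup>2 + 2 * (v y)\<^sup>2)" using i by simp
  then show ?thesis
  proof (rule Bochner_Integration.integrable_bound)
    show "(\<lambda>y. (u y - v y)\<^sup>2) \<in> borel_measurable M" using m by simp
    have "(x - z)\<^sup>2 \<le> 2 * x\<^sup>2 + 2 * z\<^sup>2" for x z :: real
      using zero_le_power2[of "x + z"] by (simp add: power2_eq_square algebra_simps)
    then show "AE y in M. norm ((u y - v y)\<^sup>2) \<le> norm (2 * (u y)\<^sup>2 + 2 * (v y)\<^sup>2)"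
      by simp
  qed
qed

text \<open>
  The excess of \<open>\<bar>v\<bar>\<close> over \<open>B\<close> is at most \<open>\<bar>u m - v\<bar>\<close> almost everywhere, so its \<open>L\<^sup>2\<close> norm is \<open>0\<close>.
\<close>

lemma AE_bound_of_l2_limit:
  assumes u: "\<And>m. square_integrable M (u m)" "\<And>m. AE y in M. \<bar>u m y\<bar> \<le> B"
    and v: "square_integrable M v" and lim: "(\<lambda>m. l2_norm M (\<lambda>y. u m y - v y)) \<longlonglongrightarrow> 0"
  shows "AE y in M. \<bar>v y\<bar> \<le> B"
proof -
  define w where "w y = (max 0 (\<bar>v y\<bar> - B))\<^sup>2" for y
  have wu: "AE y in M. w y \<le> (u m y - v y)\<^sup>2" for m
    using u(2)[of m]
  proof eventually_elim
    case (elim y)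
    then have "max 0 (\<bar>v y\<bar> - B) \<le> \<bar>u m y - v y\<bar>" by linarith
    then have "(max 0 (\<bar>v y\<bar> - B))\<^sup>2 \<le> \<bar>u m y - v y\<bar>\<^sup>2" by (intro power_mono) auto
    then show ?case by (simp add: w_def)
  qed
  have wm: "w \<in> borel_measurable M"
  proof -
    have [measurable]: "v \<in> borel_measurable M" using v by (simp add: square_integrable_def)
    show ?thesis unfolding w_def by measurable
  qed
  have wi: "integrable M w"
  proof (rule Bochner_Integration.integrable_bound[OF square_integrable_diff[OF u(1)[of 0] v] wm])
    show "AE y in M. norm (w y) \<le> norm ((u 0 y - v y)\<^sup>2)"
      using wu[of 0] by eventually_elim (simp add: w_def)
  qed
  have le: "(\<integral>y. w y \<partial>M) \<le> (l2_norm M (\<lambda>y. u m y - v y))\<^sup>2" for m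
  proof -
    have "(\<integral>y. w y \<partial>M) \<le> (\<integral>y. (u m y - v y)\<^sup>2 \<partial>M)"
      by (rule integral_mono_AE[OF wi square_integrable_diff[OF u(1) v] wu])
    also have "\<dots> = (l2_norm M (\<lambda>y. u m y - v y))\<^sup>2" by (simp add: l2_norm_def)
    finally show ?thesis .
  qed
  have "(\<lambda>m. (l2_norm M (\<lambda>y. u m y - v y))\<^sup>2) \<longlonglongrightarrow> 0\<^sup>2"
    by (intro tendsto_intros lim)
  then have "(\<integral>y. w y \<partial>M) \<le> 0\<^sup>2"
    by (rule LIMSEQ_le_const) (use le in blast)
  then have "(\<integral>y. w y \<partial>M) \<le> 0" by simp
  moreover have "0 \<le> (\<integral>y. w y \<partial>M)" by (rule integral_nonneg_AE) (simp add: w_def)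
  ultimately have "(\<integral>y. w y \<partial>M) = 0" by simp
  then have "AE y in M. w y = 0"
    by (subst (asm) integral_nonneg_eq_0_iff_AE[OF wi]) (auto simp: w_def)
  then show ?thesis by eventually_elim (auto simp: w_def max_def split: if_splits)
qed

lemma (in complete_measure) measurable_AE_eq:
  assumes f: "f \<in> borel_measurable M" and ae: "AE y in M. f y = g y"
  shows "g \<in> borel_measurable M"
proof (rule measurableI)
  fix A :: "'b::topological_space set" assume A: "A \<in> sets borel"
  show "g -` A \<inter> space M \<in> sets M"
  proof (rule in_sets_AE[OF _ measurable_sets[OF f A]])
    show "AE y in M. y \<in> f -` A \<inter> space M \<longleftrightarrow> y \<in> g -` A \<inter> space M"
      using ae by eventually_elim simp
  qed simp
qed simp

theorem theorem9:
  fixes N :: nat and p :: "nat \<Rightarrow> real ^ 'n"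
    and M :: real and f h F :: "real \<Rightarrow> real"
    and a :: "real ^ 'n \<Rightarrow> real"
    and g u :: "nat \<Rightarrow> real ^ 'n \<Rightarrow> real" and g0 u0 :: "real ^ 'n \<Rightarrow> real"
    and g1 g2 h1 h2 \<epsilon> c M1 :: real and \<theta> \<beta> :: "nat \<Rightarrow> real"
  defines "V \<equiv> gasket N p" and "\<mu> \<equiv> gasket_measure N p"
  assumes N: "N \<ge> 2" and dim: "CARD('n) = N - 1"
    and p: "\<And>i j. i \<in> {1..N} \<Longrightarrow> j \<in> {1..N} \<Longrightarrow> i \<noteq> j \<Longrightarrow> norm (p i - p j) = 1"
    and M: "M > 0"
    and f: "continuous_on UNIV f"
    and h: "continuous_on {-M..M} h" "\<And>t. t \<in> {-M..M} \<Longrightarrow> 0 \<le> h t"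
    and F: "\<And>\<xi>. F \<xi> = (LBINT t=ereal 0..ereal \<xi>. f t)"
    and g: "\<And>m. continuous_on V (g m)"
    and u: "\<And>m. square_integrable \<mu> (u m)" "\<And>m. AE y in \<mu>. \<bar>u m y\<bar> \<le> M"
    and A1: "integrable \<mu> a" "AE y in \<mu>. a y \<le> 0"
    and A2: "g1 > 0" "g2 > 0" "\<And>m y. y \<in> V \<Longrightarrow> g1 \<le> g m y \<and> g m y \<le> g2"
      "h1 > 0" "h2 > 0" "\<And>t. t \<in> {-M..M} \<Longrightarrow> h1 \<le> h t \<and> h t \<le> h2"
    and A3: "\<epsilon> > 0" "\<And>m. \<theta> m > 2 + \<epsilon>"
      "\<And>m t. t \<noteq> 0 \<Longrightarrow> 0 < \<theta> m * F t \<and> \<theta> m * F t \<le> t * f t"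
      "c > 0" "\<And>m. 1 / 2 - 1 / \<theta> m \<ge> c"
    and A4: "M1 > 0" "\<And>m. \<beta> m > 0"
      "\<And>m y t s. y \<in> V \<Longrightarrow> \<bar>t\<bar> \<le> M1 \<Longrightarrow> \<bar>s\<bar> \<le> M \<Longrightarrow>
         \<bar>g m y * f t * h s\<bar> \<le> M1 / (2 * (\<beta> m + 1) * (2 * real N + 3)\<^sup>2)"
    and g_lim: "continuous_on V g0" "uniform_limit V g g0 sequentially"
    and u_lim: "square_integrable \<mu> u0" "(\<lambda>m. l2_norm \<mu> (\<lambda>y. u m y - u0 y)) \<longlonglongrightarrow> 0"
  shows "\<exists>x. weak_solution N p a g0 f h u0 x \<and> (\<exists>y\<in>V. x y \<noteq> 0)"
proof -
  interpret regular_simplex N p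
    by standard (use N p in auto)
  interpret complete_measure "gasket_measure N p"
    by standard (rule complete_\<mu>)
  \<comment> \<open>Each \<open>\<theta> m\<close> serves as the exponent of the growth condition; the first one is taken.\<close>
  define \<theta>0 where "\<theta>0 = \<theta> 0"
  interpret ambrosetti_rabinowitz f F \<theta>0
  proof
    show "continuous_on UNIV f" by (rule f)
    have "F = (\<lambda>u. LBINT y=ereal 0..ereal u. f y)" by (rule HOL.ext) (rule F)
    then show "(F has_real_derivative f t) (at t)" for t
      using integral_function_derivative[OF f, of t] by (simp only:)
    show "F 0 = 0" by (simp add: F)
    show th: "2 < \<theta>0" using A3(1) A3(2)[of 0] by (simp add: \<theta>0_def)
    show "0 < F t \<and> \<theta>0 * F t \<le> t * f t" if "t \<noteq> 0" for t
      using A3(3)[OF that, of 0] th by (simp add: \<theta>0_def zero_less_mult_iff)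
  qed
  have g0: "g1 \<le> g0 y \<and> g0 y \<le> g2" if "y \<in> V" for y
  proof -
    have lim: "(\<lambda>m. g m y) \<longlonglongrightarrow> g0 y" by (rule tendsto_uniform_limitI[OF g_lim(2) that])
    show ?thesis
      using LIMSEQ_le_const[OF lim, of g1] LIMSEQ_le_const2[OF lim, of g2] A2(3)[OF that] by blast
  qed
  have u0: "AE y in \<mu>. \<bar>u0 y\<bar> \<le> M"
    by (rule AE_bound_of_l2_limit[OF u u_lim])
  \<comment> \<open>A continuous extension of \<open>h\<close> beyond \<open>{-M..M}\<close>. Since \<open>hc \<circ> u0\<close> and \<open>h \<circ> u0\<close> agree almost everywhere,
    completeness of the measure makes the latter measurable.\<close>
  define hc where "hc t = h (max (- M) (min M t))" for t
  have "continuous_on UNIV (\<lambda>t. max (- M) (min M t))"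
    by (intro continuous_on_max continuous_on_min continuous_on_const continuous_on_id)
  then have "continuous_on UNIV hc"
    unfolding hc_def by (rule continuous_on_compose2[OF h(1)]) (use M in auto)
  then have "hc \<in> borel_measurable borel" by (rule borel_measurable_continuous_onI)
  moreover have "u0 \<in> borel_measurable \<mu>"
    using u_lim(1) unfolding square_integrable_def by (rule conjunct1)
  ultimately have "(\<lambda>y. hc (u0 y)) \<in> borel_measurable \<mu>"
    by (rule measurable_compose[rotated])
  moreover have "AE y in \<mu>. hc (u0 y) = h (u0 y)"
    using u0 by eventually_elim (simp add: hc_def abs_le_iff)
  ultimately have hm: "(\<lambda>y. h (u0 y)) \<in> borel_measurable \<mu>"
    unfolding \<mu>_def by (rule measurable_AE_eq)
  define b where "b y = g0 y * h (u0 y)" for y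
  interpret gasket_problem N p f F \<theta>0 a b "g1 * h1" "g2 * h2"
  proof
    show "integrable (gasket_measure N p) a" by (rule A1(1)[unfolded \<mu>_def])
    show "AE y in gasket_measure N p. a y \<le> 0" by (rule A1(2)[unfolded \<mu>_def])
    show "b \<in> borel_measurable (gasket_measure N p)"
      unfolding b_def
      by (rule borel_measurable_times[OF continuous_measurable[OF g_lim(1)[unfolded V_def]] hm[unfolded \<mu>_def]])
    show "AE y in gasket_measure N p. g1 * h1 \<le> b y \<and> b y \<le> g2 * h2"
      using u0 AE_space unfolding \<mu>_def
    proof eventually_elim
      case (elim y)
      then have "y \<in> V" by (simp add: V_def)
      from g0[OF this] A2(6)[of "u0 y"] elim A2(1,2,4,5) show ?case
        unfolding b_def by (intro conjI mult_mono) (auto simp: abs_le_iff)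
    qed
    show "0 < g1 * h1" using A2 by simp
  qed
  obtain x where x: "x \<in> H01 N p" "\<forall>v\<in>H01 N p. energy_form N p x v - lin x v = 0" "\<exists>y\<in>gasket N p. x y \<noteq> 0"
    using nontrivial_solution by blast
  have "weak_solution N p a g0 f h u0 x"
    unfolding weak_solution_def
  proof (intro conjI ballI x(1))
    fix v assume "v \<in> H01 N p"
    with x(2) have "energy_form N p x v - lin x v = 0" by blast
    then show "energy_form N p x v - (\<integral>y. a y * x y * v y \<partial>gasket_measure N p)
        - (\<integral>y. g0 y * f (x y) * h (u0 y) * v y \<partial>gasket_measure N p) = 0"
      by (simp add: lin_def b_def mult_ac)
  qed
  with x(3) show ?thesis unfolding V_def by blast
qed

end
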